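(* Let $1<q<\infty$. Assume that $|F|\in L^q_{\mathrm{loc}}(\Omega_T)$ and that $u\in L^q_{\mathrm{loc}}(0,T;W^{1,q}_{\mathrm{loc}}(\Omega;\mathbb{R}^N))$ satisfies $$\iint_{\Omega_T}\bigl(-u\cdot\varphi_t+\mathcal{A}(z,\nabla u)\cdot\nabla\varphi\bigr)\,dz=\iint_{\Omega_T}F\cdot\nabla\varphi\,dz$$ for every $\varphi\in C_0^\infty(\Omega_T;\mathbb{R}^N)$. Then there exists a constant $c=c(n,q,L)$ such that $$\frac1{|I|}\int_I|u(x,t)-u_I(x)|^q\,dt\le c\,|I|^{\frac q2}\,\frac1{|I|}\int_I M^*g(x,t)^q\,dt,\qquad g=(|\nabla u|+|F|)1_{2Q},$$ for every parabolic cylinder $Q=Q_\rho=B\times I$ such that $2Q\Subset\Omega_T$ and almost every $x\in B$.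
   Context: $\Omega\subset\mathbb{R}^n$, $n\ge1$, is a bounded open domain, $T>0$, $\Omega_T=\Omega\times(0,T)$, $N\ge1$, $0<\nu<L<\infty$. $\mathcal{A}:\Omega_T\times\mathbb{R}^{Nn}\to\mathbb{R}^{Nn}$ is a Carathéodory vector field ($\mathcal{A}(\cdot,\xi)$ measurable for every $\xi$, $\mathcal{A}(z,\cdot)$ continuous for a.e. $z$) with $\nu|\xi|^2\le\mathcal{A}(z,\xi)\cdot\xi$ and $|\mathcal{A}(z,\xi)|\le L|\xi|$ for a.e. $z\in\Omega_T$ and every $\xi\in\mathbb{R}^{Nn}$. $F:\Omega_T\to\mathbb{R}^{Nn}$ is measurable. We write $z=(x,t)$, $dz=dx\,dt$, and $\nabla$ is the gradient in $x$. $u\in L^q_{\mathrm{loc}}(0,T;W^{1,q}_{\mathrm{loc}}(\Omega;\mathbb{R}^N))$ means that for all $\Omega'\Subset\Omega$ and $0<t_1<t_2<T$ one has $u(\cdot,t)\in W^{1,q}(\Omega';\mathbb{R}^N)$ for a.e. $t\in(t_1,t_2)$ and $\int_{t_1}^{t_2}\int_{\Omega'}(|u|^q+|\nabla u|^q)\,dx\,dt<\infty$. Parabolic cylinders: $Q_\rho=B\times I$ with $B=B_\rho(x_0)$, $I=(t_0-\rho^2,t_0+\rho^2)$, and $2Q_\rho=B_{2\rho}(x_0)\times(t_0-(2\rho)^2,t_0+(2\rho)^2)$. $2Q\Subset\Omega_T$ means that the closure of $2Q$ is a compact subset of $\Omega_T$. $u_I(x)=\frac1{|I|}\int_I u(x,t)\,dt$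 (componentwise). The function $g$ is extended by zero outside $2Q$. The strong maximal function of $f\in L^1_{\mathrm{loc}}(\mathbb{R}^{n+1})$ is $M^*f(z)=\sup\frac1{|B'\times I'|}\iint_{B'\times I'}|f|\,d\zeta$, the supremum taken over all cylinders $B'\times I'\ni z$ with $B'\subset\mathbb{R}^n$ an open ball and $I'\subset\mathbb{R}$ a bounded open interval (radius and length independent of each other). *)

theory Defs
  imports "HOL-Analysis.Analysis"
begin

section \<open>Tuples of length N\<close>

text \<open>
  The target dimension N is a natural number rather than a type, so that a constant can be
  chosen before N. Following \<^const>\<open>Euclidean_space\<close>, R^N and R^(Nn) are the functions on nat,
  with values in real and real^'n respectively, that vanish from N on. On these sets
  the product topology of the function type is the Euclidean topology.
\<close>

definition tuples :: "nat \<Rightarrow> (nat \<Rightarrow> 'b::zero) set" where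
  "tuples N = {v. \<forall>i\<ge>N. v i = 0}"

lemma tuples_real: "tuples N = topspace (Euclidean_space N)"
  by (simp add: tuples_def topspace_Euclidean_space)

definition tinner :: "nat \<Rightarrow> (nat \<Rightarrow> 'b::real_inner) \<Rightarrow> (nat \<Rightarrow> 'b) \<Rightarrow> real" where
  "tinner N v w = (\<Sum>i<N. v i \<bullet> w i)"

definition tnorm :: "nat \<Rightarrow> (nat \<Rightarrow> 'b::real_normed_vector) \<Rightarrow> real" where
  "tnorm N v = L2_set (\<lambda>i. norm (v i)) {..<N}"

definition tmeasurable_on ::
    "nat \<Rightarrow> 'a::euclidean_space set \<Rightarrow> ('a \<Rightarrow> nat \<Rightarrow> 'b::euclidean_space) \<Rightarrow> bool" where
  "tmeasurable_on N S f \<longleftrightarrow> (\<forall>i<N. (\<lambda>z. f z i) \<in> borel_measurable (lebesgue_on S))"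

section \<open>Averages and the strong maximal function\<close>

definition nn_mean :: "'a::euclidean_space set \<Rightarrow> ('a \<Rightarrow> ennreal) \<Rightarrow> ennreal" where
  "nn_mean S f = (\<integral>\<^sup>+z\<in>S. f z \<partial>lebesgue) / emeasure lebesgue S"

definition mean :: "'a::euclidean_space set \<Rightarrow> ('a \<Rightarrow> real) \<Rightarrow> real" where
  "mean S f = (LINT z:S|lebesgue. f z) / measure lebesgue S"

text \<open>Real powers of extended nonnegative reals; only meaningful for positive exponents.\<close>

definition ennpowr :: "ennreal \<Rightarrow> real \<Rightarrow> ennreal" where
  "ennpowr a q = (if a = \<infinity> then \<infinity> else ennreal (enn2real a powr q))"

definition strong_maximal :: "('a::euclidean_space \<times> real \<Rightarrow> real) \<Rightarrow> 'a \<times> real \<Rightarrow> ennreal" where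
  "strong_maximal f z =
     (SUP S \<in> {ball y r \<times> {a<..<b} | y r a b. z \<in> ball y r \<times> {a<..<b}}.
        nn_mean S (\<lambda>\<zeta>. ennreal \<bar>f \<zeta>\<bar>))"

section \<open>Test functions and derivatives\<close>

primrec times_differentiable :: "nat \<Rightarrow> ('a::euclidean_space \<Rightarrow> real) \<Rightarrow> bool" where
  "times_differentiable 0 f \<longleftrightarrow> continuous_on UNIV f"
| "times_differentiable (Suc k) f \<longleftrightarrow>
     (\<forall>x. f differentiable (at x)) \<and>
     (\<forall>v. times_differentiable k (\<lambda>x. frechet_derivative f (at x) v))"

definition test_function :: "'a::euclidean_space set \<Rightarrow> ('a \<Rightarrow> real) \<Rightarrow> bool" where
  "test_function U \<phi> \<longleftrightarrow>
     (\<forall>k. times_differentiable k \<phi>) \<and>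
     compact (closure {x. \<phi> x \<noteq> 0}) \<and> closure {x. \<phi> x \<noteq> 0} \<subseteq> U"

definition test_tuple ::
    "nat \<Rightarrow> 'a::euclidean_space set \<Rightarrow> ('a \<Rightarrow> nat \<Rightarrow> real) \<Rightarrow> bool" where
  "test_tuple N U \<phi> \<longleftrightarrow>
     (\<forall>z. \<phi> z \<in> tuples N) \<and> (\<forall>i<N. test_function U (\<lambda>z. \<phi> z i))"

definition grad :: "(real^'n \<Rightarrow> real) \<Rightarrow> real^'n \<Rightarrow> real^'n" where
  "grad f x = (\<chi> j. frechet_derivative f (at x) (axis j 1))"

definition space_grad :: "((real^'n) \<times> real \<Rightarrow> nat \<Rightarrow> real) \<Rightarrow> (real^'n) \<times> real \<Rightarrow> nat \<Rightarrow> real^'n" where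
  "space_grad \<phi> z i = grad (\<lambda>y. \<phi> (y, snd z) i) (fst z)"

definition time_deriv :: "((real^'n) \<times> real \<Rightarrow> nat \<Rightarrow> real) \<Rightarrow> (real^'n) \<times> real \<Rightarrow> nat \<Rightarrow> real" where
  "time_deriv \<phi> z i = deriv (\<lambda>s. \<phi> (fst z, s) i) (snd z)"

section \<open>Function spaces\<close>

definition compactly_contained :: "'a::topological_space set \<Rightarrow> 'a set \<Rightarrow> bool" where
  "compactly_contained U V \<longleftrightarrow> compact (closure U) \<and> closure U \<subseteq> V"

definition weak_gradient ::
    "(real^'n) set \<Rightarrow> (real^'n \<Rightarrow> real) \<Rightarrow> (real^'n \<Rightarrow> real^'n) \<Rightarrow> bool" where
  "weak_gradient U f G \<longleftrightarrow>
     (\<forall>\<phi>. test_function U \<phi> \<longrightarrow>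
        (LINT x:U|lebesgue. f x *\<^sub>R grad \<phi> x) = - (LINT x:U|lebesgue. \<phi> x *\<^sub>R G x))"

definition in_Lq ::
    "nat \<Rightarrow> real \<Rightarrow> 'a::euclidean_space set \<Rightarrow> ('a \<Rightarrow> nat \<Rightarrow> 'b::euclidean_space) \<Rightarrow> bool" where
  "in_Lq N q S f \<longleftrightarrow>
     tmeasurable_on N S f \<and> (\<integral>\<^sup>+z\<in>S. ennreal (tnorm N (f z) powr q) \<partial>lebesgue) < \<infinity>"

definition in_Lq_loc ::
    "nat \<Rightarrow> real \<Rightarrow> 'a::euclidean_space set \<Rightarrow> ('a \<Rightarrow> nat \<Rightarrow> 'b::euclidean_space) \<Rightarrow> bool" where
  "in_Lq_loc N q S f \<longleftrightarrow> (\<forall>K. compact K \<and> K \<subseteq> S \<longrightarrow> in_Lq N q K f)"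

text \<open>f belongs to W^(1,q)(U; R^N), and G represents its weak gradient.\<close>

definition W1q_with_gradient ::
    "nat \<Rightarrow> real \<Rightarrow> (real^'n) set \<Rightarrow> (real^'n \<Rightarrow> nat \<Rightarrow> real) \<Rightarrow> (real^'n \<Rightarrow> nat \<Rightarrow> real^'n) \<Rightarrow> bool" where
  "W1q_with_gradient N q U f G \<longleftrightarrow>
     in_Lq N q U f \<and> in_Lq N q U G \<and>
     (\<forall>i<N. weak_gradient U (\<lambda>x. f x i) (\<lambda>x. G x i))"

text \<open>
  u belongs to L^q_loc(0,T; W^(1,q)_loc(Omega; R^N)), and Du is a measurable representative,
  unique up to null sets, of its weak gradient in the space variable.
\<close>

definition Lq_loc_W1q_loc_with_gradient ::
    "nat \<Rightarrow> real \<Rightarrow> (real^'n) set \<Rightarrow> real \<Rightarrow>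
     ((real^'n) \<times> real \<Rightarrow> nat \<Rightarrow> real) \<Rightarrow> ((real^'n) \<times> real \<Rightarrow> nat \<Rightarrow> real^'n) \<Rightarrow> bool" where
  "Lq_loc_W1q_loc_with_gradient N q \<Omega> T u Du \<longleftrightarrow>
     u \<in> \<Omega> \<times> {0<..<T} \<rightarrow> tuples N \<and> Du \<in> \<Omega> \<times> {0<..<T} \<rightarrow> tuples N \<and>
     tmeasurable_on N (\<Omega> \<times> {0<..<T}) u \<and> tmeasurable_on N (\<Omega> \<times> {0<..<T}) Du \<and>
     (\<forall>\<Omega>' t1 t2. open \<Omega>' \<and> compactly_contained \<Omega>' \<Omega> \<and> 0 < t1 \<and> t1 < t2 \<and> t2 < T \<longrightarrow>
        (AE t in lebesgue_on {t1<..<t2}.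
           W1q_with_gradient N q \<Omega>' (\<lambda>x. u (x, t)) (\<lambda>x. Du (x, t))) \<and>
        (\<integral>\<^sup>+z\<in>\<Omega>' \<times> {t1<..<t2}.
           ennreal (tnorm N (u z) powr q + tnorm N (Du z) powr q) \<partial>lebesgue) < \<infinity>)"

section \<open>The parabolic system\<close>

definition caratheodory_field ::
    "nat \<Rightarrow> ((real^'n) \<times> real) set \<Rightarrow> ((real^'n) \<times> real \<Rightarrow> (nat \<Rightarrow> real^'n) \<Rightarrow> nat \<Rightarrow> real^'n) \<Rightarrow> bool" where
  "caratheodory_field N S A \<longleftrightarrow>
     (\<forall>z\<in>S. A z \<in> tuples N \<rightarrow> tuples N) \<and>
     (\<forall>\<xi>\<in>tuples N. tmeasurable_on N S (\<lambda>z. A z \<xi>)) \<and>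
     (AE z in lebesgue_on S. continuous_on (tuples N) (A z))"

definition structure_conditions ::
    "nat \<Rightarrow> real \<Rightarrow> real \<Rightarrow> ((real^'n) \<times> real) set \<Rightarrow>
     ((real^'n) \<times> real \<Rightarrow> (nat \<Rightarrow> real^'n) \<Rightarrow> nat \<Rightarrow> real^'n) \<Rightarrow> bool" where
  "structure_conditions N \<nu> L S A \<longleftrightarrow>
     (AE z in lebesgue_on S. \<forall>\<xi>\<in>tuples N.
        \<nu> * (tnorm N \<xi>)\<^sup>2 \<le> tinner N (A z \<xi>) \<xi> \<and> tnorm N (A z \<xi>) \<le> L * tnorm N \<xi>)"

definition weak_solution ::
    "nat \<Rightarrow> ((real^'n) \<times> real) set \<Rightarrow> ((real^'n) \<times> real \<Rightarrow> (nat \<Rightarrow> real^'n) \<Rightarrow> nat \<Rightarrow> real^'n) \<Rightarrow>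
     ((real^'n) \<times> real \<Rightarrow> nat \<Rightarrow> real^'n) \<Rightarrow>
     ((real^'n) \<times> real \<Rightarrow> nat \<Rightarrow> real) \<Rightarrow> ((real^'n) \<times> real \<Rightarrow> nat \<Rightarrow> real^'n) \<Rightarrow> bool" where
  "weak_solution N S A F u Du \<longleftrightarrow>
     (\<forall>\<phi>. test_tuple N S \<phi> \<longrightarrow>
        (LINT z:S|lebesgue.
           - tinner N (u z) (time_deriv \<phi> z) + tinner N (A z (Du z)) (space_grad \<phi> z))
        = (LINT z:S|lebesgue. tinner N (F z) (space_grad \<phi> z)))"

definition time_interval :: "real \<Rightarrow> real \<Rightarrow> real set" where
  "time_interval t0 \<rho> = {t0 - \<rho>\<^sup>2 <..< t0 + \<rho>\<^sup>2}"

definition cylinder :: "real^'n \<Rightarrow> real \<Rightarrow> real \<Rightarrow> ((real^'n) \<times> real) set" where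
  "cylinder x0 t0 \<rho> = ball x0 \<rho> \<times> time_interval t0 \<rho>"

definition time_mean :: "real set \<Rightarrow> ((real^'n) \<times> real \<Rightarrow> nat \<Rightarrow> real) \<Rightarrow> real^'n \<Rightarrow> nat \<Rightarrow> real" where
  "time_mean I u x i = mean I (\<lambda>t. u (x, t) i)"

end

theory Submission
  imports Defs
begin

text \<open>
  Fix x in B and two times s, t in I, where B has radius \<rho> and I has half-length \<rho>^2.
  The heart of the matter is the pointwise inequality |u(x,s) - u(x,t)| \<le> C \<rho> (M*g(x,s)
  + M*g(x,t)). To reach it, u(x,s) is compared with an average of u(.,s) over the ball of radius
  \<rho> about x, which costs \<rho> M*g(x,s) because only the spatial gradient enters; the
  averages at the times s and t are then compared by testing the system with a spatial bump
  times a function of time that climbs from 0 to a constant near s and returns to 0 near t. The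
  time derivative of u is thereby traded for A(z,Du) - F, which is at most (L + 1) g, one
  spatial derivative of the bump, of size 1/\<rho>, and a time span of order \<rho>^2; the cost
  is again of order \<rho> M*g. As the ball and the time interval shrink independently of each
  other, it is the strong maximal function that controls every one of these averages.

  All averages are averages in space and time with the product kernel bump((y - x)/r) bump((s -
  t)/\<tau>), so that the inequality holds at every point, without exceptional sets
  (avg_estimate). Changing r at fixed \<tau> is harmless because the r-derivative of the spatial
  kernel is a divergence (kernel_divergence). With r = \<tau> the average is a mollification of
  u, which converges almost everywhere along a subsequence (mollify_AE_subsequence), by
  continuity of translations in L^1.

  The constant must not depend on the number N of components. The estimates are therefore made
  for a scalar function: for every weight vector w of length at most 1 the function w.u solves a
  scalar equation whose gradient and flux are still bounded by g and (L + 1) g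
  (weighted_sum_scalar_equation), and taking the supremum over w restores the Euclidean norm.

  Finally, since |I| = 2 \<rho>^2, raising the pointwise inequality to the power q and averaging
  over s and t gives the claim (mean_oscillation_bound). The functions in the hypotheses are
  only Lebesgue measurable, so Borel representatives on 2Q are chosen before Fubini's theorem is
  applied; that A(z,Du(z)) is measurable at all is where the Caratheodory property enters
  (caratheodory_measurable).
\<close>

section \<open>Translations in L1 and mollification\<close>

lemma lborel_translate:
  fixes f :: "'a::euclidean_space \<Rightarrow> real"
  assumes "integrable lborel f"
  shows integrable_translate: "integrable lborel (\<lambda>z. f (z + h))"
    and integral_translate: "(LBINT z. f (z + h)) = (LBINT z. f z)"
proof -
  have [measurable]: "f \<in> borel_measurable borel" using assms by auto
  have "integrable (distr lborel borel ((+) h)) f"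
    using assms by (simp add: lborel_distr_plus)
  then show "integrable lborel (\<lambda>z. f (z + h))"
    by (subst (asm) integrable_distr_eq) (auto simp: add.commute)
  have "(LBINT z. f z) = (\<integral>z. f z \<partial>distr lborel borel ((+) h))"
    by (simp add: lborel_distr_plus)
  also have "\<dots> = (LBINT z. f (h + z))"
    by (subst integral_distr) auto
  finally show "(LBINT z. f (z + h)) = (LBINT z. f z)" by (simp add: add.commute)
qed

text \<open>
  Translation invariance of Lebesgue measure turns the error of replacing f by g at the shifted
  point into the error at the original point, whence the factor 2. This is the approximation
  step of the proof that translations are continuous in L1.
\<close>

lemma L1_translation_triangle:
  fixes f g :: "'a::euclidean_space \<Rightarrow> real"
  assumes f: "integrable lborel f" and g: "integrable lborel g"
  shows "(LBINT z. \<bar>f (z + h) - f z\<bar>) \<le>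
     2 * (LBINT z. \<bar>f z - g z\<bar>) + (LBINT z. \<bar>g (z + h) - g z\<bar>)"
proof -
  note i = f g integrable_translate[OF f] integrable_translate[OF g]
  have "(LBINT z. \<bar>f (z + h) - f z\<bar>) \<le>
     (LBINT z. \<bar>f (z+h) - g (z+h)\<bar> + \<bar>g (z + h) - g z\<bar> + \<bar>f z - g z\<bar>)"
    using i by (intro integral_mono integrable_abs Bochner_Integration.integrable_add
        Bochner_Integration.integrable_diff) auto
  also have "\<dots> = (LBINT z. \<bar>f (z+h) - g (z+h)\<bar>) +
      (LBINT z. \<bar>g (z + h) - g z\<bar>) + (LBINT z. \<bar>f z - g z\<bar>)"
    using f g integrable_translate[OF f, of h] integrable_translate[OF g, of h] by simp
  also have "(LBINT z. \<bar>f (z+h) - g (z+h)\<bar>) = (LBINT z. \<bar>f z - g z\<bar>)"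
    using integral_translate[of "\<lambda>z. \<bar>f z - g z\<bar>" h] f g by simp
  finally show ?thesis by simp
qed

text \<open>
  For open U of finite measure the indicator is lower semicontinuous, so the part of U that a
  small translation moves out of U tends to 0 by dominated convergence; the part that moves in
  has the same measure.
\<close>

lemma L1_translation_continuous_open:
  fixes U :: "'a::euclidean_space set"
  assumes U: "open U" "emeasure lborel U < \<infinity>" and h: "h \<longlonglongrightarrow> 0"
  shows "(\<lambda>k::nat. LBINT z. \<bar>indicator U (z + h k) - indicator U z :: real\<bar>) \<longlonglongrightarrow> 0"
proof -
  let ?f = "indicator U :: 'a \<Rightarrow> real"
  have [measurable]: "U \<in> sets borel" using U by auto
  have iU: "integrable lborel ?f"
    using U by (auto intro!: integrable_real_indicator)
  have iprod: "integrable lborel (\<lambda>z. ?f z * ?f (z + h k))" for k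
    by (rule Bochner_Integration.integrable_bound[OF iU]) (measurable, auto simp: indicator_def)
  \<comment> \<open>the mass lost and the mass gained by U under the translation are equal\<close>
  have eq: "(LBINT z. \<bar>?f (z + h k) - ?f z\<bar>) = 2 * (LBINT z. ?f z * (1 - ?f (z + h k)))" for k
  proof -
    have "(LBINT z. \<bar>?f (z + h k) - ?f z\<bar>) = (LBINT z. ?f (z + h k) + ?f z - 2 * (?f z * ?f (z + h k)))"
      by (rule Bochner_Integration.integral_cong) (auto simp: indicator_def)
    also have "\<dots> = 2 * (LBINT z. ?f z) - 2 * (LBINT z. ?f z * ?f (z + h k))"
      using iU iprod[of k] integrable_translate[OF iU, of "h k"] integral_translate[OF iU, of "h k"] by simp
    also have "\<dots> = 2 * (LBINT z. ?f z - ?f z * ?f (z + h k))"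
      using iU iprod[of k] by simp
    finally show ?thesis by (simp add: algebra_simps)
  qed
  have "(\<lambda>k. LBINT z. ?f z * (1 - ?f (z + h k))) \<longlonglongrightarrow> (\<integral>z. 0 \<partial>(lborel::'a measure))"
  proof (rule integral_dominated_convergence[where w = ?f])
    show "AE z in lborel. (\<lambda>k. ?f z * (1 - ?f (z + h k))) \<longlonglongrightarrow> 0"
    proof (rule AE_I2)
      fix z :: 'a
      show "(\<lambda>k. ?f z * (1 - ?f (z + h k))) \<longlonglongrightarrow> 0"
      proof (cases "z \<in> U")
        case True
        have "(\<lambda>k. z + h k) \<longlonglongrightarrow> z + 0" by (intro tendsto_intros h)
        then have "eventually (\<lambda>k. z + h k \<in> U) sequentially"
          using U(1) True by (auto simp: topological_tendstoD)
        then have "eventually (\<lambda>k. ?f z * (1 - ?f (z + h k)) = 0) sequentially"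
          by eventually_elim auto
        then show ?thesis by (rule tendsto_eventually)
      qed simp
    qed
  qed (use U iU in \<open>auto simp: indicator_def\<close>)
  then have "(\<lambda>k. 2 * (LBINT z. ?f z * (1 - ?f (z + h k)))) \<longlonglongrightarrow> 2 * 0"
    by (intro tendsto_mult_left) simp
  then show ?thesis unfolding eq by simp
qed

lemma L1_translation_continuous_if_approximable:
  fixes f :: "'a::euclidean_space \<Rightarrow> real"
  assumes f: "integrable lborel f"
    and approx: "\<And>e. e > 0 \<Longrightarrow> \<exists>g. integrable lborel g \<and> (LBINT z. \<bar>f z - g z\<bar>) < e \<and>
        (\<lambda>k::nat. LBINT z. \<bar>g (z + h k) - g z\<bar>) \<longlonglongrightarrow> 0"
  shows "(\<lambda>k. LBINT z. \<bar>f (z + h k) - f z\<bar>) \<longlonglongrightarrow> 0"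
proof (rule LIMSEQ_I)
  fix e :: real assume "e > 0"
  then obtain g where g: "integrable lborel g" "(LBINT z. \<bar>f z - g z\<bar>) < e / 4"
    and lim: "(\<lambda>k. LBINT z. \<bar>g (z + h k) - g z\<bar>) \<longlonglongrightarrow> 0"
    using approx[of "e/4"] by auto
  obtain K where K: "\<And>k. k \<ge> K \<Longrightarrow> norm ((LBINT z. \<bar>g (z + h k) - g z\<bar>) - 0) < e / 2"
    using LIMSEQ_D[OF lim, of "e/2"] \<open>e > 0\<close> by auto
  have "norm ((LBINT z. \<bar>f (z + h k) - f z\<bar>) - 0) < e" if "k \<ge> K" for k
  proof -
    have "(LBINT z. \<bar>g (z + h k) - g z\<bar>) < e / 2"
      using K[OF that] by (metis abs_less_iff diff_zero real_norm_def)
    moreover have "(LBINT z. \<bar>f (z + h k) - f z\<bar>) \<ge> 0" by simp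
    ultimately show ?thesis
      using L1_translation_triangle[OF f g(1), of "h k"] g(2) by simp
  qed
  then show "\<exists>no. \<forall>n\<ge>no. norm ((LBINT z. \<bar>f (z + h n) - f z\<bar>) - 0) < e" by blast
qed

text \<open>
  Translations act continuously on L1. Every integrable function is reached from indicators by
  sums and dominated limits, and a measurable set of finite measure is approximated from outside
  by open ones.
\<close>

lemma L1_translation_continuous:
  fixes f :: "'a::euclidean_space \<Rightarrow> real"
  assumes f: "integrable lborel f" and h: "h \<longlonglongrightarrow> 0"
  shows "(\<lambda>k::nat. LBINT z. \<bar>f (z + h k) - f z\<bar>) \<longlonglongrightarrow> 0"
  using f
proof (induction rule: integrable_induct)
  case (base A c)
  let ?f = "\<lambda>z. indicator A z *\<^sub>R c"
  have iA: "integrable lborel ?f" using base by simp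
  show ?case
  proof (rule L1_translation_continuous_if_approximable[OF iA])
    fix e :: real assume e: "e > 0"
    define d where "d = e / (\<bar>c\<bar> + 1)"
    have d: "d > 0" "d * \<bar>c\<bar> < e" using e by (auto simp: d_def field_simps)
    obtain U where U: "open U" "A \<subseteq> U" "emeasure lborel (U - A) < ennreal d"
      using outer_regular_lborel[of A d] base d by auto
    have UA: "U = A \<union> (U - A)" using U by auto
    have [measurable]: "A \<in> sets borel" using base by auto
    have "emeasure lborel U = emeasure lborel A + emeasure lborel (U - A)"
      using plus_emeasure[of A lborel "U - A"] UA[symmetric] U(1) by simp
    also have "\<dots> < \<infinity>"
      using base(2) less_trans[OF U(3) ennreal_less_top] by simp
    finally have fin: "emeasure lborel U < \<infinity>" .
    let ?g = "\<lambda>z. indicator U z * c"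
    have "integrable lborel ?g" using U(1) fin by simp
    moreover have "(LBINT z. \<bar>?f z - ?g z\<bar>) < e"
    proof -
      have "(LBINT z. \<bar>?f z - ?g z\<bar>) = (LBINT z. \<bar>c\<bar> * indicator (U - A) z)"
        using U(2) by (intro Bochner_Integration.integral_cong) (auto simp: indicator_def)
      also have "\<dots> = \<bar>c\<bar> * measure lborel (U - A)"
        by simp
      also have "\<dots> \<le> \<bar>c\<bar> * d"
        using U(3) d(1) by (intro mult_left_mono) (auto simp: measure_def enn2real_leI)
      finally show ?thesis using d(2) by (simp add: mult.commute)
    qed
    moreover have "(\<lambda>k. LBINT z. \<bar>?g (z + h k) - ?g z\<bar>) \<longlonglongrightarrow> 0"
    proof -
      have "(\<lambda>k. (LBINT z. \<bar>indicator U (z + h k) - indicator U z :: real\<bar>) * \<bar>c\<bar>) \<longlonglongrightarrow> 0 * \<bar>c\<bar>"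
        by (intro tendsto_mult_right L1_translation_continuous_open U fin h)
      then show ?thesis
        by (simp add: left_diff_distrib[symmetric] abs_mult)
    qed
    ultimately show "\<exists>g. integrable lborel g \<and> (LBINT z. \<bar>?f z - g z\<bar>) < e \<and>
        (\<lambda>k. LBINT z. \<bar>g (z + h k) - g z\<bar>) \<longlonglongrightarrow> 0"
      by blast
  qed
next
  case (add f g)
  have "(\<lambda>k. (LBINT z. \<bar>f (z + h k) - f z\<bar>) + (LBINT z. \<bar>g (z + h k) - g z\<bar>)) \<longlonglongrightarrow> 0 + 0"
    by (intro tendsto_add add.IH)
  then have lim: "(\<lambda>k. (LBINT z. \<bar>f (z + h k) - f z\<bar>) + (LBINT z. \<bar>g (z + h k) - g z\<bar>)) \<longlonglongrightarrow> 0"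
    by simp
  show ?case
  proof (rule Lim_null_comparison[OF _ lim])
    have "(LBINT z. \<bar>f (z + h k) + g (z + h k) - (f z + g z)\<bar>) \<le>
       (LBINT z. \<bar>f (z + h k) - f z\<bar>) + (LBINT z. \<bar>g (z + h k) - g z\<bar>)" for k
    proof -
      note i = add.hyps(1,2) integrable_translate[OF add.hyps(1), of "h k"] integrable_translate[OF add.hyps(2), of "h k"]
      have "(LBINT z. \<bar>f (z + h k) + g (z + h k) - (f z + g z)\<bar>) \<le>
         (LBINT z. \<bar>f (z + h k) - f z\<bar> + \<bar>g (z + h k) - g z\<bar>)"
        using i by (intro integral_mono integrable_abs Bochner_Integration.integrable_add
            Bochner_Integration.integrable_diff) auto
      then show ?thesis using i by simp
    qed
    then show "\<forall>\<^sub>F k in sequentially. norm (LBINT z. \<bar>f (z + h k) + g (z + h k) - (f z + g z)\<bar>)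
       \<le> (LBINT z. \<bar>f (z + h k) - f z\<bar>) + (LBINT z. \<bar>g (z + h k) - g z\<bar>)"
      by (intro always_eventually) simp
  qed
next
  case (lim f s)
  have "(\<lambda>i. LBINT z. \<bar>f z - s i z\<bar>) \<longlonglongrightarrow> (\<integral>z. 0 \<partial>(lborel::'a measure))"
  proof (rule integral_dominated_convergence[where w = "\<lambda>z. 3 * \<bar>f z\<bar>"])
    show "AE z in lborel. (\<lambda>i. \<bar>f z - s i z\<bar>) \<longlonglongrightarrow> 0"
    proof (rule AE_I2)
      fix z :: 'a
      have "(\<lambda>i. \<bar>f z - s i z\<bar>) \<longlonglongrightarrow> \<bar>f z - f z\<bar>"
        using lim.hyps by (intro tendsto_intros) auto
      then show "(\<lambda>i. \<bar>f z - s i z\<bar>) \<longlonglongrightarrow> 0" by simp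
    qed
    have "\<bar>f z - s i z\<bar> \<le> 3 * \<bar>f z\<bar>" for i z
      using lim.hyps(3)[of z i] by simp
    then show "AE z in lborel. norm \<bar>f z - s i z\<bar> \<le> 3 * \<bar>f z\<bar>" for i
      by simp
  qed (use lim.hyps in auto)
  then have L: "(\<lambda>i. LBINT z. \<bar>f z - s i z\<bar>) \<longlonglongrightarrow> 0" by simp
  show ?case
  proof (rule L1_translation_continuous_if_approximable[OF lim.hyps(4)])
    fix e :: real assume "e > 0"
    then have "eventually (\<lambda>i. (LBINT z. \<bar>f z - s i z\<bar>) < e) sequentially"
      by (intro order_tendstoD(2)[OF L])
    then obtain i where "(LBINT z. \<bar>f z - s i z\<bar>) < e"
      by (meson eventually_sequentially order_refl)
    then show "\<exists>g. integrable lborel g \<and> (LBINT z. \<bar>f z - g z\<bar>) < e \<and>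
        (\<lambda>k. LBINT z. \<bar>g (z + h k) - g z\<bar>) \<longlonglongrightarrow> 0"
      using lim.hyps(1) lim.IH by blast
  qed
qed

text \<open>
  The kernel need not have integral 1: mollification converges to the function times the
  integral of the kernel.
\<close>

definition mollify :: "('a::euclidean_space \<Rightarrow> real) \<Rightarrow> real \<Rightarrow> ('a \<Rightarrow> real) \<Rightarrow> 'a \<Rightarrow> real" where
  "mollify K e f z = (LBINT \<zeta>. f \<zeta> * K ((\<zeta> - z) /\<^sub>R e) / e ^ DIM('a))"

lemma mollify_rescale:
  fixes f :: "'a::euclidean_space \<Rightarrow> real"
  assumes fm[measurable]: "f \<in> borel_measurable borel" and Km[measurable]: "K \<in> borel_measurable borel" and e: "e > 0"
  shows "mollify K e f z = (LBINT y. f (z + e *\<^sub>R y) * K y)"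
proof -
  have "mollify K e f z = (\<integral>\<zeta>. f \<zeta> * K ((\<zeta> - z) /\<^sub>R e) / e ^ DIM('a)
      \<partial>density (distr lborel borel (\<lambda>x. z + e *\<^sub>R x)) (\<lambda>_. ennreal (\<bar>e\<bar> ^ DIM('a))))"
    unfolding mollify_def using e by (subst lborel_affine[of e z]) auto
  also have "\<dots> = (LBINT y. e ^ DIM('a) * (f (z + e *\<^sub>R y) * K ((z + e *\<^sub>R y - z) /\<^sub>R e) / e ^ DIM('a)))"
    using e by (subst integral_density, simp_all, subst integral_distr) auto
  also have "\<dots> = (LBINT y. f (z + e *\<^sub>R y) * K y)"
    using e by simp
  finally show ?thesis .
qed

text \<open>
  After rescaling, the error at z is an average over y, with weight K y, of f(z + e y) - f(z), e
  being the scale. Integrating in z first (Tonelli) leaves the L1 distance between f and its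
  translate by e y, which tends to 0 for each y and is bounded by twice the norm of f.
\<close>

lemma mollify_tendsto_L1:
  fixes f :: "'a::euclidean_space \<Rightarrow> real"
  assumes f: "integrable lborel f" and K: "integrable lborel K" "\<And>y. 0 \<le> K y" "\<And>y. K y \<le> B"
    and e: "\<And>k. e k > 0" "e \<longlonglongrightarrow> 0"
  shows "(\<lambda>k::nat. LBINT z. \<bar>mollify K (e k) f z - integral\<^sup>L lborel K * f z\<bar>) \<longlonglongrightarrow> 0"
    and "integrable lborel (\<lambda>z. mollify K (e k) f z - integral\<^sup>L lborel K * f z)"
proof -
  let ?I = "\<lambda>k z. \<integral>\<^sup>+y. ennreal (K y * \<bar>f (z + e k *\<^sub>R y) - f z\<bar>) \<partial>lborel"
  let ?E = "\<lambda>k z. mollify K (e k) f z - integral\<^sup>L lborel K * f z"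
  have [measurable]: "f \<in> borel_measurable borel" "K \<in> borel_measurable borel" using f K by auto
  define D where "D = (\<lambda>k y. LBINT z. \<bar>f (z + e k *\<^sub>R y) - f z\<bar>)"
  define C where "C = 2 * (LBINT z. \<bar>f z\<bar>)"
  have iT: "integrable lborel (\<lambda>z. f (z + h) - f z)" for h
    using f integrable_translate[OF f] by simp
  have D0: "D k y \<ge> 0" for k y by (simp add: D_def)
  have DC: "D k y \<le> C" for k y
  proof -
    have "D k y \<le> (LBINT z. \<bar>f (z + e k *\<^sub>R y)\<bar> + \<bar>f z\<bar>)"
      unfolding D_def using f integrable_translate[OF f]
      by (intro integral_mono integrable_abs Bochner_Integration.integrable_add iT) auto
    also have "\<dots> = C"
      using f integrable_translate[OF f] integral_translate[of "\<lambda>z. \<bar>f z\<bar>"] by (simp add: C_def)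
    finally show ?thesis .
  qed
  have Dm[measurable]: "D k \<in> borel_measurable borel" for k
    unfolding D_def by measurable
  have KD: "\<bar>K y * D k y\<bar> \<le> C * K y" for k y
    using mult_left_mono[OF DC[of k y] K(2)[of y]] K(2)[of y] D0[of k y] by (simp add: abs_mult mult.commute)
  have iDK: "integrable lborel (\<lambda>y. K y * D k y)" for k
  proof (rule Bochner_Integration.integrable_bound[where f = "\<lambda>y. C * K y"])
    show "AE y in lborel. norm (K y * D k y) \<le> norm (C * K y)"
      by (intro AE_I2) (use KD in \<open>force intro: order_trans[OF _ abs_ge_self]\<close>)
  qed (use K in auto)
  have bound: "(\<integral>\<^sup>+z. norm (?E k z) \<partial>lborel) \<le> ennreal (LBINT y. K y * D k y)" for k
  proof -
    have int1: "AE z in lborel. ennreal (norm (?E k z)) \<le> ?I k z"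
    proof (rule AE_I2)
      fix z :: 'a
      have i1: "integrable lborel (\<lambda>y. f (z + e k *\<^sub>R y) * K y)"
      proof (rule Bochner_Integration.integrable_bound[where f = "\<lambda>y. B * f (z + e k *\<^sub>R y)"])
        have "integrable (density (distr lborel borel (\<lambda>x. z + e k *\<^sub>R x)) (\<lambda>_. ennreal (\<bar>e k\<bar> ^ DIM('a)))) f"
          using f lborel_affine[of "e k" z] e(1)[of k] by (metis less_irrefl)
        then have "integrable (lborel::'a measure) (\<lambda>y. e k ^ DIM('a) * f (z + e k *\<^sub>R y))"
          using e(1)[of k] by (subst (asm) integrable_density) (auto simp: integrable_distr_eq less_imp_le)
        then show "integrable lborel (\<lambda>y. B * f (z + e k *\<^sub>R y))"
          using e(1)[of k] by (simp add: less_imp_neq[symmetric])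
        show "AE y in lborel. norm (f (z + e k *\<^sub>R y) * K y) \<le> norm (B * f (z + e k *\<^sub>R y))"
        proof (rule AE_I2)
          fix y :: 'a
          have "\<bar>f (z + e k *\<^sub>R y)\<bar> * \<bar>K y\<bar> \<le> \<bar>f (z + e k *\<^sub>R y)\<bar> * \<bar>B\<bar>"
            using K(2,3)[of y] by (intro mult_left_mono) auto
          then show "norm (f (z + e k *\<^sub>R y) * K y) \<le> norm (B * f (z + e k *\<^sub>R y))"
            by (simp add: abs_mult mult.commute)
        qed
      qed measurable
      have "?E k z = (LBINT y. f (z + e k *\<^sub>R y) * K y - K y * f z)"
        using i1 K(1) by (subst mollify_rescale[OF _ _ e(1)]) (simp_all del: scaleR_conv_of_real)
      also have "\<dots> = (LBINT y. K y * (f (z + e k *\<^sub>R y) - f z))"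
        by (intro Bochner_Integration.integral_cong) (simp_all add: right_diff_distrib mult.commute)
      finally have eq: "?E k z = (LBINT y. K y * (f (z + e k *\<^sub>R y) - f z))" .
      have "integrable lborel (\<lambda>y. K y * (f (z + e k *\<^sub>R y) - f z))"
        using Bochner_Integration.integrable_diff[OF i1 integrable_mult_left[OF K(1), of "f z"]]
        by (rule Bochner_Integration.integrable_cong[THEN iffD1, rotated 2]) (simp_all add: algebra_simps)
      then have "ennreal (norm (LBINT y. K y * (f (z + e k *\<^sub>R y) - f z))) \<le>
          (\<integral>\<^sup>+y. ennreal (norm (K y * (f (z + e k *\<^sub>R y) - f z))) \<partial>lborel)"
        by (rule integral_norm_bound_ennreal)
      also have "\<dots> = ?I k z"
        using K(2) by (simp add: abs_mult)
      finally show "ennreal (norm (?E k z)) \<le> ?I k z"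
        unfolding eq .
    qed
    have "(\<integral>\<^sup>+z. norm (?E k z) \<partial>lborel)
       \<le> (\<integral>\<^sup>+z. ?I k z \<partial>lborel)"
      by (rule nn_integral_mono_AE[OF int1])
    also have "\<dots> = (\<integral>\<^sup>+y. (\<integral>\<^sup>+z. ennreal (K y * \<bar>f (z + e k *\<^sub>R y) - f z\<bar>) \<partial>lborel) \<partial>lborel)"
      by (rule lborel_pair.Fubini') measurable
    also have "\<dots> = (\<integral>\<^sup>+y. ennreal (K y * D k y) \<partial>lborel)"
    proof (rule nn_integral_cong)
      fix y :: 'a
      have "(\<integral>\<^sup>+z. ennreal (K y * \<bar>f (z + e k *\<^sub>R y) - f z\<bar>) \<partial>lborel) = ennreal (LBINT z. K y * \<bar>f (z + e k *\<^sub>R y) - f z\<bar>)"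
        using iT K(2) by (intro nn_integral_eq_integral) auto
      then show "(\<integral>\<^sup>+z. ennreal (K y * \<bar>f (z + e k *\<^sub>R y) - f z\<bar>) \<partial>lborel) = ennreal (K y * D k y)"
        by (simp add: D_def)
    qed
    also have "\<dots> = ennreal (LBINT y. K y * D k y)"
      using iDK D0 K(2) by (intro nn_integral_eq_integral) auto
    finally show ?thesis .
  qed
  have T: "(\<lambda>k. LBINT y. K y * D k y) \<longlonglongrightarrow> (\<integral>y. 0 \<partial>(lborel::'a measure))"
  proof (rule integral_dominated_convergence[where w = "\<lambda>y. C * K y"])
    show "AE y in lborel. (\<lambda>k. K y * D k y) \<longlonglongrightarrow> 0"
    proof (rule AE_I2)
      fix y :: 'a
      have "(\<lambda>k. e k *\<^sub>R y) \<longlonglongrightarrow> 0 *\<^sub>R y" by (intro tendsto_intros e)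
      then have "(\<lambda>k. D k y) \<longlonglongrightarrow> 0"
        unfolding D_def by (intro L1_translation_continuous f) simp
      then show "(\<lambda>k. K y * D k y) \<longlonglongrightarrow> 0" by (rule tendsto_mult_right_zero)
    qed
    show "AE y in lborel. norm (K y * D k y) \<le> C * K y" for k
      by (intro AE_I2) (simp add: KD)
  qed (use K in auto)
  have [measurable]: "mollify K (e k) f \<in> borel_measurable borel" for k
    unfolding mollify_def[abs_def] by measurable
  show int: "integrable lborel (\<lambda>z. ?E k z)" for k
    using bound[of k] by (intro integrableI_bounded) (auto simp: less_top[symmetric] top_unique)
  have le: "(LBINT z. \<bar>?E k z\<bar>) \<le> (LBINT y. K y * D k y)" for k
  proof -
    have "ennreal (LBINT z. \<bar>?E k z\<bar>) \<le> ennreal (LBINT y. K y * D k y)"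
      using bound[of k] nn_integral_eq_integral[OF integrable_abs[OF int[of k]]] by simp
    then show ?thesis using K(2) D0 by (subst (asm) ennreal_le_iff) auto
  qed
  show "(\<lambda>k. LBINT z. \<bar>?E k z\<bar>) \<longlonglongrightarrow> 0"
    by (rule tendsto_sandwich[OF always_eventually always_eventually tendsto_const]) (use le T in auto)
qed

section \<open>A smooth bump function\<close>

lemma times_differentiable_imp_continuous: "times_differentiable k f \<Longrightarrow> continuous_on UNIV f"
  by (cases k) (auto simp: continuous_on_eq_continuous_at differentiable_imp_continuous_within)

lemma times_differentiable_Suc_D: "times_differentiable (Suc k) f \<Longrightarrow> times_differentiable k f"
proof (induction k arbitrary: f)
  case 0
  then show ?case
    by (auto simp: continuous_on_eq_continuous_at differentiable_imp_continuous_within)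
next
  case (Suc k)
  from Suc.prems have d: "\<forall>x. f differentiable (at x)"
    and s: "\<And>v. times_differentiable (Suc k) (\<lambda>x. frechet_derivative f (at x) v)"
    by (metis times_differentiable.simps(2))+
  from Suc.IH[OF s] d show ?case by simp
qed

lemma times_differentiable_SucI:
  assumes "\<And>x. (f has_derivative f' x) (at x)" and "\<And>v. times_differentiable k (\<lambda>x. f' x v)"
  shows "times_differentiable (Suc k) f"
proof -
  have "frechet_derivative f (at x) = f' x" for x
    using frechet_derivative_at[OF assms(1)] by simp
  with assms show ?thesis by (auto simp: differentiable_def)
qed

lemma times_differentiable_SucE:
  assumes "times_differentiable (Suc k) f"
  obtains f' where "\<And>x. (f has_derivative f' x) (at x)" and "\<And>v. times_differentiable k (\<lambda>x. f' x v)"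
  using assms by (auto simp: frechet_derivative_works intro: that)

lemma times_differentiable_const: "times_differentiable k (\<lambda>x. c)"
  by (induction k arbitrary: c) (auto intro!: times_differentiable_SucI[where f' = "\<lambda>x v. 0"] simp del: times_differentiable.simps(2))

lemma times_differentiable_add:
  "times_differentiable k f \<Longrightarrow> times_differentiable k g \<Longrightarrow> times_differentiable k (\<lambda>x. f x + g x)"
proof (induction k arbitrary: f g)
  case (Suc k)
  obtain f' where f': "\<And>x. (f has_derivative f' x) (at x)" "\<And>v. times_differentiable k (\<lambda>x. f' x v)"
    by (rule times_differentiable_SucE[OF Suc.prems(1)]) (rule that)
  obtain g' where g': "\<And>x. (g has_derivative g' x) (at x)" "\<And>v. times_differentiable k (\<lambda>x. g' x v)"
    by (rule times_differentiable_SucE[OF Suc.prems(2)]) (rule that)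
  show ?case
    by (rule times_differentiable_SucI[where f' = "\<lambda>x v. f' x v + g' x v"]) (intro has_derivative_add f' g' Suc.IH)+
qed (auto intro: continuous_intros)

lemma times_differentiable_sum: "(\<And>i. i \<in> A \<Longrightarrow> times_differentiable k (f i)) \<Longrightarrow> times_differentiable k (\<lambda>x. \<Sum>i\<in>A. f i x)"
  by (induction A rule: infinite_finite_induct) (auto intro!: times_differentiable_const times_differentiable_add)

lemma times_differentiable_mult:
  "times_differentiable k f \<Longrightarrow> times_differentiable k g \<Longrightarrow> times_differentiable k (\<lambda>x. f x * g x)"
proof (induction k arbitrary: f g)
  case (Suc k)
  obtain f' where f': "\<And>x. (f has_derivative f' x) (at x)" "\<And>v. times_differentiable k (\<lambda>x. f' x v)"
    by (rule times_differentiable_SucE[OF Suc.prems(1)]) (rule that)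
  obtain g' where g': "\<And>x. (g has_derivative g' x) (at x)" "\<And>v. times_differentiable k (\<lambda>x. g' x v)"
    by (rule times_differentiable_SucE[OF Suc.prems(2)]) (rule that)
  show ?case
    by (rule times_differentiable_SucI[where f' = "\<lambda>x v. f x * g' x v + f' x v * g x"])
      (intro has_derivative_mult times_differentiable_add Suc.IH f' g' Suc.prems[THEN times_differentiable_Suc_D])+
qed (auto intro: continuous_intros)

lemma times_differentiable_linear: "bounded_linear f \<Longrightarrow> times_differentiable k f"
proof (cases k)
  case (Suc m)
  assume "bounded_linear f"
  then show ?thesis
    unfolding Suc by (intro times_differentiable_SucI[where f' = "\<lambda>x. f"] times_differentiable_const bounded_linear_imp_has_derivative)
qed (simp add: linear_continuous_on)

lemma times_differentiable_comp_affine: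
  assumes l: "bounded_linear l"
  shows "times_differentiable k f \<Longrightarrow> times_differentiable k (\<lambda>x. f (l x + a))"
proof (induction k arbitrary: f)
  case 0
  then show ?case
    using continuous_on_compose2[of UNIV f UNIV "\<lambda>x. l x + a"]
      continuous_on_add[OF linear_continuous_on[OF l] continuous_on_const, of UNIV a] by simp
next
  case (Suc k)
  obtain f' where f': "\<And>x. (f has_derivative f' x) (at x)" "\<And>v. times_differentiable k (\<lambda>x. f' x v)"
    by (rule times_differentiable_SucE[OF Suc.prems(1)]) (rule that)
  have D: "((\<lambda>x. l x + a) has_derivative l) (at x)" for x
    using bounded_linear_imp_has_derivative[OF l] by (auto intro!: derivative_eq_intros)
  show ?case
    by (rule times_differentiable_SucI[where f' = "\<lambda>x v. f' (l x + a) (l v)"], rule has_derivative_compose[OF D f'(1)], rule Suc.IH[OF f'(2)])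
qed

lemma times_differentiable_compose:
  fixes h :: "real \<Rightarrow> real"
  shows "times_differentiable k h \<Longrightarrow> times_differentiable k f \<Longrightarrow> times_differentiable k (\<lambda>x. h (f x))"
proof (induction k arbitrary: f h)
  case 0
  then show ?case using continuous_on_compose2[of UNIV h UNIV f] by auto
next
  case (Suc k)
  obtain f' where f': "\<And>x. (f has_derivative f' x) (at x)" "\<And>v. times_differentiable k (\<lambda>x. f' x v)"
    by (rule times_differentiable_SucE[OF Suc.prems(2)]) (rule that)
  obtain h' where h': "\<And>x. (h has_derivative h' x) (at x)" "\<And>v. times_differentiable k (\<lambda>x. h' x v)"
    by (rule times_differentiable_SucE[OF Suc.prems(1)]) (rule that)
  have lin: "h' y v = h' y 1 * v" for y v
    using linear_cmul[OF has_derivative_linear[OF h'(1)], of y v 1] by simp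
  have "((\<lambda>x. h (f x)) has_derivative (\<lambda>v. h' (f x) 1 * f' x v)) (at x)" for x
    by (rule has_derivative_eq_rhs[OF has_derivative_compose[OF f'(1) h'(1)]]) (rule ext, rule lin)
  then show ?case
    by (rule times_differentiable_SucI) (rule times_differentiable_mult[OF Suc.IH[OF h'(2) Suc.prems(2)[THEN times_differentiable_Suc_D]] f'(2)])
qed

lemma times_differentiable_real_SucI:
  fixes h :: "real \<Rightarrow> real"
  assumes "\<And>x. (h has_real_derivative h' x) (at x)" "times_differentiable k h'"
  shows "times_differentiable (Suc k) h"
  by (rule times_differentiable_SucI[where f' = "\<lambda>x v. h' x * v"])
    (use assms in \<open>auto simp: has_field_derivative_def intro!: times_differentiable_mult times_differentiable_const\<close>)

text \<open>
  The functions p(1/s) exp(-1/s), extended by 0, are closed under differentiation and flat at 0;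
  this makes all of them smooth by one induction over all polynomials p.
\<close>

definition flat :: "real poly \<Rightarrow> real \<Rightarrow> real" where
  "flat p s = (if s > 0 then poly p (1 / s) * exp (- (1 / s)) else 0)"

lemma poly_exp_tendsto_0: "((\<lambda>y. poly p y * exp (- y)) \<longlongrightarrow> (0::real)) at_top"
proof -
  have "((\<lambda>y. \<Sum>i\<le>degree p. coeff p i * (y ^ i / exp y)) \<longlongrightarrow> (\<Sum>i\<le>degree p. coeff p i * 0)) at_top"
    by (intro tendsto_intros tendsto_power_div_exp_0)
  then show ?thesis
    by (simp add: poly_altdef sum_distrib_right exp_minus divide_inverse mult.assoc)
qed

lemma flat_deriv: "(flat p has_real_derivative flat ((p - pderiv p) * [:0, 0, 1:]) s) (at s)"
proof -
  consider "s > 0" | "s < 0" | "s = 0" by linarith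
  then show ?thesis
  proof cases
    case 1
    have "((\<lambda>s. poly p (1 / s) * exp (- (1 / s))) has_real_derivative flat ((p - pderiv p) * [:0, 0, 1:]) s) (at s)"
      using 1 by (auto intro!: derivative_eq_intros DERIV_compose_FDERIV poly_DERIV[THEN DERIV_chain2]
          simp: flat_def power2_eq_square field_simps)
    then show ?thesis
      by (rule has_field_derivative_transform_within_open[where S = "{0<..}"]) (use 1 in \<open>auto simp: flat_def\<close>)
  next
    case 2
    have "((\<lambda>s. 0) has_real_derivative flat ((p - pderiv p) * [:0, 0, 1:]) s) (at s)"
      using 2 by (simp add: flat_def)
    then show ?thesis
      by (rule has_field_derivative_transform_within_open[where S = "{..<0}"]) (use 2 in \<open>auto simp: flat_def\<close>)
  next
    case 3
    \<comment> \<open>the difference quotient at 0 is again of the form p(1/s) exp(-1/s), with one more factor 1/s\<close>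
    have "((\<lambda>s. poly (p * [:0, 1:]) (1 / s) * exp (- (1 / s))) \<longlongrightarrow> 0) (at_right 0)"
      using filterlim_compose[OF poly_exp_tendsto_0[of "p * [:0, 1:]"] filterlim_inverse_at_top_right]
      unfolding inverse_eq_divide .
    then have "((\<lambda>s. flat p s / s) \<longlongrightarrow> 0) (at_right 0)"
      by (rule Lim_transform_eventually) (auto simp: eventually_at_right_field flat_def intro!: exI[of _ 1])
    moreover have "((\<lambda>s. flat p s / s) \<longlongrightarrow> 0) (at_left 0)"
      by (rule tendsto_eventually) (auto simp: eventually_at_left_field flat_def intro!: exI[of _ "-1"])
    ultimately have "((\<lambda>s. flat p s / s) \<longlongrightarrow> 0) (at 0)"
      by (simp add: filterlim_split_at)
    then show ?thesis
      using 3 by (simp add: has_field_derivative_iff flat_def)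
  qed
qed

lemma times_differentiable_flat: "times_differentiable k (flat p)"
proof (induction k arbitrary: p)
  case 0
  have "isCont (flat p) s" for s using flat_deriv[of p s] by (rule DERIV_isCont)
  then show ?case by (simp add: continuous_at_imp_continuous_on)
next
  case (Suc k)
  show ?case by (rule times_differentiable_real_SucI[OF flat_deriv Suc.IH])
qed

definition bump :: "'a::euclidean_space \<Rightarrow> real" where
  "bump z = flat 1 (1 - z \<bullet> z)"

text \<open>
  The bump function is h(1 - |z|^2) with h(s) = exp(-1/s), and h'(s) = s^(-2) exp(-1/s): this is
  h' at 1 - |z|^2.
\<close>

definition bump_slope :: "'a::euclidean_space \<Rightarrow> real" where
  "bump_slope z = flat [:0, 0, 1:] (1 - z \<bullet> z)"

lemma times_differentiable_bump: "times_differentiable k (bump :: 'a::euclidean_space \<Rightarrow> real)"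
proof -
  have "times_differentiable k (\<lambda>z::'a. \<Sum>b\<in>Basis. (z \<bullet> b) * (z \<bullet> b))"
    by (intro times_differentiable_sum times_differentiable_mult times_differentiable_linear bounded_linear_inner_left)
  then have "times_differentiable k (\<lambda>z::'a. flat 1 (1 + (-1) * (\<Sum>b\<in>Basis. (z \<bullet> b) * (z \<bullet> b))))"
    by (rule times_differentiable_compose[OF times_differentiable_flat times_differentiable_add[OF times_differentiable_const times_differentiable_mult[OF times_differentiable_const]]])
  moreover have "(\<lambda>z::'a. flat 1 (1 + (-1) * (\<Sum>b\<in>Basis. (z \<bullet> b) * (z \<bullet> b)))) = bump"
    by (auto simp: bump_def euclidean_inner[symmetric])
  ultimately show ?thesis by simp
qed

lemma bump_has_derivative:
  "(bump has_derivative (\<lambda>v. - 2 * bump_slope z * (z \<bullet> v))) (at z)"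
proof -
  have "((\<lambda>z. 1 - z \<bullet> z) has_derivative (\<lambda>v. - (z \<bullet> v + v \<bullet> z))) (at z)"
    by (auto intro!: derivative_eq_intros)
  from has_derivative_compose[OF this flat_deriv[of 1 "1 - z \<bullet> z", unfolded has_field_derivative_def]]
  have "((\<lambda>x. flat 1 (1 - x \<bullet> x)) has_derivative (\<lambda>v. - 2 * bump_slope z * (z \<bullet> v))) (at z)"
    by (rule has_derivative_eq_rhs) (auto simp: fun_eq_iff bump_slope_def inner_commute pderiv_1)
  then show ?thesis by (simp add: bump_def[abs_def])
qed

lemma bump_nonneg: "0 \<le> bump z"
  by (simp add: bump_def flat_def)

lemma bump_le_1: "bump z \<le> 1"
  by (simp add: bump_def flat_def)

lemma bump_zero: "norm z \<ge> 1 \<Longrightarrow> bump z = 0"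
  by (simp add: bump_def flat_def dot_square_norm abs_square_less_1)

lemma bump_pos: "norm z < 1 \<Longrightarrow> 0 < bump z"
  using power_strict_mono[of "norm z" 1 2] by (auto simp add: bump_def flat_def dot_square_norm)

lemma bump_slope_bounds: "0 \<le> bump_slope z" "bump_slope z \<le> 2"
proof -
  \<comment> \<open>with y = 1/s this bounds the derivative of exp(-1/s)\<close>
  have e: "y * y * exp (- y) \<le> 2" if "y \<ge> 0" for y :: real
  proof -
    have "y * y \<le> 2 * exp y" using exp_lower_Taylor_quadratic[OF that] that by (simp add: power2_eq_square)
    then show ?thesis by (simp add: exp_minus field_simps)
  qed
  show "bump_slope z \<le> 2"
    using e[of "1 / (1 - z \<bullet> z)"] by (auto simp: bump_slope_def flat_def)
  show "0 \<le> bump_slope z" by (simp add: bump_slope_def flat_def)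
qed

lemma bump_slope_zero: "norm z \<ge> 1 \<Longrightarrow> bump_slope z = 0"
  by (simp add: bump_slope_def flat_def dot_square_norm abs_square_less_1)

lemma continuous_on_bump: "continuous_on S bump"
  using times_differentiable_imp_continuous[OF times_differentiable_bump] continuous_on_subset by blast

lemma continuous_on_bump_slope: "continuous_on S (bump_slope :: 'a::euclidean_space \<Rightarrow> real)"
proof -
  have "continuous_on UNIV (flat [:0, 0, 1:])" by (rule times_differentiable_imp_continuous[OF times_differentiable_flat])
  then have "continuous_on S (\<lambda>z::'a. flat [:0, 0, 1:] (1 - z \<bullet> z))"
    by (rule continuous_on_compose2) (auto intro!: continuous_intros)
  then show ?thesis by (simp add: bump_slope_def[abs_def])
qed

lemma borel_measurable_bump[measurable]: "bump \<in> borel_measurable borel"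
  by (rule borel_measurable_continuous_onI[OF continuous_on_bump])

lemma borel_measurable_bump_slope[measurable]: "bump_slope \<in> borel_measurable borel"
  by (rule borel_measurable_continuous_onI[OF continuous_on_bump_slope])

text \<open>
  A smooth step from 0 to the integral of the bump. Differences of two shifted steps have
  compact support, and their derivative is a difference of two shifted bumps.
\<close>

definition bump_primitive :: "real \<Rightarrow> real" where
  "bump_primitive s = integral {-1..s} bump"

lemma bump_primitive_bounds: "0 \<le> bump_primitive s" "bump_primitive s \<le> 2"
  and bump_primitive_const: "s \<ge> 1 \<Longrightarrow> bump_primitive s = bump_primitive 1"
  and bump_primitive_zero: "s \<le> -1 \<Longrightarrow> bump_primitive s = 0"
proof -
  have int: "bump integrable_on {a..b}" for a b :: real
    by (intro integrable_continuous_real continuous_on_bump)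
  show nn: "0 \<le> bump_primitive s" for s
    unfolding bump_primitive_def by (intro integral_nonneg int) (simp add: bump_nonneg)
  show z: "s \<le> -1 \<Longrightarrow> bump_primitive s = 0" for s
  proof -
    assume "s \<le> -1"
    then consider "s = -1" | "{-1..s} = {}" by fastforce
    then show "bump_primitive s = 0" by cases (auto simp: bump_primitive_def)
  qed
  show c: "s \<ge> 1 \<Longrightarrow> bump_primitive s = bump_primitive 1" for s
  proof -
    assume s: "s \<ge> 1"
    have "bump_primitive s = integral {-1..1::real} bump + integral {1..s} bump"
      unfolding bump_primitive_def
      by (rule Henstock_Kurzweil_Integration.integral_combine[symmetric]) (use s int in auto)
    also have "integral {1..s} bump = integral {1..s} (\<lambda>x. 0 :: real)"
      by (rule Henstock_Kurzweil_Integration.integral_cong) (simp add: bump_zero)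
    finally show ?thesis by (simp add: bump_primitive_def)
  qed
  show "bump_primitive s \<le> 2"
  proof (cases "s \<le> 1")
    case True
    show ?thesis
    proof (cases "s \<ge> -1")
      case True
      have "bump_primitive s \<le> integral {-1..s} (\<lambda>x. 1)"
        unfolding bump_primitive_def by (intro integral_le int) (auto simp: bump_le_1)
      then show ?thesis using True \<open>s \<le> 1\<close> by simp
    qed (simp add: z)
  next
    case False
    have "bump_primitive 1 \<le> integral {-1..1::real} (\<lambda>x. 1)"
      unfolding bump_primitive_def by (intro integral_le int) (auto simp: bump_le_1)
    then show ?thesis using False c[of s] by simp
  qed
qed

lemma bump_primitive_deriv: "(bump_primitive has_real_derivative bump s) (at s)"
proof -
  define a where "a = min s (-1) - 1"
  have eq: "bump_primitive x = integral {a..x} bump" if "x > a" for x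
  proof (cases "x \<ge> -1")
    case True
    have "integral {a..x} bump = integral {a..-1} bump + integral {-1..x} bump"
      by (rule Henstock_Kurzweil_Integration.integral_combine[symmetric])
         (use True in \<open>auto simp: a_def intro!: integrable_continuous_real continuous_on_bump\<close>)
    also have "integral {a..-1} bump = integral {a..-1} (\<lambda>x. 0 :: real)"
      by (rule Henstock_Kurzweil_Integration.integral_cong) (simp add: bump_zero)
    finally show ?thesis by (simp add: bump_primitive_def)
  next
    case False
    have "integral {a..x} bump = integral {a..x} (\<lambda>x. 0 :: real)"
      by (rule Henstock_Kurzweil_Integration.integral_cong) (use False in \<open>simp add: bump_zero\<close>)
    then show ?thesis using bump_primitive_zero[of x] False by simp
  qed
  have "((\<lambda>x. integral {a..x} bump) has_real_derivative bump s) (at s within {a..s+1})"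
    by (rule integral_has_real_derivative) (auto simp: a_def intro: continuous_on_bump)
  then have "((\<lambda>x. integral {a..x} bump) has_real_derivative bump s) (at s)"
    by (subst (asm) at_within_interior) (auto simp: a_def)
  then show ?thesis
    by (rule has_field_derivative_transform_within_open[where S = "{a<..}"]) (auto simp: eq, auto simp: a_def)
qed

lemma times_differentiable_bump_primitive: "times_differentiable k bump_primitive"
proof (cases k)
  case 0
  have "isCont bump_primitive s" for s using bump_primitive_deriv[of s] by (rule DERIV_isCont)
  then show ?thesis by (simp add: 0 continuous_at_imp_continuous_on)
next
  case (Suc m)
  show ?thesis unfolding Suc by (rule times_differentiable_real_SucI[OF bump_primitive_deriv times_differentiable_bump])
qed

section \<open>Parameter integrals and the maximal function\<close>

lemma test_functionI:
  assumes "\<And>k. times_differentiable k \<phi>" "compact C" "C \<subseteq> U" "\<And>x. x \<notin> C \<Longrightarrow> \<phi> x = 0"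
  shows "test_function U \<phi>"
proof -
  have "closure {x. \<phi> x \<noteq> 0} \<subseteq> C"
    using assms(4) by (intro closure_minimal compact_imp_closed assms(2)) auto
  then show ?thesis
    using assms(1-3) compact_Int_closed[OF assms(2) closed_closure[of "{x. \<phi> x \<noteq> 0}"]]
    by (auto simp: test_function_def Int_absorb1)
qed

lemma grad_eqI:
  assumes "(f has_derivative (\<lambda>v. a \<bullet> v)) (at x)"
  shows "grad f x = a"
  by (simp add: grad_def frechet_derivative_at[OF assms, symmetric] inner_axis vec_eq_iff)

lemma bump_scaled_deriv:
  fixes x y :: "'a::euclidean_space"
  assumes "r > 0"
  shows "((\<lambda>y. bump ((y - x) /\<^sub>R r)) has_derivative
     (\<lambda>v. (- (2 * bump_slope ((y - x) /\<^sub>R r) / r\<^sup>2) *\<^sub>R (y - x)) \<bullet> v)) (at y)"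
proof -
  have "((\<lambda>y. (y - x) /\<^sub>R r) has_derivative (\<lambda>v. v /\<^sub>R r)) (at y)"
    by (auto intro!: derivative_eq_intros)
  from has_derivative_compose[OF this bump_has_derivative]
  show ?thesis
    by (rule has_derivative_eq_rhs) (simp add: fun_eq_iff power2_eq_square divide_inverse)
qed

lemma times_differentiable_bump_scaled: "times_differentiable k (\<lambda>y. bump ((y - x) /\<^sub>R r))"
proof -
  have "times_differentiable k (\<lambda>y. bump (y /\<^sub>R r + - (x /\<^sub>R r)))"
    by (rule times_differentiable_comp_affine[OF bounded_linear_scaleR_right times_differentiable_bump])
  then show ?thesis by (simp add: scaleR_diff_right)
qed

lemma bump_scaled_zero: "r > 0 \<Longrightarrow> z \<notin> ball x r \<Longrightarrow> bump ((z - x) /\<^sub>R r) = 0"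
  by (rule bump_zero) (auto simp: dist_norm norm_minus_commute[of x] divide_inverse[symmetric] mult.commute[of "inverse r"] simp del: scaleR_diff_right)

lemma bump_slope_scaled_zero: "r > 0 \<Longrightarrow> z \<notin> ball x r \<Longrightarrow> bump_slope ((z - x) /\<^sub>R r) = 0"
  by (rule bump_slope_zero) (auto simp: dist_norm norm_minus_commute[of x] divide_inverse[symmetric] mult.commute[of "inverse r"] simp del: scaleR_diff_right)

text \<open>
  A uniform bound on the parameter derivative of the kernel dominates its difference quotients.
\<close>

lemma has_derivative_under_integral:
  fixes f :: "'a::euclidean_space \<Rightarrow> real" and k :: "real \<Rightarrow> 'a \<Rightarrow> real"
  assumes f: "integrable lborel f" and r: "a < r" "r < b"
    and m[measurable]: "\<And>r. k r \<in> borel_measurable borel" "k' r \<in> borel_measurable borel"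
    and i: "\<And>r. a < r \<Longrightarrow> r < b \<Longrightarrow> integrable lborel (\<lambda>z. f z * k r z)"
    and d: "\<And>r z. a < r \<Longrightarrow> r < b \<Longrightarrow> ((\<lambda>r. k r z) has_real_derivative k' r z) (at r)"
    and B: "\<And>r z. a < r \<Longrightarrow> r < b \<Longrightarrow> \<bar>k' r z\<bar> \<le> C"
  shows "((\<lambda>r. LBINT z. f z * k r z) has_real_derivative (LBINT z. f z * k' r z)) (at r)"
proof -
  have [measurable]: "f \<in> borel_measurable borel" using f by auto
  \<comment> \<open>the mean value inequality supplies the dominating function C |f|\<close>
  have lip: "\<bar>k s z - k r z\<bar> \<le> C * \<bar>s - r\<bar>" if "a < s" "s < b" for s z
  proof -
    have "norm (k s z - k r z) \<le> C * norm (s - r)"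
      by (rule field_differentiable_bound[of "{a<..<b}" "\<lambda>r. k r z" "\<lambda>r. k' r z"])
         (use that r B d in \<open>auto intro: has_field_derivative_at_within\<close>)
    then show ?thesis by simp
  qed
  have "((\<lambda>s. ((LBINT z. f z * k s z) - (LBINT z. f z * k r z)) / (s - r)) \<longlongrightarrow> (LBINT z. f z * k' r z))
      (at r within {a<..<b})"
    unfolding tendsto_at_iff_sequentially
  proof (intro allI impI)
    fix X :: "nat \<Rightarrow> real" assume X: "\<forall>i. X i \<in> {a<..<b} - {r}" "X \<longlonglongrightarrow> r"
    have eq: "((LBINT z. f z * k (X i) z) - (LBINT z. f z * k r z)) / (X i - r)
        = (LBINT z. f z * ((k (X i) z - k r z) / (X i - r)))" for i
    proof -
      have "integrable lborel (\<lambda>z. f z * k (X i) z)" "integrable lborel (\<lambda>z. f z * k r z)"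
        using i X(1) r by auto
      then have "((LBINT z. f z * k (X i) z) - (LBINT z. f z * k r z)) / (X i - r)
         = (LBINT z. (f z * k (X i) z - f z * k r z) / (X i - r))" by simp
      then show ?thesis by (simp add: right_diff_distrib)
    qed
    have "(\<lambda>i. LBINT z. f z * ((k (X i) z - k r z) / (X i - r))) \<longlonglongrightarrow> (LBINT z. f z * k' r z)"
    proof (rule integral_dominated_convergence[where w = "\<lambda>z. C * \<bar>f z\<bar>"])
      show "AE z in lborel. (\<lambda>i. f z * ((k (X i) z - k r z) / (X i - r))) \<longlonglongrightarrow> f z * k' r z"
      proof (intro AE_I2 tendsto_mult_left)
        fix z
        have "((\<lambda>s. (k s z - k r z) / (s - r)) \<longlongrightarrow> k' r z) (at r)"
          using d[OF r, of z] by (simp add: has_field_derivative_iff)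
        then show "(\<lambda>i. (k (X i) z - k r z) / (X i - r)) \<longlonglongrightarrow> k' r z"
          unfolding tendsto_at_iff_sequentially using X by (auto simp: o_def)
      qed
      show "AE z in lborel. norm (f z * ((k (X i) z - k r z) / (X i - r))) \<le> C * \<bar>f z\<bar>" for i
      proof (intro AE_I2)
        fix z
        have "\<bar>(k (X i) z - k r z) / (X i - r)\<bar> \<le> C"
        proof -
          have pos: "0 < \<bar>X i - r\<bar>" and "\<bar>k (X i) z - k r z\<bar> \<le> C * \<bar>X i - r\<bar>"
            using lip[of "X i" z] X(1) by auto
          then show ?thesis by (simp only: abs_divide pos_divide_le_eq[OF pos])
        qed
        then have "\<bar>f z\<bar> * \<bar>(k (X i) z - k r z) / (X i - r)\<bar> \<le> \<bar>f z\<bar> * C"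
          by (rule mult_left_mono) simp
        then show "norm (f z * ((k (X i) z - k r z) / (X i - r))) \<le> C * \<bar>f z\<bar>"
          by (simp add: abs_mult mult.commute)
      qed
    qed (use f in auto)
    then show "((\<lambda>s. ((LBINT z. f z * k s z) - (LBINT z. f z * k r z)) / (s - r)) \<circ> X) \<longlonglongrightarrow> (LBINT z. f z * k' r z)"
      by (simp add: o_def eq)
  qed
  moreover have "at r within {a<..<b} = at r" using r by (intro at_within_open) auto
  ultimately show ?thesis by (simp only: has_field_derivative_iff)
qed

lemma DERIV_inverse_power_nat:
  assumes "r > 0"
  shows "((\<lambda>r. 1 / r ^ N) has_real_derivative - (N / r ^ (N + 1))) (at (r::real))"
proof -
  have "((\<lambda>r. r ^ N) has_real_derivative N * r ^ (N - 1)) (at r)"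
    using DERIV_pow[of N r] by simp
  then have "((\<lambda>r. inverse (r ^ N)) has_real_derivative - (inverse (r ^ N) * (N * r ^ (N - 1)) * inverse (r ^ N))) (at r)"
    by (rule DERIV_inverse') (use assms in simp)
  moreover have "inverse (r ^ N) * (N * r ^ (N - 1)) * inverse (r ^ N) = N / r ^ (N + 1)"
    using assms by (cases N) (simp_all add: field_simps)
  ultimately show ?thesis by (simp add: inverse_eq_divide)
qed

lemma borel_measurable_fst_snd[measurable]:
  "(fst :: 'a::euclidean_space \<times> 'b::euclidean_space \<Rightarrow> 'a) \<in> borel_measurable borel"
  "(snd :: 'a::euclidean_space \<times> 'b::euclidean_space \<Rightarrow> 'b) \<in> borel_measurable borel"
  by (auto intro!: borel_measurable_continuous_onI continuous_intros)

lemma borel_measurable_nth[measurable (raw)]: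
  "f \<in> borel_measurable M \<Longrightarrow> (\<lambda>x. (f x :: real^'n) $ j) \<in> borel_measurable M"
  by (rule borel_measurable_continuous_on[of "\<lambda>x. x $ j"]) (auto intro!: continuous_intros)

lemma integrable_nth:
  fixes X :: "'a \<Rightarrow> real^'n"
  shows "integrable M X \<Longrightarrow> integrable M (\<lambda>z. X z $ j)"
  by (rule integrable_bounded_linear[OF bounded_linear_vec_nth])

lemma integrable_mult_bounded:
  fixes f h :: "'a::euclidean_space \<Rightarrow> real"
  assumes f: "integrable lborel f" and [measurable]: "h \<in> borel_measurable borel" and B: "\<And>z. \<bar>h z\<bar> \<le> B"
  shows "integrable lborel (\<lambda>z. f z * h z)"
proof (rule Bochner_Integration.integrable_bound[of lborel "\<lambda>z. B * f z"])
  show "AE z in lborel. norm (f z * h z) \<le> norm (B * f z)"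
  proof (rule AE_I2)
    fix z
    have "\<bar>f z\<bar> * \<bar>h z\<bar> \<le> \<bar>f z\<bar> * \<bar>B\<bar>" using B[of z] by (intro mult_left_mono) auto
    then show "norm (f z * h z) \<le> norm (B * f z)" by (simp add: abs_mult mult.commute)
  qed
qed (use f in auto)

lemma ennreal_le_mult_if_divide_le:
  fixes x y :: ennreal
  assumes "x / ennreal V \<le> y" "V > 0"
  shows "x \<le> y * ennreal V"
proof -
  have "x = x / ennreal V * ennreal V"
    using assms(2) by (simp add: ennreal_divide_times)
  also have "\<dots> \<le> y * ennreal V" by (rule mult_right_mono[OF assms(1)]) simp
  finally show ?thesis .
qed

text \<open>
  A field \<phi> of size B supported in a cylinder integrates X to at most B times the integral
  of |X| over that cylinder, that is, B times its measure times an average below the maximal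
  function at any of its points.
\<close>

lemma strong_maximal_controls_integral:
  fixes X \<phi> :: "(real^'n) \<times> real \<Rightarrow> real^'n"
  assumes [measurable]: "g \<in> borel_measurable lebesgue"
    and X: "integrable lborel X" "AE z in lborel. norm (X z) \<le> k * g z" and k: "k \<ge> 0"
    and \<phi>: "\<And>z. norm (\<phi> z) \<le> B" "\<And>z. z \<notin> ball y r \<times> {a<..<b} \<Longrightarrow> \<phi> z = 0"
    and z0: "z0 \<in> ball y r \<times> {a<..<b}"
    and M: "strong_maximal g z0 \<le> ennreal m" "m \<ge> 0"
  shows "\<bar>LBINT z. \<phi> z \<bullet> X z\<bar> \<le> B * k * (unit_ball_vol (real CARD('n)) * r ^ CARD('n) * (b - a)) * m"
proof -
  let ?S = "ball y r \<times> {a<..<b}"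
  define V where "V = unit_ball_vol (real CARD('n)) * r ^ CARD('n) * (b - a)"
  have pos: "r > 0" "a < b" using z0 by (auto intro: le_less_trans[OF zero_le_dist])
  have V: "V > 0" using pos by (simp add: V_def)
  have B0: "B \<ge> 0" using norm_ge_zero order_trans \<phi>(1) by blast
  have [measurable]: "?S \<in> sets borel" by (intro borel_open open_Times) auto
  have eS: "emeasure lebesgue ?S = ennreal V"
  proof -
    have "emeasure lebesgue ?S = emeasure (lborel \<Otimes>\<^sub>M lborel) ?S"
      by (simp add: lborel_prod)
    also have "\<dots> = emeasure lborel (ball y r) * emeasure lborel {a<..<b}"
      by (subst lborel.emeasure_pair_measure_Times) auto
    also have "\<dots> = ennreal V"
      using pos by (simp add: emeasure_ball V_def ennreal_mult[symmetric])
    finally show ?thesis .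
  qed
  have "nn_mean ?S (\<lambda>\<zeta>. ennreal \<bar>g \<zeta>\<bar>) \<le> strong_maximal g z0"
    unfolding strong_maximal_def by (rule SUP_upper) (use z0 in blast)
  then have "(\<integral>\<^sup>+z\<in>?S. ennreal \<bar>g z\<bar> \<partial>lebesgue) / ennreal V \<le> ennreal m"
    using M(1) by (simp add: nn_mean_def eS)
  then have I: "(\<integral>\<^sup>+z\<in>?S. ennreal \<bar>g z\<bar> \<partial>lebesgue) \<le> ennreal m * ennreal V"
    using V by (rule ennreal_le_mult_if_divide_le)
  have "ennreal \<bar>LBINT z. \<phi> z \<bullet> X z\<bar> \<le> (\<integral>\<^sup>+z. ennreal (norm (\<phi> z \<bullet> X z)) \<partial>lborel)"
  proof (cases "integrable lborel (\<lambda>z. \<phi> z \<bullet> X z)")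
    case True
    then show ?thesis using integral_norm_bound_ennreal[OF True] by simp
  qed (simp add: not_integrable_integral_eq)
  also have "\<dots> \<le> (\<integral>\<^sup>+z. ennreal (B * k) * (ennreal \<bar>g z\<bar> * indicator ?S z) \<partial>lborel)"
  proof (rule nn_integral_mono_AE)
    show "AE z in lborel. ennreal (norm (\<phi> z \<bullet> X z)) \<le> ennreal (B * k) * (ennreal \<bar>g z\<bar> * indicator ?S z)"
      using X(2)
    proof eventually_elim
      case (elim z)
      show ?case
      proof (cases "z \<in> ?S")
        case True
        have "\<bar>\<phi> z \<bullet> X z\<bar> \<le> norm (\<phi> z) * norm (X z)" by (rule Cauchy_Schwarz_ineq2)
        also have "\<dots> \<le> B * (k * \<bar>g z\<bar>)"
        proof (rule mult_mono[OF \<phi>(1) _ B0 norm_ge_zero])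
          show "norm (X z) \<le> k * \<bar>g z\<bar>"
            using elim mult_left_mono[OF abs_ge_self[of "g z"] k] by linarith
        qed
        finally show ?thesis using True B0 k by (simp add: ennreal_mult[symmetric] mult.assoc)
      qed (use \<phi>(2) in auto)
    qed
  qed
  also have "\<dots> = (\<integral>\<^sup>+z. ennreal (B * k) * (ennreal \<bar>g z\<bar> * indicator ?S z) \<partial>lebesgue)"
    by (simp add: nn_integral_completion)
  also have "\<dots> = ennreal (B * k) * (\<integral>\<^sup>+z\<in>?S. ennreal \<bar>g z\<bar> \<partial>lebesgue)"
  proof (rule nn_integral_cmult)
    have "(\<lambda>z. ennreal \<bar>g z\<bar>) \<in> borel_measurable lebesgue" by measurable
    moreover have "?S \<in> sets lebesgue" by simp
    ultimately show "(\<lambda>z. ennreal \<bar>g z\<bar> * indicator ?S z) \<in> borel_measurable lebesgue"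
      by (intro borel_measurable_times_ennreal borel_measurable_indicator)
  qed
  also have "\<dots> \<le> ennreal (B * k) * (ennreal m * ennreal V)"
    by (rule mult_left_mono[OF I]) simp
  also have "\<dots> = ennreal (B * k * V * m)"
    using B0 k V M(2) by (simp add: ennreal_mult[symmetric] mult_ac)
  finally show ?thesis
    using B0 k V M(2) by (simp add: V_def)
qed


section \<open>Estimates for a scalar equation\<close>

text \<open>
  A function U on space-time whose spatial gradient on 2Q is G and whose time derivative there
  is the divergence of H. The test functions are products p(y) q(s), the form of all the kernels
  below. U, G and H are Borel functions on the whole space; the inequalities for G and H hold
  everywhere up to null sets, g being 0 outside 2Q in the application.
\<close>

locale scalar_equation =
  fixes x0 :: "real^'n" and t0 \<rho> \<Lambda> :: real
    and U g :: "(real^'n) \<times> real \<Rightarrow> real" and G H :: "(real^'n) \<times> real \<Rightarrow> real^'n"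
  assumes \<rho>: "\<rho> > 0" and \<Lambda>: "\<Lambda> \<ge> 0"
    and int: "integrable lborel U" "integrable lborel G" "integrable lborel H"
    and weak_grad: "\<And>p q. test_function (ball x0 (2 * \<rho>)) p \<Longrightarrow> test_function (time_interval t0 (2 * \<rho>)) q \<Longrightarrow>
       (LBINT z. U z * (grad p (fst z) $ j * q (snd z))) = - (LBINT z. p (fst z) * q (snd z) * G z $ j)"
    and weak_eq: "\<And>p q. test_function (ball x0 (2 * \<rho>)) p \<Longrightarrow> test_function (time_interval t0 (2 * \<rho>)) q \<Longrightarrow>
       (LBINT z. U z * (p (fst z) * deriv q (snd z))) = (LBINT z. q (snd z) * (grad p (fst z) \<bullet> H z))"
    and g: "g \<in> borel_measurable lebesgue"
    and G_le: "AE z in lborel. norm (G z) \<le> g z" and H_le: "AE z in lborel. norm (H z) \<le> \<Lambda> * g z"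
begin

definition space_kernel :: "real \<Rightarrow> real^'n \<Rightarrow> real^'n \<Rightarrow> real" where
  "space_kernel r x y = bump ((y - x) /\<^sub>R r) / r ^ CARD('n)"

text \<open>
  The average of U around (x,t), up to a constant factor independent of r and \<tau>, over the
  ball of radius r and the time interval of half-length \<tau>. The two scales are separate
  since the time scale stays fixed while the radius moves from \<tau> to \<rho>.
\<close>

definition avg :: "real \<Rightarrow> real \<Rightarrow> real^'n \<Rightarrow> real \<Rightarrow> real" where
  "avg \<tau> r x t = (LBINT z. U z * (space_kernel r x (fst z) * (bump ((snd z - t) /\<^sub>R \<tau>) / \<tau>)))"

lemma test_function_space_kernel:
  assumes "x \<in> ball x0 \<rho>" "0 < r" "r \<le> \<rho>" "\<And>k. times_differentiable k f"
  shows "test_function (ball x0 (2 * \<rho>)) (\<lambda>y. f y * space_kernel r x y)"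
proof (rule test_functionI[where C = "cball x r"])
  show "times_differentiable k (\<lambda>y. f y * space_kernel r x y)" for k
    unfolding space_kernel_def divide_inverse by (intro times_differentiable_mult times_differentiable_const times_differentiable_bump_scaled assms)
  show "cball x r \<subseteq> ball x0 (2 * \<rho>)"
  proof
    fix y assume "y \<in> cball x r"
    then show "y \<in> ball x0 (2 * \<rho>)"
      using assms(1,3) dist_triangle[of x0 y x] by auto
  qed
  show "f y * space_kernel r x y = 0" if "y \<notin> cball x r" for y
    using that assms(2) by (simp add: space_kernel_def bump_scaled_zero)
qed auto

lemma test_function_in_time:
  assumes t: "t1 \<in> time_interval t0 \<rho>" "t2 \<in> time_interval t0 \<rho>" and e: "0 < \<tau>" "\<tau> \<le> \<rho>\<^sup>2"
    and q: "\<And>k. times_differentiable k q" "\<And>s. s \<notin> {t1 - \<tau>..t2 + \<tau>} \<Longrightarrow> q s = 0"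
  shows "test_function (time_interval t0 (2 * \<rho>)) q"
proof (rule test_functionI[where C = "{t1 - \<tau>..t2 + \<tau>}"])
  have "\<rho>\<^sup>2 > 0" using \<rho> by simp
  then show "{t1 - \<tau>..t2 + \<tau>} \<subseteq> time_interval t0 (2 * \<rho>)"
    using t e by (auto simp: time_interval_def power_mult_distrib)
qed (use q in auto)

definition radius_deriv :: "real \<Rightarrow> real^'n \<Rightarrow> real^'n \<Rightarrow> real" where
  "radius_deriv r x y = 2 * bump_slope ((y - x) /\<^sub>R r) * (norm (y - x))\<^sup>2 / r ^ (CARD('n) + 3)
      - CARD('n) * bump ((y - x) /\<^sub>R r) / r ^ (CARD('n) + 1)"

lemma space_kernel_radius_deriv:
  assumes r: "r > 0"
  shows "((\<lambda>r. space_kernel r x y) has_real_derivative radius_deriv r x y) (at r)"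
proof -
  have "((\<lambda>r. (y - x) /\<^sub>R r) has_derivative (\<lambda>h. - (h / r\<^sup>2) *\<^sub>R (y - x))) (at r)"
    using r by (auto intro!: derivative_eq_intros simp: fun_eq_iff power2_eq_square divide_inverse mult_ac)
  from has_derivative_compose[OF this bump_has_derivative]
  have "((\<lambda>r. bump ((y - x) /\<^sub>R r)) has_real_derivative
      2 * bump_slope ((y - x) /\<^sub>R r) * (norm (y - x))\<^sup>2 / r ^ 3) (at r)"
    unfolding has_field_derivative_def
    by (rule has_derivative_eq_rhs)
       (use r in \<open>simp add: fun_eq_iff dot_square_norm power2_eq_square power3_eq_cube divide_inverse mult_ac\<close>)
  moreover have "((\<lambda>r. 1 / r ^ CARD('n)) has_real_derivative - (CARD('n) / r ^ (CARD('n) + 1))) (at r)"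
    by (rule DERIV_inverse_power_nat[OF r])
  ultimately have "((\<lambda>r. bump ((y - x) /\<^sub>R r) * (1 / r ^ CARD('n))) has_real_derivative
      bump ((y - x) /\<^sub>R r) * - (CARD('n) / r ^ (CARD('n) + 1)) + 2 * bump_slope ((y - x) /\<^sub>R r) * (norm (y - x))\<^sup>2 / r ^ 3 * (1 / r ^ CARD('n))) (at r)"
    by (rule DERIV_mult')
  then show ?thesis
    by (simp add: space_kernel_def radius_deriv_def power_add mult_ac power3_eq_cube)
qed

lemma radius_deriv_bound:
  assumes r: "r > 0"
  shows "\<bar>radius_deriv r x y\<bar> \<le> (4 + CARD('n)) / r ^ (CARD('n) + 1)"
proof -
  have "bump_slope ((y - x) /\<^sub>R r) * (norm (y - x))\<^sup>2 \<le> 2 * r\<^sup>2"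
  proof (cases "y \<in> ball x r")
    case True
    then have "(norm (y - x))\<^sup>2 \<le> r\<^sup>2"
      by (intro power_mono) (auto simp: dist_norm norm_minus_commute)
    then show ?thesis by (intro mult_mono bump_slope_bounds) auto
  qed (use r in \<open>simp add: bump_slope_scaled_zero\<close>)
  then have "2 * bump_slope ((y - x) /\<^sub>R r) * (norm (y - x))\<^sup>2 / r ^ (CARD('n) + 3) \<le> 4 * r\<^sup>2 / r ^ (CARD('n) + 3)"
    using r by (intro divide_right_mono) auto
  also have "\<dots> = 4 / r ^ (CARD('n) + 1)"
    using r by (simp add: power_add power2_eq_square power3_eq_cube)
  finally have 1: "2 * bump_slope ((y - x) /\<^sub>R r) * (norm (y - x))\<^sup>2 / r ^ (CARD('n) + 3) \<le> 4 / r ^ (CARD('n) + 1)" .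
  have 2: "0 \<le> 2 * bump_slope ((y - x) /\<^sub>R r) * (norm (y - x))\<^sup>2 / r ^ (CARD('n) + 3)"
    by (intro divide_nonneg_nonneg mult_nonneg_nonneg bump_slope_bounds) (use r in auto)
  have "CARD('n) * bump ((y - x) /\<^sub>R r) / r ^ (CARD('n) + 1) \<le> CARD('n) * 1 / r ^ (CARD('n) + 1)"
    using r by (intro divide_right_mono mult_left_mono) (auto simp: bump_le_1)
  moreover have "0 \<le> CARD('n) * bump ((y - x) /\<^sub>R r) / r ^ (CARD('n) + 1)"
    by (intro divide_nonneg_nonneg mult_nonneg_nonneg bump_nonneg) (use r in auto)
  ultimately show ?thesis
    using 1 2 unfolding radius_deriv_def by (simp add: add_divide_distrib)
qed

lemma grad_weighted_kernel:
  assumes r: "r > 0"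
  shows "grad (\<lambda>y. (y - x) $ j / r * space_kernel r x y) y =
      (bump ((y - x) /\<^sub>R r) / r ^ (CARD('n) + 1)) *\<^sub>R axis j 1
       - (2 * bump_slope ((y - x) /\<^sub>R r) * (y - x) $ j / r ^ (CARD('n) + 3)) *\<^sub>R (y - x)"
proof (rule grad_eqI)
    have alg: "w $ j / r * (((- (2 * S / r\<^sup>2) *\<^sub>R w) \<bullet> v) / r ^ CARD('n)) + v $ j / r * (B / r ^ CARD('n))
       = ((B / r ^ (CARD('n) + 1)) *\<^sub>R axis j 1 - (2 * S * w $ j / r ^ (CARD('n) + 3)) *\<^sub>R w) \<bullet> v"
      for w v :: "real^'n" and S B
      using r by (simp add: inner_diff_left inner_axis' power_add power2_eq_square power3_eq_cube field_simps)
    have "((\<lambda>y. (y - x) $ j / r) has_derivative (\<lambda>v. v $ j / r)) (at y)"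
      using r by (auto intro!: derivative_eq_intros bounded_linear.has_derivative[OF bounded_linear_vec_nth])
    moreover have "((\<lambda>y. bump ((y - x) /\<^sub>R r) / r ^ CARD('n)) has_derivative
       (\<lambda>v. ((- (2 * bump_slope ((y - x) /\<^sub>R r) / r\<^sup>2) *\<^sub>R (y - x)) \<bullet> v) / r ^ CARD('n))) (at y)"
      unfolding divide_inverse[of _ "r ^ CARD('n)"]
      by (rule has_derivative_mult_left[OF bump_scaled_deriv[OF r]])
    ultimately have "((\<lambda>y. (y - x) $ j / r * (bump ((y - x) /\<^sub>R r) / r ^ CARD('n))) has_derivative
       (\<lambda>v. (y - x) $ j / r * (((- (2 * bump_slope ((y - x) /\<^sub>R r) / r\<^sup>2) *\<^sub>R (y - x)) \<bullet> v) / r ^ CARD('n))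
          + v $ j / r * (bump ((y - x) /\<^sub>R r) / r ^ CARD('n)))) (at y)"
      by (rule has_derivative_mult)
    then show "((\<lambda>y. (y - x) $ j / r * space_kernel r x y) has_derivative
      (\<lambda>v. ((bump ((y - x) /\<^sub>R r) / r ^ (CARD('n) + 1)) *\<^sub>R axis j 1
       - (2 * bump_slope ((y - x) /\<^sub>R r) * (y - x) $ j / r ^ (CARD('n) + 3)) *\<^sub>R (y - x)) \<bullet> v)) (at y)"
      unfolding space_kernel_def
      by (rule has_derivative_eq_rhs)
         (rule ext, rule alg)
  qed

text \<open>
  Dilating a bump of fixed mass only transports its mass radially: the derivative in the radius
  is minus the divergence of the field ((y - x)/r) times the kernel. This is what allows the
  gradient of U to replace U in the change of radius.
\<close>

lemma kernel_divergence:
  assumes r: "r > 0"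
  shows "(\<Sum>j\<in>UNIV. grad (\<lambda>y. (y - x) $ j / r * space_kernel r x y) y $ j) = - radius_deriv r x y"
proof -
  have "(\<Sum>j\<in>UNIV. grad (\<lambda>y. (y - x) $ j / r * space_kernel r x y) y $ j)
     = (\<Sum>j\<in>(UNIV::'n set). bump ((y - x) /\<^sub>R r) / r ^ (CARD('n) + 1))
       - (\<Sum>j\<in>UNIV. 2 * bump_slope ((y - x) /\<^sub>R r) / r ^ (CARD('n) + 3) * ((y - x) $ j)\<^sup>2)"
    unfolding grad_weighted_kernel[OF r] by (simp add: sum_subtractf axis_def power2_eq_square mult_ac)
  also have "\<dots> = - radius_deriv r x y"
    by (simp add: sum_distrib_left sum_divide_distrib radius_deriv_def norm_vec_def L2_set_def real_sqrt_pow2 sum_nonneg)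
  finally show ?thesis .
qed


lemma space_kernel_bounds: "r > 0 \<Longrightarrow> 0 \<le> space_kernel r x y" "r > 0 \<Longrightarrow> space_kernel r x y \<le> 1 / r ^ CARD('n)"
  by (auto simp: space_kernel_def bump_nonneg bump_le_1 divide_right_mono)

lemma space_kernel_zero: "r > 0 \<Longrightarrow> y \<notin> ball x r \<Longrightarrow> space_kernel r x y = 0"
  by (simp add: space_kernel_def bump_scaled_zero)

lemma measurable_kernels[measurable]:
  "space_kernel r x \<in> borel_measurable borel" "radius_deriv r x \<in> borel_measurable borel"
  unfolding space_kernel_def[abs_def] radius_deriv_def[abs_def] by measurable

lemma weighted_kernel_bound:
  assumes "r > 0"
  shows "norm (y - x) / r * space_kernel r x y \<le> 1 / r ^ CARD('n)"
proof (cases "y \<in> ball x r")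
  case True
  then have "norm (y - x) / r \<le> 1" using assms by (simp add: dist_norm norm_minus_commute)
  then show ?thesis
    using mult_mono[of "norm (y - x) / r" 1 "space_kernel r x y" "1 / r ^ CARD('n)"] assms space_kernel_bounds by auto
qed (use assms in \<open>simp add: space_kernel_zero\<close>)

lemma grad_weighted_kernel_bound:
  assumes r: "r > 0"
  shows "\<bar>grad (\<lambda>y. (y - x) $ j / r * space_kernel r x y) y $ j\<bar> \<le> 5 / r ^ (CARD('n) + 1)"
proof -
  have "bump_slope ((y - x) /\<^sub>R r) * ((y - x) $ j * (y - x) $ j) \<le> 2 * (r * r)"
  proof (cases "y \<in> ball x r")
    case True
    then have "\<bar>(y - x) $ j\<bar> \<le> r"
      using component_le_norm_cart[of "y - x" j] by (simp add: dist_norm norm_minus_commute)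
    then have "\<bar>(y - x) $ j\<bar> * \<bar>(y - x) $ j\<bar> \<le> r * r" by (intro mult_mono) auto
    then have "(y - x) $ j * (y - x) $ j \<le> r * r" by simp
    then show ?thesis by (rule mult_mono[OF bump_slope_bounds(2)]) auto
  qed (use r in \<open>simp add: bump_slope_scaled_zero\<close>)
  then have "2 * (bump_slope ((y - x) /\<^sub>R r) * ((y - x) $ j * (y - x) $ j)) / r ^ (CARD('n) + 3) \<le> 4 * (r * r) / r ^ (CARD('n) + 3)"
    using r by (intro divide_right_mono, linarith) simp
  also have "\<dots> = 4 / r ^ (CARD('n) + 1)"
    using r by (simp add: power_add power3_eq_cube)
  finally have 1: "2 * (bump_slope ((y - x) /\<^sub>R r) * ((y - x) $ j * (y - x) $ j)) / r ^ (CARD('n) + 3) \<le> 4 / r ^ (CARD('n) + 1)" .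
  have 2: "0 \<le> 2 * (bump_slope ((y - x) /\<^sub>R r) * ((y - x) $ j * (y - x) $ j)) / r ^ (CARD('n) + 3)"
    by (rule divide_nonneg_nonneg[OF mult_nonneg_nonneg[OF _ mult_nonneg_nonneg[OF bump_slope_bounds(1) zero_le_square]]])
       (use r in auto)
  have 3: "0 \<le> bump ((y - x) /\<^sub>R r) / r ^ (CARD('n) + 1)" "bump ((y - x) /\<^sub>R r) / r ^ (CARD('n) + 1) \<le> 1 / r ^ (CARD('n) + 1)"
    using r by (auto simp: bump_nonneg bump_le_1 divide_right_mono)
  have "grad (\<lambda>y. (y - x) $ j / r * space_kernel r x y) y $ j = bump ((y - x) /\<^sub>R r) / r ^ (CARD('n) + 1)
      - 2 * (bump_slope ((y - x) /\<^sub>R r) * ((y - x) $ j * (y - x) $ j)) / r ^ (CARD('n) + 3)"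
    unfolding grad_weighted_kernel[OF r] by (simp add: axis_def mult_ac)
  then show ?thesis using 1 2 3 by linarith
qed

text \<open>
  Differentiation under the integral, followed by an integration by parts in space: with the
  divergence identity for the kernel, U meets only spatial derivatives of test functions, one
  for each coordinate.
\<close>

lemma avg_radius_deriv:
  assumes x: "x \<in> ball x0 \<rho>" and t: "t \<in> time_interval t0 \<rho>" and e: "0 < \<tau>" "\<tau> \<le> \<rho>\<^sup>2" and r: "0 < r" "r \<le> \<rho>"
  shows "((\<lambda>r. avg \<tau> r x t) has_real_derivative
    (LBINT z. ((space_kernel r x (fst z) * (bump ((snd z - t) /\<^sub>R \<tau>) / \<tau>) / r) *\<^sub>R (fst z - x)) \<bullet> G z)) (at r)"
proof -
  define \<theta> where "\<theta> = (\<lambda>s. bump ((s - t) /\<^sub>R \<tau>) / \<tau>)"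
  have [measurable]: "\<theta> \<in> borel_measurable borel" unfolding \<theta>_def by measurable
  have \<theta>: "0 \<le> \<theta> s" "\<theta> s \<le> 1 / \<tau>" for s
    using e by (auto simp: \<theta>_def bump_nonneg bump_le_1 divide_right_mono)
  have t\<theta>: "test_function (time_interval t0 (2 * \<rho>)) \<theta>"
  proof (rule test_function_in_time[OF t t e])
    show "times_differentiable k \<theta>" for k
      unfolding \<theta>_def divide_inverse by (intro times_differentiable_mult times_differentiable_const times_differentiable_bump_scaled)
    show "\<theta> s = 0" if "s \<notin> {t - \<tau>..t + \<tau>}" for s
    proof -
      have "s \<notin> ball t \<tau>" using that by (auto simp: dist_real_def)
      from bump_scaled_zero[OF e(1) this] show ?thesis unfolding \<theta>_def by (simp only: div_0)
    qed
  qed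
  have D: "((\<lambda>r. LBINT z. U z * (space_kernel r x (fst z) * \<theta> (snd z))) has_real_derivative
     (LBINT z. U z * (radius_deriv r x (fst z) * \<theta> (snd z)))) (at r)"
  \<comment> \<open>the radius is kept away from 0 so that the kernel derivative is bounded\<close>
  proof (rule has_derivative_under_integral[where a = "r / 2" and b = "2 * r" and C = "(4 + CARD('n)) / (r / 2) ^ (CARD('n) + 1) * (1 / \<tau>)"])
    fix s assume s: "r / 2 < s" "s < 2 * r"
    then have s0: "s > 0" using r by simp
    show "integrable lborel (\<lambda>z. U z * (space_kernel s x (fst z) * \<theta> (snd z)))"
    proof (rule integrable_mult_bounded[OF int(1)])
      show "\<bar>space_kernel s x (fst z) * \<theta> (snd z)\<bar> \<le> 1 / s ^ CARD('n) * (1 / \<tau>)" for z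
        using space_kernel_bounds[OF s0] \<theta> s0 by (simp only: abs_mult abs_of_nonneg) (intro mult_mono, auto)
    qed measurable
    fix z
    show "((\<lambda>r. space_kernel r x (fst z) * \<theta> (snd z)) has_real_derivative radius_deriv s x (fst z) * \<theta> (snd z)) (at s)"
      by (rule DERIV_cmult_right[OF space_kernel_radius_deriv[OF s0]])
    have "\<bar>radius_deriv s x (fst z)\<bar> \<le> (4 + CARD('n)) / (r / 2) ^ (CARD('n) + 1)"
      by (rule order_trans[OF radius_deriv_bound[OF s0]], intro divide_left_mono power_mono)
         (use s r in auto)
    then show "\<bar>radius_deriv s x (fst z) * \<theta> (snd z)\<bar> \<le> (4 + CARD('n)) / (r / 2) ^ (CARD('n) + 1) * (1 / \<tau>)"
      unfolding abs_mult using \<theta>[of "snd z"] r by (intro mult_mono) auto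
  qed (use int r in auto)
  define \<psi> where "\<psi> = (\<lambda>j y. (y - x) $ j / r * space_kernel r x y)"
  have tp: "test_function (ball x0 (2 * \<rho>)) (\<psi> j)" for j
    unfolding \<psi>_def
  proof (rule test_function_space_kernel[OF x r])
    have "times_differentiable k (\<lambda>y. (y $ j + - (x $ j)) * (1 / r))" for k
      by (intro times_differentiable_mult times_differentiable_add times_differentiable_const times_differentiable_linear bounded_linear_vec_nth)
    then show "times_differentiable k (\<lambda>y. (y - x) $ j / r)" for k by simp
  qed
  have [measurable]: "(\<lambda>y. grad (\<psi> j) y $ j) \<in> borel_measurable borel" for j
    unfolding \<psi>_def grad_weighted_kernel[OF r(1)] by measurable
  have [measurable]: "\<psi> j \<in> borel_measurable borel" for j
    unfolding \<psi>_def by measurable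
  have \<psi>_le: "\<bar>\<psi> j y\<bar> \<le> 1 / r ^ CARD('n)" for j y
  proof -
    have "\<bar>\<psi> j y\<bar> \<le> norm (y - x) / r * space_kernel r x y"
      using r space_kernel_bounds(1)[OF r(1)] component_le_norm_cart[of "y - x" j]
      by (simp add: \<psi>_def abs_mult divide_right_mono mult_right_mono)
    then show ?thesis using weighted_kernel_bound[OF r(1), of y x] by linarith
  qed
  have i1: "integrable lborel (\<lambda>z. U z * (grad (\<psi> j) (fst z) $ j * \<theta> (snd z)))" for j
  proof (rule integrable_mult_bounded[OF int(1)])
    show "\<bar>grad (\<psi> j) (fst z) $ j * \<theta> (snd z)\<bar> \<le> 5 / r ^ (CARD('n) + 1) * (1 / \<tau>)" for z
      unfolding abs_mult using grad_weighted_kernel_bound[OF r(1), of x j "fst z"] \<theta>[of "snd z"] r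
      by (intro mult_mono) (auto simp: \<psi>_def)
  qed measurable
  have i2: "integrable lborel (\<lambda>z. G z $ j * (\<psi> j (fst z) * \<theta> (snd z)))" for j
  proof (rule integrable_mult_bounded[OF integrable_nth[OF int(2)]])
    show "\<bar>\<psi> j (fst z) * \<theta> (snd z)\<bar> \<le> 1 / r ^ CARD('n) * (1 / \<tau>)" for z
      unfolding abs_mult using \<psi>_le[of j "fst z"] \<theta>[of "snd z"] r
      by (intro mult_mono) auto
  qed measurable
  have "(LBINT z. U z * (radius_deriv r x (fst z) * \<theta> (snd z)))
      = (LBINT z. - (\<Sum>j\<in>UNIV. U z * (grad (\<psi> j) (fst z) $ j * \<theta> (snd z))))"
  proof (rule Bochner_Integration.integral_cong[OF refl])
    fix z :: "(real^'n) \<times> real"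
    have "radius_deriv r x (fst z) = - (\<Sum>j\<in>UNIV. grad (\<psi> j) (fst z) $ j)"
      using kernel_divergence[OF r(1), of x "fst z"] by (simp add: \<psi>_def)
    then show "U z * (radius_deriv r x (fst z) * \<theta> (snd z)) = - (\<Sum>j\<in>UNIV. U z * (grad (\<psi> j) (fst z) $ j * \<theta> (snd z)))"
      by (simp add: sum_distrib_left sum_distrib_right)
  qed
  also have "\<dots> = - (\<Sum>j\<in>UNIV. LBINT z. U z * (grad (\<psi> j) (fst z) $ j * \<theta> (snd z)))"
    using i1 by simp
  also have "\<dots> = (\<Sum>j\<in>UNIV. LBINT z. \<psi> j (fst z) * \<theta> (snd z) * G z $ j)"
    by (simp add: weak_grad[OF tp t\<theta>] sum_negf)
  also have "\<dots> = (LBINT z. (\<Sum>j\<in>UNIV. \<psi> j (fst z) * \<theta> (snd z) * G z $ j))"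
    using i2 by (subst Bochner_Integration.integral_sum) (auto simp: mult_ac)
  also have "\<dots> = (LBINT z. ((space_kernel r x (fst z) * \<theta> (snd z) / r) *\<^sub>R (fst z - x)) \<bullet> G z)"
    by (intro Bochner_Integration.integral_cong[OF refl])
       (simp add: inner_vec_def \<psi>_def sum_distrib_left mult_ac)
  finally have "(LBINT z. U z * (radius_deriv r x (fst z) * \<theta> (snd z)))
     = (LBINT z. ((space_kernel r x (fst z) * \<theta> (snd z) / r) *\<^sub>R (fst z - x)) \<bullet> G z)" .
  with D show ?thesis by (simp only: avg_def \<theta>_def)
qed


text \<open>
  A pointwise Poincare inequality. The field in the radius derivative is at most r^(-n)/\<tau>
  on a cylinder of measure 2 \<tau> r^n times the volume of the unit ball, so the derivative is
  at most twice that volume times the maximal function, whatever the radius.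
\<close>

lemma avg_radius_estimate:
  assumes x: "x \<in> ball x0 \<rho>" and t: "t \<in> time_interval t0 \<rho>" and e: "0 < \<tau>" "\<tau> \<le> \<rho>\<^sup>2" "\<tau> \<le> \<rho>"
    and M: "strong_maximal g (x, t) \<le> ennreal m" "m \<ge> 0"
  shows "\<bar>avg \<tau> \<rho> x t - avg \<tau> \<tau> x t\<bar> \<le> 2 * unit_ball_vol (real CARD('n)) * \<rho> * m"
proof -
  let ?\<theta> = "\<lambda>z. bump ((snd z - t) /\<^sub>R \<tau>) / \<tau>"
  let ?X = "\<lambda>r z. (space_kernel r x (fst z) * ?\<theta> z / r) *\<^sub>R (fst z - x)"
  define W where "W = (\<lambda>r. LBINT z. ?X r z \<bullet> G z)"
  have D: "((\<lambda>r. avg \<tau> r x t) has_real_derivative W r) (at r)" if "\<tau> \<le> r" "r \<le> \<rho>" for r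
    unfolding W_def by (rule avg_radius_deriv[OF x t e(1,2)]) (use e that in auto)
  have W: "\<bar>W r\<bar> \<le> 2 * unit_ball_vol (real CARD('n)) * m" if r: "\<tau> \<le> r" "r \<le> \<rho>" for r
  proof -
    have r0: "r > 0" using r e by simp
    have "\<bar>W r\<bar> \<le> 1 / r ^ CARD('n) * (1 / \<tau>) * 1 * (unit_ball_vol (real CARD('n)) * r ^ CARD('n) * ((t + \<tau>) - (t - \<tau>))) * m"
      unfolding W_def
    proof (rule strong_maximal_controls_integral[OF g int(2) _ _ _ _ _ M])
      show "AE z in lborel. norm (G z) \<le> 1 * g z" using G_le by simp
      show "(x, t) \<in> ball x r \<times> {t - \<tau><..<t + \<tau>}" using r0 e by simp
    next
      fix z :: "(real^'n) \<times> real"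
      have b: "0 \<le> ?\<theta> z" "?\<theta> z \<le> 1 / \<tau>"
        using e bump_nonneg bump_le_1 by (auto intro!: divide_nonneg_pos divide_right_mono simp del: real_scaleR_def)
      have "norm (?X r z)
         = (norm (fst z - x) / r * space_kernel r x (fst z)) * ?\<theta> z"
        using r0 e(1) space_kernel_bounds(1)[OF r0, of x "fst z"] by (simp add: abs_mult mult_ac bump_nonneg)
      also have "\<dots> \<le> 1 / r ^ CARD('n) * (1 / \<tau>)"
        using b weighted_kernel_bound[OF r0] r0 by (intro mult_mono) auto
      finally show "norm (?X r z) \<le> 1 / r ^ CARD('n) * (1 / \<tau>)" .
      assume "z \<notin> ball x r \<times> {t - \<tau><..<t + \<tau>}"
      then consider "fst z \<notin> ball x r" | "snd z \<notin> ball t \<tau>"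
        by (cases z) (auto simp: dist_real_def abs_less_iff)
      then show "?X r z = 0"
        by cases (simp_all only: space_kernel_zero[OF r0] bump_scaled_zero[OF e(1)] simp_thms mult_zero_left mult_zero_right div_0 scaleR_zero_left)
    qed simp
    also have "\<dots> = 2 * unit_ball_vol (real CARD('n)) * m" using r0 e by simp
    finally show ?thesis .
  qed
  show ?thesis
  proof (cases "\<tau> = \<rho>")
    case False
    then obtain r where r: "\<tau> < r" "r < \<rho>" and eq: "avg \<tau> \<rho> x t - avg \<tau> \<tau> x t = (\<rho> - \<tau>) * W r"
      using MVT2[of \<tau> \<rho> "\<lambda>r. avg \<tau> r x t" W] D e by auto
    have "\<bar>(\<rho> - \<tau>) * W r\<bar> \<le> \<rho> * (2 * unit_ball_vol (real CARD('n)) * m)"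
      unfolding abs_mult using r e W[of r] by (intro mult_mono) auto
    then show ?thesis unfolding eq by (simp add: mult_ac)
  qed (use \<rho> M in simp)
qed

text \<open>
  The average at a later time differs from that at an earlier one by the integral of U against a
  time derivative, so the equation turns the difference into an integral of H against a spatial
  gradient. The factor 32 is 2 \<cdot> 4 \<cdot> 4: a bound 2 for the function of time, 4
  \<rho>^(-n-1) for the gradient of the kernel, and a time span of at most 4 \<rho>^2.
\<close>

lemma avg_time_estimate:
  assumes x: "x \<in> ball x0 \<rho>" and t: "t1 \<in> time_interval t0 \<rho>" "t2 \<in> time_interval t0 \<rho>" "t1 \<le> t2"
    and e: "0 < \<tau>" "\<tau> \<le> \<rho>\<^sup>2" and M: "strong_maximal g (x, s) \<le> ennreal m" "m \<ge> 0" and s: "s \<in> {t1..t2}"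
  shows "\<bar>avg \<tau> \<rho> x t1 - avg \<tau> \<rho> x t2\<bar> \<le> 32 * \<Lambda> * unit_ball_vol (real CARD('n)) * \<rho> * m"
proof -
  \<comment> \<open>a step up near the first time and a step down near the second; its derivative is the difference of the two time kernels\<close>
  define q where "q = (\<lambda>s. bump_primitive ((s - t1) /\<^sub>R \<tau>) - bump_primitive ((s - t2) /\<^sub>R \<tau>))"
  have tdp: "times_differentiable k (\<lambda>s. bump_primitive ((s - t) /\<^sub>R \<tau>))" for t k
  proof -
    have "times_differentiable k (\<lambda>s. bump_primitive (s /\<^sub>R \<tau> + - (t /\<^sub>R \<tau>)))"
      by (rule times_differentiable_comp_affine[OF bounded_linear_scaleR_right times_differentiable_bump_primitive])
    then show ?thesis by (simp add: right_diff_distrib)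
  qed
  have tdq: "times_differentiable k q" for k
    using times_differentiable_add[OF tdp[of k t1] times_differentiable_mult[OF times_differentiable_const[of k "-1"] tdp[of k t2]]] by (simp add: q_def)
  have q0: "q s = 0" if out: "s \<notin> {t1 - \<tau><..<t2 + \<tau>}" for s
  proof -
    consider "s \<le> t1 - \<tau>" | "s \<ge> t2 + \<tau>" using out by fastforce
    then show ?thesis
    proof cases
      case 1
      then have "(s - t1) /\<^sub>R \<tau> \<le> -1" "(s - t2) /\<^sub>R \<tau> \<le> -1" using e t by (auto simp: field_simps)
      then show ?thesis by (simp only: q_def bump_primitive_zero)
    next
      case 2
      then have "(s - t1) /\<^sub>R \<tau> \<ge> 1" "(s - t2) /\<^sub>R \<tau> \<ge> 1" using e t by (auto simp: field_simps)
      then show ?thesis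
        using bump_primitive_const[of "(s - t1) /\<^sub>R \<tau>"] bump_primitive_const[of "(s - t2) /\<^sub>R \<tau>"] by (simp only: q_def)
    qed
  qed
  have tq: "test_function (time_interval t0 (2 * \<rho>)) q"
    by (rule test_function_in_time[OF t(1,2) e tdq]) (use q0 in auto)
  have q_le: "\<bar>q s\<bar> \<le> 2" for s
    unfolding q_def using bump_primitive_bounds[of "(s - t1) /\<^sub>R \<tau>"] bump_primitive_bounds[of "(s - t2) /\<^sub>R \<tau>"] by linarith
  have dq: "deriv q s = bump ((s - t1) /\<^sub>R \<tau>) / \<tau> - bump ((s - t2) /\<^sub>R \<tau>) / \<tau>" for s
  proof (rule DERIV_imp_deriv)
    have "((\<lambda>s. bump_primitive ((s - t) /\<^sub>R \<tau>)) has_real_derivative bump ((s - t) /\<^sub>R \<tau>) * (1 / \<tau>)) (at s)" for t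
      by (rule DERIV_chain2[OF bump_primitive_deriv]) (use e in \<open>auto intro!: derivative_eq_intros simp: divide_inverse\<close>)
    from DERIV_diff[OF this[of t1] this[of t2]]
    show "(q has_real_derivative bump ((s - t1) /\<^sub>R \<tau>) / \<tau> - bump ((s - t2) /\<^sub>R \<tau>) / \<tau>) (at s)"
      unfolding q_def by simp
  qed
  define p where "p = space_kernel \<rho> x"
  have tp: "test_function (ball x0 (2 * \<rho>)) p"
    unfolding p_def using test_function_space_kernel[OF x \<rho> order_refl times_differentiable_const, of 1] by simp
  have gp: "grad p y = - (2 * bump_slope ((y - x) /\<^sub>R \<rho>) / \<rho> ^ (CARD('n) + 2)) *\<^sub>R (y - x)" for y
  proof (rule grad_eqI)
    have "((\<lambda>y. bump ((y - x) /\<^sub>R \<rho>) / \<rho> ^ CARD('n)) has_derivative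
       (\<lambda>v. ((- (2 * bump_slope ((y - x) /\<^sub>R \<rho>) / \<rho>\<^sup>2) *\<^sub>R (y - x)) \<bullet> v) / \<rho> ^ CARD('n))) (at y)"
      unfolding divide_inverse[of _ "\<rho> ^ CARD('n)"]
      by (rule has_derivative_mult_left[OF bump_scaled_deriv[OF \<rho>]])
    then show "(p has_derivative (\<lambda>v. (- (2 * bump_slope ((y - x) /\<^sub>R \<rho>) / \<rho> ^ (CARD('n) + 2)) *\<^sub>R (y - x)) \<bullet> v)) (at y)"
      unfolding p_def space_kernel_def[abs_def]
      by (rule has_derivative_eq_rhs) (simp add: fun_eq_iff power_add mult_ac power2_eq_square del: scaleR_diff_right)
  qed
  have gp_le: "norm (grad p y) \<le> 4 / \<rho> ^ (CARD('n) + 1)" for y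
  proof -
    have "bump_slope ((y - x) /\<^sub>R \<rho>) * norm (y - x) \<le> 2 * \<rho>"
    proof (cases "y \<in> ball x \<rho>")
      case True
      then have "norm (y - x) \<le> \<rho>" by (simp add: dist_norm norm_minus_commute)
      then show ?thesis by (rule mult_mono[OF bump_slope_bounds(2)]) auto
    qed (use \<rho> in \<open>simp add: bump_slope_scaled_zero\<close>)
    then have "2 * (bump_slope ((y - x) /\<^sub>R \<rho>) * norm (y - x)) / \<rho> ^ (CARD('n) + 2) \<le> 4 * \<rho> / \<rho> ^ (CARD('n) + 2)"
      using \<rho> by (intro divide_right_mono, linarith) simp
    then show ?thesis
      unfolding gp using \<rho> bump_slope_bounds(1)[of "(y - x) /\<^sub>R \<rho>"]
      by (simp add: power_add power2_eq_square abs_mult del: scaleR_diff_right)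
  qed
  have gp0: "grad p y = 0" if "y \<notin> ball x \<rho>" for y
    unfolding gp using bump_slope_scaled_zero[OF \<rho> that] by simp
  have i: "integrable lborel (\<lambda>z. U z * (space_kernel \<rho> x (fst z) * (bump ((snd z - t) /\<^sub>R \<tau>) / \<tau>)))" for t
  proof (rule integrable_mult_bounded[OF int(1)])
    show "\<bar>space_kernel \<rho> x (fst z) * (bump ((snd z - t) /\<^sub>R \<tau>) / \<tau>)\<bar> \<le> 1 / \<rho> ^ CARD('n) * (1 / \<tau>)" for z
      unfolding abs_mult
      using space_kernel_bounds[OF \<rho>, of x "fst z"] \<rho> e bump_nonneg[of "(snd z - t) /\<^sub>R \<tau>"] bump_le_1[of "(snd z - t) /\<^sub>R \<tau>"]
      by (intro mult_mono) (auto intro: divide_right_mono simp del: real_scaleR_def)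
  qed measurable
  have "avg \<tau> \<rho> x t1 - avg \<tau> \<rho> x t2 = (LBINT z. U z * (p (fst z) * deriv q (snd z)))"
    unfolding avg_def by (subst Bochner_Integration.integral_diff[OF i i, symmetric])
      (simp add: p_def dq right_diff_distrib del: real_scaleR_def)
  also have "\<dots> = (LBINT z. (q (snd z) *\<^sub>R grad p (fst z)) \<bullet> H z)"
    unfolding weak_eq[OF tp tq] by simp
  finally have eq: "avg \<tau> \<rho> x t1 - avg \<tau> \<rho> x t2 = (LBINT z. (q (snd z) *\<^sub>R grad p (fst z)) \<bullet> H z)" .
  have "\<bar>avg \<tau> \<rho> x t1 - avg \<tau> \<rho> x t2\<bar> \<le> 2 * (4 / \<rho> ^ (CARD('n) + 1)) * \<Lambda> *
      (unit_ball_vol (real CARD('n)) * \<rho> ^ CARD('n) * ((t2 + \<tau>) - (t1 - \<tau>))) * m"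
    unfolding eq
  proof (rule strong_maximal_controls_integral[OF g int(3) H_le \<Lambda> _ _ _ M])
    show "(x, s) \<in> ball x \<rho> \<times> {t1 - \<tau><..<t2 + \<tau>}" using \<rho> e s by simp
  next
    fix z :: "(real^'n) \<times> real"
    show "norm (q (snd z) *\<^sub>R grad p (fst z)) \<le> 2 * (4 / \<rho> ^ (CARD('n) + 1))"
      unfolding norm_scaleR using q_le gp_le \<rho> by (intro mult_mono) auto
    assume "z \<notin> ball x \<rho> \<times> {t1 - \<tau><..<t2 + \<tau>}"
    then show "q (snd z) *\<^sub>R grad p (fst z) = 0"
      using q0[of "snd z"] gp0[of "fst z"] by (cases z) auto
  qed
  also have "\<dots> = 8 * \<Lambda> * unit_ball_vol (real CARD('n)) / \<rho> * (t2 - t1 + 2 * \<tau>) * m"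
    using \<rho> by (simp add: field_simps)
  also have "\<dots> \<le> 8 * \<Lambda> * unit_ball_vol (real CARD('n)) / \<rho> * (4 * \<rho>\<^sup>2) * m"
  proof (intro mult_right_mono mult_left_mono)
    show "t2 - t1 + 2 * \<tau> \<le> 4 * \<rho>\<^sup>2" using t e by (auto simp: time_interval_def)
  qed (use \<Lambda> \<rho> M in auto)
  also have "\<dots> = 32 * \<Lambda> * unit_ball_vol (real CARD('n)) * \<rho> * m"
    using \<rho> by (simp add: power2_eq_square)
  finally show ?thesis .
qed

text \<open>
  From (x,t1) to radius \<rho>, across to t2 at this radius, and back to radius \<tau>.
\<close>

lemma avg_estimate:
  assumes x: "x \<in> ball x0 \<rho>" and t: "t1 \<in> time_interval t0 \<rho>" "t2 \<in> time_interval t0 \<rho>"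
    and e: "0 < \<tau>" "\<tau> \<le> \<rho>\<^sup>2" "\<tau> \<le> \<rho>"
    and M: "strong_maximal g (x, t1) \<le> ennreal m1" "m1 \<ge> 0" "strong_maximal g (x, t2) \<le> ennreal m2" "m2 \<ge> 0"
  shows "\<bar>avg \<tau> \<tau> x t1 - avg \<tau> \<tau> x t2\<bar> \<le> (2 + 32 * \<Lambda>) * unit_ball_vol (real CARD('n)) * \<rho> * (m1 + m2)"
proof -
  let ?w = "unit_ball_vol (real CARD('n))"
  have "\<bar>avg \<tau> \<rho> x t1 - avg \<tau> \<rho> x t2\<bar> \<le> 32 * \<Lambda> * ?w * \<rho> * m1"
  proof (cases "t1 \<le> t2")
    case True
    then show ?thesis using avg_time_estimate[OF x t True e(1,2) M(1,2)] by simp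
  next
    case False
    then show ?thesis using avg_time_estimate[OF x t(2,1) _ e(1,2) M(1,2)] by (simp add: abs_minus_commute)
  qed
  moreover have "0 \<le> 32 * \<Lambda> * ?w * \<rho> * m2" using \<Lambda> \<rho> M by simp
  moreover have "(2 + 32 * \<Lambda>) * ?w * \<rho> * (m1 + m2) =
      2 * ?w * \<rho> * m1 + 2 * ?w * \<rho> * m2 + 32 * \<Lambda> * ?w * \<rho> * m1 + 32 * \<Lambda> * ?w * \<rho> * m2"
    by (simp add: algebra_simps)
  ultimately show ?thesis
    using avg_radius_estimate[OF x t(1) e M(1,2)] avg_radius_estimate[OF x t(2) e M(3,4)] by linarith
qed

lemma avg_eq_mollify:
  assumes "\<tau> > 0"
  shows "avg \<tau> \<tau> x t = mollify (\<lambda>z. bump (fst z) * bump (snd z)) \<tau> U (x, t)"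
  unfolding avg_def mollify_def
  by (intro Bochner_Integration.integral_cong[OF refl]) (use assms in \<open>simp add: space_kernel_def mult_ac DIM_prod del: real_scaleR_def\<close>)

end

section \<open>Norms of tuples by duality\<close>

lemma tnorm_nonneg: "0 \<le> tnorm N v"
  by (simp add: tnorm_def L2_set_nonneg)

lemma norm_le_tnorm: "i < N \<Longrightarrow> norm (v i) \<le> tnorm N v"
  unfolding tnorm_def using member_le_L2_set[of "{..<N}" i "\<lambda>i. norm (v i)"] by auto

lemma norm_weighted_sum_le:
  fixes v :: "nat \<Rightarrow> 'a::real_normed_vector"
  assumes "tnorm N w \<le> 1"
  shows "norm (\<Sum>i<N. (w i :: real) *\<^sub>R v i) \<le> tnorm N v"
proof -
  have "norm (\<Sum>i<N. w i *\<^sub>R v i) \<le> (\<Sum>i<N. \<bar>norm (w i)\<bar> * \<bar>norm (v i)\<bar>)"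
    by (rule order_trans[OF norm_sum]) simp
  also have "\<dots> \<le> tnorm N w * tnorm N v"
    unfolding tnorm_def by (rule L2_set_mult_ineq)
  also have "\<dots> \<le> 1 * tnorm N v" by (intro mult_right_mono assms tnorm_nonneg)
  finally show ?thesis by simp
qed

text \<open>
  The supremum is attained at v divided by its norm. Estimates for all weighted sums thus give
  estimates for the tuple with the same constant, whatever the number of components.
\<close>

lemma tnorm_le_by_duality:
  fixes v :: "nat \<Rightarrow> real"
  assumes "\<And>w. tnorm N w \<le> 1 \<Longrightarrow> (\<Sum>i<N. w i * v i) \<le> b"
  shows "tnorm N v \<le> b"
proof (cases "tnorm N v = 0")
  case True
  have "(\<Sum>i<N. 0 * v i) \<le> b" by (rule assms) (simp add: tnorm_def L2_set_def)
  with True show ?thesis by simp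
next
  case False
  define l where "l = tnorm N v"
  have l: "l > 0" using False tnorm_nonneg[of N v] by (simp add: l_def)
  have sq: "l\<^sup>2 = (\<Sum>i<N. (v i)\<^sup>2)"
    by (simp add: l_def tnorm_def L2_set_def sum_nonneg)
  have "tnorm N (\<lambda>i. v i / l) = 1"
  proof -
    have "(\<Sum>i<N. (v i / l)\<^sup>2) = 1"
      using l by (simp add: power_divide sum_divide_distrib[symmetric] sq[symmetric])
    then show ?thesis by (simp add: tnorm_def L2_set_def power_divide)
  qed
  then have "(\<Sum>i<N. v i / l * v i) \<le> b" by (intro assms) simp
  also have "(\<Sum>i<N. v i / l * v i) = (\<Sum>i<N. (v i)\<^sup>2) / l"
    by (simp add: sum_divide_distrib power2_eq_square)
  also have "\<dots> = l" unfolding sq[symmetric] using l by (simp add: power2_eq_square)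
  finally show ?thesis by (simp add: l_def)
qed

section \<open>From time differences to mean oscillation\<close>

lemma ennpowr_eq_ennreal: "m \<noteq> \<infinity> \<Longrightarrow> ennpowr m q = ennreal (enn2real m powr q)"
  by (simp add: ennpowr_def)

lemma borel_measurable_ennpowr[measurable (raw)]:
  assumes [measurable]: "f \<in> borel_measurable M"
  shows "(\<lambda>x. ennpowr (f x) q) \<in> borel_measurable M"
proof -
  have "f -` {\<infinity>} \<inter> space M \<in> sets M" by (rule measurable_sets[OF assms]) simp
  moreover have "f -` {\<infinity>} \<inter> space M = {x \<in> space M. f x = \<infinity>}" by auto
  ultimately have "{x \<in> space M. f x = \<infinity>} \<in> sets M" by simp
  moreover have "(\<lambda>x. ennreal (enn2real (f x) powr q)) \<in> borel_measurable M"
    by (intro measurable_compose[OF _ measurable_ennreal] powr_real_measurable borel_measurable_const) measurable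
  ultimately show ?thesis
    unfolding ennpowr_def by (intro measurable_If borel_measurable_const)
qed

text \<open>
  Integrated with a suitable \<mu>, this bounds the mean of a function by the mean of its q-th
  power, in place of Jensen's inequality.
\<close>

lemma young_powr:
  fixes a \<mu> q :: real
  assumes "0 \<le> a" "0 < \<mu>" "1 < q"
  shows "a \<le> \<mu> + \<mu> powr (1 - q) * a powr q"
proof (cases "a \<le> \<mu>")
  case True
  then show ?thesis using assms by (simp add: add_increasing2)
next
  case False
  then have "(a / \<mu>) powr (q - 1) \<ge> 1" using assms by (intro ge_one_powr_ge_zero) auto
  then have "a * 1 \<le> a * (a / \<mu>) powr (q - 1)" using assms by (intro mult_left_mono) auto
  also have "\<dots> = \<mu> powr (1 - q) * a powr q"
    using assms False by (simp add: powr_divide powr_diff powr_minus field_simps)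
  finally show ?thesis using assms by simp
qed

lemma powr_add_le:
  fixes r s q :: real
  assumes "0 \<le> r" "0 \<le> s" "0 < q"
  shows "(r + s) powr q \<le> 2 powr q * (r powr q + s powr q)"
proof -
  have "(r + s) powr q \<le> (2 * max r s) powr q" using assms by (intro powr_mono2) auto
  also have "\<dots> = 2 powr q * max r s powr q" using assms by (simp add: powr_mult)
  also have "max r s powr q \<le> r powr q + s powr q" by (simp add: max_def)
  finally show ?thesis by simp
qed

text \<open>
  If the mean of m^q is at most \<mu>^q, then Young's inequality bounds the mean of m by 2
  \<mu>. Averaging the difference inequality over s bounds the distance of v(t) from its mean by
  \<kappa> (m(t) + 2 \<mu>), and the q-th power of this is integrated in t. The mean is
  componentwise, so it is compared with v(t) by duality.
\<close>

lemma mean_oscillation_bound_level: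
  fixes v :: "real \<Rightarrow> nat \<Rightarrow> real" and m :: "real \<Rightarrow> ennreal" and a b \<kappa> \<mu> q :: real
  assumes q: "1 < q" and ab: "a < b" and \<kappa>: "0 < \<kappa>"
    and m[measurable]: "m \<in> borel_measurable borel"
    and v: "\<And>i. i < N \<Longrightarrow> integrable lborel (\<lambda>t. v t i)"
    and Z: "AE t in lborel. t \<in> {a<..<b} \<longrightarrow> t \<in> Z"
    and osc: "\<And>s t m1 m2. s \<in> Z \<Longrightarrow> t \<in> Z \<Longrightarrow> m s \<le> ennreal m1 \<Longrightarrow> m t \<le> ennreal m2 \<Longrightarrow> 0 \<le> m1 \<Longrightarrow> 0 \<le> m2 \<Longrightarrow>
        tnorm N (\<lambda>i. v s i - v t i) \<le> \<kappa> * (m1 + m2)"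
    and \<mu>: "\<mu> > 0" "nn_mean {a<..<b} (\<lambda>t. ennpowr (m t) q) \<le> ennreal (\<mu> powr q)"
  shows "nn_mean {a<..<b} (\<lambda>t. ennreal (tnorm N (\<lambda>i. v t i - mean {a<..<b} (\<lambda>t. v t i)) powr q))
     \<le> ennreal (\<kappa> powr q * 2 powr q * (1 + 2 powr q) * \<mu> powr q)"
proof -
  define I where "I = {a<..<b}"
  define l where "l = b - a"
  let ?O = "\<lambda>t. tnorm N (\<lambda>i. v t i - mean I (\<lambda>t. v t i))"
  have l: "l > 0" using ab by (simp add: l_def)
  have [measurable]: "I \<in> sets borel" by (simp add: I_def)
  have eI: "emeasure lborel I = ennreal l" "measure lborel I = l" "emeasure lebesgue I = ennreal l" "measure lebesgue I = l"
    using ab by (auto simp: I_def l_def measure_def)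
  define r where "r = (\<lambda>t. enn2real (m t))"
  have [measurable]: "r \<in> borel_measurable borel" by (simp add: r_def)
  have r0: "r t \<ge> 0" for t by (simp add: r_def)
  have P: "(\<integral>\<^sup>+t\<in>I. ennpowr (m t) q \<partial>lborel) \<le> ennreal (\<mu> powr q * l)"
  proof -
    have "(\<integral>\<^sup>+t\<in>I. ennpowr (m t) q \<partial>lborel) / ennreal l \<le> ennreal (\<mu> powr q)"
      using \<mu>(2) unfolding I_def[symmetric] by (simp add: nn_mean_def eI nn_integral_completion)
    then have "(\<integral>\<^sup>+t\<in>I. ennpowr (m t) q \<partial>lborel) / ennreal l * ennreal l \<le> ennreal (\<mu> powr q) * ennreal l"
      by (rule mult_right_mono) simp
    then show ?thesis using l by (simp add: ennreal_divide_times ennreal_mult)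
  qed
  have fin: "AE t in lborel. t \<in> I \<longrightarrow> m t \<noteq> \<infinity>"
  proof -
    have "AE t in lborel. ennpowr (m t) q * indicator I t \<noteq> \<infinity>"
      using P by (intro nn_integral_PInf_AE) (auto simp: top_unique)
    then show ?thesis by eventually_elim (auto simp: ennpowr_def)
  qed
  let ?Rq = "\<integral>\<^sup>+t\<in>I. ennreal (r t powr q) \<partial>lborel" and ?R = "\<integral>\<^sup>+t\<in>I. ennreal (r t) \<partial>lborel"
  have rq: "?Rq \<le> ennreal (\<mu> powr q * l)"
  proof -
    have "?Rq = (\<integral>\<^sup>+t\<in>I. ennpowr (m t) q \<partial>lborel)"
      using fin by (intro nn_integral_cong_AE, eventually_elim) (auto simp: ennpowr_eq_ennreal r_def indicator_def)
    with P show ?thesis by simp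
  qed
  \<comment> \<open>Young's inequality at level \<mu> makes m integrable although only m^q is controlled\<close>
  have rI: "?R \<le> ennreal (2 * \<mu> * l)"
  proof -
    have "?R \<le> (\<integral>\<^sup>+t. ennreal \<mu> * indicator I t + ennreal (\<mu> powr (1 - q)) * (ennreal (r t powr q) * indicator I t) \<partial>lborel)"
      using young_powr[OF r0 \<mu>(1) q] \<mu>
      by (intro nn_integral_mono) (auto simp: indicator_def ennreal_mult[symmetric] ennreal_plus[symmetric] simp del: ennreal_plus)
    also have "\<dots> = ennreal \<mu> * ennreal l + ennreal (\<mu> powr (1 - q)) * ?Rq"
      by (subst nn_integral_add, measurable) (simp add: nn_integral_cmult nn_integral_cmult_indicator eI)
    also have "\<dots> \<le> ennreal \<mu> * ennreal l + ennreal (\<mu> powr (1 - q)) * ennreal (\<mu> powr q * l)"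
      by (intro add_left_mono mult_left_mono rq) simp
    also have "\<dots> = ennreal (\<mu> * l + \<mu> powr (1 - q) * (\<mu> powr q * l))"
      using \<mu> l by (simp add: ennreal_mult[symmetric] ennreal_plus[symmetric] del: ennreal_plus)
    also have "\<mu> powr (1 - q) * (\<mu> powr q * l) = \<mu> * l"
      using \<mu> by (simp add: mult.assoc[symmetric] powr_add[symmetric])
    finally show ?thesis by (simp add: mult.assoc)
  qed
  have ir: "integrable lborel (\<lambda>t. indicator I t * r t)"
  proof (rule integrableI_nonneg)
    have "(\<integral>\<^sup>+t. ennreal (indicator I t * r t) \<partial>lborel) = ?R"
      by (intro nn_integral_cong) (auto simp: indicator_def)
    also have "\<dots> < \<infinity>" using rI by (auto simp: less_top[symmetric] top_unique)
    finally show "(\<integral>\<^sup>+t. ennreal (indicator I t * r t) \<partial>lborel) < \<infinity>" .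
  qed (auto simp: r0)
  have r_int: "(LBINT t. indicator I t * r t) \<le> 2 * \<mu> * l"
  proof -
    have "ennreal (LBINT t. indicator I t * r t) = (\<integral>\<^sup>+t. ennreal (indicator I t * r t) \<partial>lborel)"
      by (rule nn_integral_eq_integral[symmetric, OF ir]) (simp add: r0)
    also have "\<dots> = ?R"
      by (intro nn_integral_cong) (auto simp: indicator_def)
    also note rI
    finally show ?thesis by (rule ennreal_le_iff[THEN iffD1, rotated]) (use \<mu>(1) l in simp)
  qed
  have i1: "integrable lborel (\<lambda>s. indicator I s :: real)"
    using eI by (intro integrable_real_indicator) auto
  have iv: "integrable lborel (\<lambda>s. indicator I s * v s i)" if "i < N" for i
    using integrable_mult_indicator[OF _ v[OF that], of I] by simp
  have mean_eq: "mean I (\<lambda>t. v t i) = (LBINT s. indicator I s * v s i) / l" if "i < N" for i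
    using iv[OF that] by (simp add: mean_def eI set_lebesgue_integral_def integral_completion)
  have key: "AE t in lborel. t \<in> I \<longrightarrow> ?O t \<le> \<kappa> * (r t + 2 * \<mu>)"
    using Z fin
  proof eventually_elim
    case (elim t)
    show ?case
    proof (intro impI tnorm_le_by_duality)
      fix w :: "nat \<Rightarrow> real" assume t: "t \<in> I" and w: "tnorm N w \<le> 1"
      have "(\<Sum>i<N. w i * (v t i - mean I (\<lambda>t. v t i))) * l =
         (\<Sum>i<N. w i * (LBINT s. indicator I s * v t i - indicator I s * v s i))"
        unfolding sum_distrib_right
      proof (rule sum.cong[OF refl])
        fix i assume "i \<in> {..<N}"
        then have i: "i < N" by simp
        have eq: "(LBINT s. indicator I s * v t i - indicator I s * v s i) = l * v t i - (LBINT s. indicator I s * v s i)"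
          using i1 iv[OF i] eI by simp
        show "w i * (v t i - mean I (\<lambda>t. v t i)) * l = w i * (LBINT s. indicator I s * v t i - indicator I s * v s i)"
          unfolding eq mean_eq[OF i] using l by (simp add: field_simps)
      qed
      also have "\<dots> = (LBINT s. (\<Sum>i<N. w i * (indicator I s * v t i - indicator I s * v s i)))"
        using i1 iv by (subst Bochner_Integration.integral_sum) auto
      also have "\<dots> \<le> (LBINT s. \<kappa> * (r t * indicator I s + indicator I s * r s))"
      proof (rule integral_mono_AE)
        show "integrable lborel (\<lambda>s. \<Sum>i<N. w i * (indicator I s * v t i - indicator I s * v s i))"
          using i1 iv by auto
        show "integrable lborel (\<lambda>s. \<kappa> * (r t * indicator I s + indicator I s * r s))"
          using i1 ir by auto
        show "AE s in lborel. (\<Sum>i<N. w i * (indicator I s * v t i - indicator I s * v s i)) \<le> \<kappa> * (r t * indicator I s + indicator I s * r s)"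
          using Z fin
        proof eventually_elim
          fix s assume s: "s \<in> {a<..<b} \<longrightarrow> s \<in> Z" "s \<in> I \<longrightarrow> m s \<noteq> \<infinity>"
          show "(\<Sum>i<N. w i * (indicator I s * v t i - indicator I s * v s i)) \<le> \<kappa> * (r t * indicator I s + indicator I s * r s)"
          proof (cases "s \<in> I")
            case True
            have "(\<Sum>i<N. w i * (v t i - v s i)) \<le> tnorm N (\<lambda>i. v t i - v s i)"
              using norm_weighted_sum_le[OF w, of "\<lambda>i. v t i - v s i"] by (simp add: abs_le_iff)
            also have "\<dots> \<le> \<kappa> * (r t + r s)"
              using s t elim True by (intro osc) (auto simp: I_def r_def less_top)
            finally show ?thesis using True by simp
          qed simp
        qed
      qed
      also have "\<dots> = \<kappa> * (r t * l + (LBINT s. indicator I s * r s))"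
        using i1 ir eI by simp
      also have "\<dots> \<le> \<kappa> * (r t * l + 2 * \<mu> * l)"
        using r_int \<kappa> by (intro mult_left_mono) auto
      also have "\<dots> = \<kappa> * (r t + 2 * \<mu>) * l" by (simp add: algebra_simps)
      finally show "(\<Sum>i<N. w i * (v t i - mean I (\<lambda>t. v t i))) \<le> \<kappa> * (r t + 2 * \<mu>)"
        using l by simp
    qed
  qed
  define c where "c = \<kappa> powr q * 2 powr q"
  have c: "c \<ge> 0" by (simp add: c_def)
  have "(\<integral>\<^sup>+t\<in>I. ennreal (?O t powr q) \<partial>lborel) \<le>
     (\<integral>\<^sup>+t. ennreal c * (ennreal (r t powr q) * indicator I t) + ennreal (c * (2 * \<mu>) powr q) * indicator I t \<partial>lborel)"
  proof (rule nn_integral_mono_AE)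
    show "AE t in lborel. ennreal (?O t powr q) * indicator I t
      \<le> ennreal c * (ennreal (r t powr q) * indicator I t) + ennreal (c * (2 * \<mu>) powr q) * indicator I t"
      using key
    proof eventually_elim
      case (elim t)
      show ?case
      proof (cases "t \<in> I")
        case True
        have "?O t powr q \<le> (\<kappa> * (r t + 2 * \<mu>)) powr q"
          using elim True q by (intro powr_mono2 tnorm_nonneg) auto
        also have "\<dots> = \<kappa> powr q * (r t + 2 * \<mu>) powr q"
          using \<kappa> r0[of t] \<mu> by (simp add: powr_mult)
        also have "\<dots> \<le> \<kappa> powr q * (2 powr q * (r t powr q + (2 * \<mu>) powr q))"
          using r0[of t] \<mu> q by (intro mult_left_mono powr_add_le) auto
        also have "\<dots> = c * r t powr q + c * (2 * \<mu>) powr q"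
          by (simp add: c_def algebra_simps)
        finally show ?thesis
          using True c by (simp add: ennreal_mult[symmetric] ennreal_plus[symmetric] del: ennreal_plus)
      qed simp
    qed
  qed
  also have "\<dots> = ennreal c * ?Rq + ennreal (c * (2 * \<mu>) powr q) * ennreal l"
    by (subst nn_integral_add, measurable) (simp add: nn_integral_cmult nn_integral_cmult_indicator eI)
  also have "\<dots> \<le> ennreal c * ennreal (\<mu> powr q * l) + ennreal (c * (2 * \<mu>) powr q) * ennreal l"
    by (intro add_right_mono mult_left_mono rq) simp
  also have "\<dots> = ennreal (\<kappa> powr q * 2 powr q * (1 + 2 powr q) * \<mu> powr q * l)"
    using l c \<mu> by (simp add: ennreal_mult[symmetric] ennreal_plus[symmetric] powr_mult c_def algebra_simps del: ennreal_plus)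
  finally have F: "(\<integral>\<^sup>+t\<in>I. ennreal (?O t powr q) \<partial>lborel) \<le>
     ennreal (\<kappa> powr q * 2 powr q * (1 + 2 powr q) * \<mu> powr q * l)" .
  have "nn_mean I (\<lambda>t. ennreal (?O t powr q))
     \<le> ennreal (\<kappa> powr q * 2 powr q * (1 + 2 powr q) * \<mu> powr q * l) / ennreal l"
    unfolding nn_mean_def eI nn_integral_completion by (rule divide_right_mono_ennreal[OF F])
  also have "\<dots> = ennreal (\<kappa> powr q * 2 powr q * (1 + 2 powr q) * \<mu> powr q)"
    using l by (subst divide_ennreal) auto
  finally show ?thesis by (simp add: I_def)
qed

text \<open>
  The level is taken slightly above the mean of m^q, since it has to be positive even if m
  vanishes.
\<close>

lemma mean_oscillation_bound:
  fixes v :: "real \<Rightarrow> nat \<Rightarrow> real" and m :: "real \<Rightarrow> ennreal" and a b \<kappa> q :: real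
  assumes q: "1 < q" and ab: "a < b" and \<kappa>: "0 < \<kappa>"
    and m[measurable]: "m \<in> borel_measurable borel"
    and v: "\<And>i. i < N \<Longrightarrow> integrable lborel (\<lambda>t. v t i)"
    and Z: "AE t in lborel. t \<in> {a<..<b} \<longrightarrow> t \<in> Z"
    and osc: "\<And>s t m1 m2. s \<in> Z \<Longrightarrow> t \<in> Z \<Longrightarrow> m s \<le> ennreal m1 \<Longrightarrow> m t \<le> ennreal m2 \<Longrightarrow> 0 \<le> m1 \<Longrightarrow> 0 \<le> m2 \<Longrightarrow>
        tnorm N (\<lambda>i. v s i - v t i) \<le> \<kappa> * (m1 + m2)"
  shows "nn_mean {a<..<b} (\<lambda>t. ennreal (tnorm N (\<lambda>i. v t i - mean {a<..<b} (\<lambda>t. v t i)) powr q))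
     \<le> ennreal (\<kappa> powr q * 2 powr q * (1 + 2 powr q)) * nn_mean {a<..<b} (\<lambda>t. ennpowr (m t) q)"
proof -
  define C where "C = \<kappa> powr q * 2 powr q * (1 + 2 powr q)"
  have C: "C > 0" using \<kappa> by (simp add: C_def add_pos_pos)
  let ?R = "nn_mean {a<..<b} (\<lambda>t. ennpowr (m t) q)"
  show ?thesis
  proof (cases "?R = \<infinity>")
    case True
    then show ?thesis using C by (simp add: C_def[symmetric] ennreal_mult_top)
  next
    case False
    define R where "R = enn2real ?R"
    have R: "?R = ennreal R" "R \<ge> 0" using False by (auto simp: R_def less_top)
    show ?thesis
    proof (rule ennreal_le_epsilon)
      fix e :: real assume e: "e > 0"
      define \<mu> where "\<mu> = (R + e / C) powr (1 / q)"
      have pos: "R + e / C > 0" using R e C by (simp add: add_nonneg_pos)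
      have \<mu>: "\<mu> > 0" "\<mu> powr q = R + e / C" using pos q by (auto simp: \<mu>_def powr_powr)
      have "?R \<le> ennreal (\<mu> powr q)"
        unfolding R(1) \<mu>(2) using e C by (intro ennreal_leI) simp
      from mean_oscillation_bound_level[OF q ab \<kappa> m v Z osc \<mu>(1) this]
      have "nn_mean {a<..<b} (\<lambda>t. ennreal (tnorm N (\<lambda>i. v t i - mean {a<..<b} (\<lambda>t. v t i)) powr q))
        \<le> ennreal (C * \<mu> powr q)" by (simp add: C_def)
      also have "C * \<mu> powr q = C * R + e" using C by (simp add: \<mu>(2) distrib_left)
      finally show "nn_mean {a<..<b} (\<lambda>t. ennreal (tnorm N (\<lambda>i. v t i - mean {a<..<b} (\<lambda>t. v t i)) powr q))
         \<le> ennreal (\<kappa> powr q * 2 powr q * (1 + 2 powr q)) * ?R + ennreal e"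
        using C R e by (simp add: R(1) C_def[symmetric] ennreal_mult[symmetric])
    qed
  qed
qed

section \<open>Measurability and Fubini\<close>

lemma lebesgue_measurable_if_AE_eq:
  fixes f :: "'a::euclidean_space \<Rightarrow> 'b::topological_space"
  assumes g: "g \<in> borel_measurable lebesgue" and eq: "AE z in lborel. f z = g z"
  shows "f \<in> borel_measurable lebesgue"
proof (rule measurableI)
  fix A :: "'b set" assume A: "A \<in> sets borel"
  have a: "g -` A \<inter> space lebesgue \<in> sets lebesgue"
    by (rule measurable_sets[OF g A])
  have b: "AE z in lebesgue. z \<in> g -` A \<inter> space lebesgue \<longleftrightarrow> z \<in> f -` A \<inter> space lebesgue"
    unfolding AE_completion_iff using eq by eventually_elim auto
  show "f -` A \<inter> space lebesgue \<in> sets lebesgue"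
    by (rule completion.in_sets_AE[OF b a]) simp
qed simp

lemma integral_lebesgue_if_AE_eq:
  fixes f :: "'a::euclidean_space \<Rightarrow> 'b::{banach, second_countable_topology}"
  assumes g: "g \<in> borel_measurable borel" and eq: "AE z in lborel. f z = g z"
  shows "integral\<^sup>L lebesgue f = integral\<^sup>L lborel g"
proof -
  have "integral\<^sup>L lebesgue f = integral\<^sup>L lebesgue g"
  proof (rule integral_cong_AE)
    show gl: "g \<in> borel_measurable lebesgue" using g by (simp add: measurable_completion)
    show "f \<in> borel_measurable lebesgue" by (rule lebesgue_measurable_if_AE_eq[OF gl eq])
  qed (use eq in \<open>simp add: AE_completion_iff\<close>)
  then show ?thesis using g by (simp add: integral_completion)
qed

lemma borel_representative:
  fixes f :: "'a::euclidean_space \<Rightarrow> 'b::euclidean_space"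
  assumes f: "f \<in> borel_measurable (lebesgue_on S)" and Q: "open Q" "Q \<subseteq> S" and S: "S \<in> sets lebesgue"
  shows "\<exists>g \<in> borel_measurable borel. AE z in lborel. g z = (if z \<in> Q then f z else 0)"
proof -
  have "f \<in> borel_measurable (lebesgue_on Q)"
    using measurable_restrict_mono[OF f Q(2)] .
  then have m: "(\<lambda>z. if z \<in> Q then f z else 0) \<in> borel_measurable lebesgue"
    by (rule borel_measurable_if_I) (use Q in simp)
  have "\<exists>g\<in>borel_measurable lborel. AE z in lborel. (if z \<in> Q then f z else 0) \<bullet> b = g z" for b
    by (rule completion_ex_borel_measurable_real) (use m in measurable)
  then obtain g where g: "\<And>b. g b \<in> borel_measurable lborel"
    "\<And>b. AE z in lborel. (if z \<in> Q then f z else 0) \<bullet> b = g b z" by metis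
  have "AE z in lborel. \<forall>b\<in>Basis. (if z \<in> Q then f z else 0) \<bullet> b = g b z"
    using g(2) by (intro AE_finite_allI) auto
  then have "AE z in lborel. (\<Sum>b\<in>Basis. g b z *\<^sub>R b) = (if z \<in> Q then f z else 0)"
  proof eventually_elim
    case (elim z)
    have "(\<Sum>b\<in>Basis. g b z *\<^sub>R b) = (\<Sum>b\<in>Basis. ((if z \<in> Q then f z else 0) \<bullet> b) *\<^sub>R b)"
      by (rule sum.cong) (use elim in auto)
    then show ?case by (simp only: euclidean_representation)
  qed
  moreover have "(\<lambda>z. \<Sum>b\<in>Basis. g b z *\<^sub>R b) \<in> borel_measurable borel"
    using g(1) by (intro borel_measurable_sum borel_measurable_scaleR) auto
  ultimately show ?thesis by (intro bexI[of _ "\<lambda>z. \<Sum>b\<in>Basis. g b z *\<^sub>R b"])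
qed

text \<open>
  The exceptional set is first enlarged to a Borel null set; only for this set do the iterated
  statements in the two orders follow from each other.
\<close>

lemma AE_lborel_swap:
  fixes P :: "'a::euclidean_space \<times> 'b::euclidean_space \<Rightarrow> bool"
  assumes "AE z in lborel. P z"
  shows "AE x in lborel. AE t in lborel. P (x, t)" "AE t in lborel. AE x in lborel. P (x, t)"
proof -
  have ae: "AE z in lborel \<Otimes>\<^sub>M lborel. P z" using assms unfolding lborel_prod .
  show "AE x in lborel. AE t in lborel. P (x, t)"
    using lborel_pair.AE_pair[OF ae] .
  obtain N where N: "{z\<in>space (lborel \<Otimes>\<^sub>M lborel). \<not> P z} \<subseteq> N"
      "emeasure (lborel \<Otimes>\<^sub>M lborel) N = 0" "N \<in> sets (lborel \<Otimes>\<^sub>M lborel)"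
    by (rule AE_E[OF ae]) (rule that)
  have "AE z in lborel \<Otimes>\<^sub>M lborel. z \<notin> N"
    using N(2,3) by (intro AE_not_in null_setsI)
  from lborel_pair.AE_pair[OF this] have "AE x in lborel. AE t in lborel. (x, t) \<notin> N" .
  have "AE t in lborel. AE x in lborel. (x, t) \<notin> N"
  proof -
    have "{z \<in> space (lborel \<Otimes>\<^sub>M lborel). (fst z, snd z) \<notin> N} \<in> sets (lborel \<Otimes>\<^sub>M lborel)"
      using sets.compl_sets[OF N(3)] by (simp only: set_diff_eq prod.collapse)
    from lborel_pair.AE_commute[of "\<lambda>x t. (x, t) \<notin> N", OF this]
    show ?thesis using \<open>AE x in lborel. AE t in lborel. (x, t) \<notin> N\<close> by (rule iffD1)
  qed
  then show "AE t in lborel. AE x in lborel. P (x, t)"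
  proof eventually_elim
    case (elim t)
    then show ?case by eventually_elim (use N(1) in \<open>auto simp: space_pair_measure\<close>)
  qed
qed

lemma integral_lborel_Fubini:
  fixes f :: "'a::euclidean_space \<times> 'b::euclidean_space \<Rightarrow> real"
  assumes "integrable lborel f"
  shows "(LBINT z. f z) = (LBINT t. (LBINT x. f (x, t)))"
  using lborel_pair.integral_snd[of "\<lambda>x t. f (x, t)"] assms by (simp add: lborel_prod)

lemma AE_integrable_slice:
  fixes f :: "'a::euclidean_space \<times> 'b::euclidean_space \<Rightarrow> real"
  assumes "integrable lborel f"
  shows "AE x in lborel. integrable lborel (\<lambda>t. f (x, t))"
  using lborel_pair.AE_integrable_fst'[of f] assms by (simp add: lborel_prod)

lemma AE_integrable_slice_snd:
  fixes f :: "'a::euclidean_space \<times> 'b::euclidean_space \<Rightarrow> real"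
  assumes "integrable lborel f"
  shows "AE t in lborel. integrable lborel (\<lambda>x. f (x, t))"
  using lborel_pair.AE_integrable_snd[of "\<lambda>x t. f (x, t)"] assms by (simp add: lborel_prod)

text \<open>
  Superlevel sets are unions of the open cylinders whose average exceeds the level.
\<close>

lemma borel_measurable_strong_maximal[measurable]:
  "strong_maximal f \<in> borel_measurable borel"
proof (rule borel_measurableI_greater)
  fix y
  have "{z. y < strong_maximal f z} =
    \<Union>{S. S \<in> {ball c r \<times> {a<..<b} | c r a b. True} \<and> y < nn_mean S (\<lambda>\<zeta>. ennreal \<bar>f \<zeta>\<bar>)}" (is "?l = ?r")
  proof (rule set_eqI)
    fix z
    have "z \<in> ?l \<longleftrightarrow> (\<exists>S \<in> {ball y r \<times> {a<..<b} | y r a b. z \<in> ball y r \<times> {a<..<b}}. y < nn_mean S (\<lambda>\<zeta>. ennreal \<bar>f \<zeta>\<bar>))"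
      by (simp only: strong_maximal_def less_SUP_iff mem_Collect_eq)
    also have "\<dots> \<longleftrightarrow> z \<in> ?r" by blast
    finally show "z \<in> ?l \<longleftrightarrow> z \<in> ?r" .
  qed
  moreover have "open ?r" by (intro open_Union) (auto intro: open_Times)
  ultimately show "{z \<in> space borel. y < strong_maximal f z} \<in> sets borel" by simp
qed

text \<open>
  For X with finitely many values the composition is a finite sum of measurable pieces. In
  general X is approximated componentwise by simple functions, and continuity in the second
  argument, which holds for almost every z, carries the measurability to the limit.
\<close>

lemma caratheodory_measurable:
  fixes A :: "(real^'n) \<times> real \<Rightarrow> (nat \<Rightarrow> real^'n) \<Rightarrow> nat \<Rightarrow> real^'n"
  assumes A: "caratheodory_field N S A" and S: "S \<in> sets lebesgue"
    and X: "tmeasurable_on N S X" "X \<in> S \<rightarrow> tuples N"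
  shows "tmeasurable_on N S (\<lambda>z. A z (X z))"
  unfolding tmeasurable_on_def
proof (intro allI impI)
  fix i assume i: "i < N"
  let ?M = "lebesgue_on S"
  have Xm: "(\<lambda>z. X z j) \<in> borel_measurable ?M" if "j < N" for j
    using X(1) that by (simp add: tmeasurable_on_def)
  have "\<exists>s. (\<forall>k. simple_function ?M (s k)) \<and> (\<forall>z\<in>space ?M. (\<lambda>k. s k z) \<longlonglongrightarrow> X z j)" if "j < N" for j
    using borel_measurable_implies_sequence_metric[OF Xm[OF that], of 0] by blast
  then obtain s where s: "\<And>j k. j < N \<Longrightarrow> simple_function ?M (s j k)"
    "\<And>j z. j < N \<Longrightarrow> z \<in> S \<Longrightarrow> (\<lambda>k. s j k z) \<longlonglongrightarrow> X z j"
    by (simp add: space_restrict_space) metis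
  \<comment> \<open>extended by 0 beyond N, so that its finitely many values are admissible arguments of the field\<close>
  define Y where "Y = (\<lambda>k z j. if j < N then s j k z else 0)"
  have Yt: "Y k z \<in> tuples N" for k z by (simp add: Y_def tuples_def)
  have fin: "finite (Y k ` S)" for k
  proof -
    have "Y k ` S \<subseteq> {f. \<forall>j. (j \<in> {..<N} \<longrightarrow> f j \<in> (\<Union>j\<in>{..<N}. s j k ` S)) \<and> (j \<notin> {..<N} \<longrightarrow> f j = 0)}"
    proof (clarsimp simp: Y_def)
      fix x t j assume "(x, t) \<in> S" "j < N"
      then show "\<exists>i\<in>{..<N}. s j k (x, t) \<in> s i k ` S"
        by (intro bexI[of _ j] imageI) auto
    qed
    moreover have "finite {f. \<forall>j. (j \<in> {..<N} \<longrightarrow> f j \<in> (\<Union>j\<in>{..<N}. s j k ` S)) \<and> (j \<notin> {..<N} \<longrightarrow> f j = 0)}"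
      using s(1) by (intro finite_set_of_finite_funs) (auto simp: simple_function_def space_restrict_space)
    ultimately show ?thesis by (rule finite_subset)
  qed
  have Ym: "{z \<in> space ?M. Y k z = \<xi>} \<in> sets ?M" for k \<xi>
  proof -
    have "{z \<in> space ?M. Y k z = \<xi>} = {z \<in> space ?M. (\<forall>j\<in>{..<N}. s j k z = \<xi> j) \<and> (\<forall>j\<ge>N. \<xi> j = 0)}"
      by (auto simp: Y_def fun_eq_iff not_less)
    also have "\<dots> \<in> sets ?M"
    proof (intro sets.sets_Collect_conj sets.sets_Collect_const sets.sets_Collect_finite_All finite_lessThan)
      fix j assume "j \<in> {..<N}"
      then have "s j k -` {\<xi> j} \<inter> space ?M \<in> sets ?M" using s(1) by (intro simple_functionD(2)) auto
      also have "s j k -` {\<xi> j} \<inter> space ?M = {z \<in> space ?M. s j k z = \<xi> j}" by blast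
      finally show "{z \<in> space ?M. s j k z = \<xi> j} \<in> sets ?M" .
    qed
    finally show ?thesis .
  qed
  have Am: "(\<lambda>z. A z (Y k z) i) \<in> borel_measurable ?M" for k
  proof -
    have "(\<lambda>z. \<Sum>\<xi>\<in>Y k ` S. if Y k z = \<xi> then A z \<xi> i else 0) \<in> borel_measurable ?M"
    proof (intro borel_measurable_sum measurable_If borel_measurable_const Ym)
      fix \<xi> assume "\<xi> \<in> Y k ` S"
      then have "\<xi> \<in> tuples N" using Yt by auto
      then show "(\<lambda>z. A z \<xi> i) \<in> borel_measurable ?M"
        using A i by (simp add: caratheodory_field_def tmeasurable_on_def)
    qed
    also have "(\<lambda>z. \<Sum>\<xi>\<in>Y k ` S. if Y k z = \<xi> then A z \<xi> i else 0) \<in> borel_measurable ?M \<longleftrightarrow> ?thesis"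
      by (rule measurable_cong) (use fin in \<open>simp add: space_restrict_space\<close>)
    finally show ?thesis .
  qed
  define B where "B = {z \<in> S. \<not> continuous_on (tuples N) (A z)}"
  have Bae: "AE z in lebesgue. z \<notin> B"
  proof -
    have "AE z in ?M. continuous_on (tuples N) (A z)"
      using A by (simp add: caratheodory_field_def)
    then have "AE z in lebesgue. z \<in> S \<longrightarrow> continuous_on (tuples N) (A z)"
      using S by (subst (asm) AE_restrict_space_iff) auto
    then show ?thesis by eventually_elim (auto simp: B_def)
  qed
  have "B \<in> null_sets lebesgue"
    unfolding completion.null_sets_iff_AE using Bae by simp
  then have B: "B \<in> sets lebesgue" "AE z in lborel. z \<notin> B"
    using Bae by (auto simp: AE_completion_iff)
  have BM: "{z \<in> space ?M. z \<in> B} \<in> sets ?M"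
    using B(1) by (auto simp: sets_restrict_space space_restrict_space B_def intro!: image_eqI[of _ _ B])
  have "(\<lambda>z. if z \<in> B then 0 else A z (X z) i) \<in> borel_measurable ?M"
  proof (rule borel_measurable_LIMSEQ_metric)
    show "(\<lambda>z. if z \<in> B then 0 else A z (Y k z) i) \<in> borel_measurable ?M" for k
      by (intro measurable_If borel_measurable_const Am BM)
    fix z assume "z \<in> space ?M"
    then have z: "z \<in> S" by (simp add: space_restrict_space)
    show "(\<lambda>k. if z \<in> B then 0 else A z (Y k z) i) \<longlonglongrightarrow> (if z \<in> B then 0 else A z (X z) i)"
    proof (cases "z \<in> B")
      case False
      then have c: "continuous_on (tuples N) (A z)" using z by (simp add: B_def)
      have Xt: "X z \<in> tuples N" using X(2) z by auto
      have "(\<lambda>k. Y k z) \<longlonglongrightarrow> X z"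
      proof -
        have "(\<lambda>k. Y k z j) \<longlonglongrightarrow> X z j" for j
          using s(2)[of j z] z Xt by (cases "j < N") (auto simp: Y_def tuples_def)
        then show ?thesis
          using limitin_componentwise[of "\<lambda>_. euclidean" UNIV "\<lambda>k. Y k z" "X z" sequentially]
          by (simp add: euclidean_product_topology)
      qed
      then have lim: "(\<lambda>k. A z (Y k z)) \<longlonglongrightarrow> A z (X z)"
        by (rule continuous_on_tendsto_compose[OF c _ Xt]) (simp add: Yt)
      have "(\<lambda>k. A z (Y k z) i) \<longlonglongrightarrow> A z (X z) i"
        using limitin_componentwise[of "\<lambda>_. euclidean" UNIV "\<lambda>k. A z (Y k z)" "A z (X z)" sequentially] lim
        by (simp add: euclidean_product_topology)
      then show ?thesis using False by simp
    qed simp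
  qed
  then have "(\<lambda>z. if z \<in> S then (if z \<in> B then 0 else A z (X z) i) else 0) \<in> borel_measurable lebesgue"
    using S by (intro borel_measurable_if_I) auto
  then have "(\<lambda>z. if z \<in> S then A z (X z) i else 0) \<in> borel_measurable lebesgue"
    by (rule lebesgue_measurable_if_AE_eq) (use B(2) in \<open>eventually_elim, auto\<close>)
  then show "(\<lambda>z. A z (X z) i) \<in> borel_measurable ?M"
    by (rule borel_measurable_if_D)
qed

section \<open>Test functions as bounded Borel multipliers\<close>

definition bounded_borel :: "('a::topological_space \<Rightarrow> real) \<Rightarrow> bool" where
  "bounded_borel f \<longleftrightarrow> f \<in> borel_measurable borel \<and> (\<exists>B. \<forall>x. \<bar>f x\<bar> \<le> B)"

lemma bounded_borel_measurable[measurable_dest]: "bounded_borel f \<Longrightarrow> f \<in> borel_measurable borel"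
  by (simp add: bounded_borel_def)

lemma bounded_borel_mult:
  assumes "bounded_borel f" "bounded_borel g"
  shows "bounded_borel (\<lambda>z. f z * g z)"
proof -
  obtain B C where B: "\<And>x. \<bar>f x\<bar> \<le> B" "\<And>x. \<bar>g x\<bar> \<le> C"
    using assms by (auto simp: bounded_borel_def)
  have "\<bar>f x * g x\<bar> \<le> B * C" for x
    unfolding abs_mult using B[of x] by (intro mult_mono) auto
  then show ?thesis using assms by (auto simp: bounded_borel_def)
qed

lemma bounded_borel_fst_snd:
  fixes p :: "'a::euclidean_space \<Rightarrow> real" and q :: "'b::euclidean_space \<Rightarrow> real"
  assumes "bounded_borel p" "bounded_borel q"
  shows "bounded_borel (\<lambda>z. p (fst z) * q (snd z))"
proof -
  have "bounded_borel (\<lambda>z::'a \<times> 'b. p (fst z))" "bounded_borel (\<lambda>z::'a \<times> 'b. q (snd z))"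
    using assms measurable_compose[OF borel_measurable_fst_snd(1)] measurable_compose[OF borel_measurable_fst_snd(2)]
    by (auto simp: bounded_borel_def)
  then show ?thesis by (rule bounded_borel_mult)
qed

lemma integrable_bounded_borel:
  fixes f h :: "'a::euclidean_space \<Rightarrow> real"
  assumes "integrable lborel f" "bounded_borel h"
  shows "integrable lborel (\<lambda>z. f z * h z)"
  using assms integrable_mult_bounded[OF assms(1)] by (auto simp: bounded_borel_def)

lemma test_function_differentiable: "test_function U p \<Longrightarrow> p differentiable (at x)"
  using times_differentiable.simps(2)[of 0 p] by (simp add: test_function_def)

lemma test_function_zero: "test_function U p \<Longrightarrow> x \<notin> U \<Longrightarrow> p x = 0"
  using closure_subset[of "{x. p x \<noteq> 0}"] by (auto simp: test_function_def)

lemma test_function_derivative: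
  assumes p: "test_function U p"
  shows "test_function U (\<lambda>x. frechet_derivative p (at x) v)"
proof (rule test_functionI)
  let ?C = "closure {x. p x \<noteq> 0}"
  show "compact ?C" "?C \<subseteq> U" using p by (auto simp: test_function_def)
  show "times_differentiable k (\<lambda>x. frechet_derivative p (at x) v)" for k
    using p times_differentiable.simps(2)[of k p] by (simp add: test_function_def)
  fix x assume x: "x \<notin> ?C"
  have "((\<lambda>x. 0) has_derivative (\<lambda>v. 0)) (at x)" by simp
  then have "(p has_derivative (\<lambda>v. 0)) (at x)"
    by (rule has_derivative_transform_within_open[where s = "- ?C"])
       (use x closure_subset[of "{x. p x \<noteq> 0}"] in auto)
  then show "frechet_derivative p (at x) v = 0"
    using frechet_derivative_at by metis
qed

lemma test_function_bounded_borel: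
  assumes p: "test_function U p"
  shows "bounded_borel p"
proof -
  let ?C = "closure {x. p x \<noteq> 0}"
  have c: "continuous_on UNIV p" using p by (auto simp: test_function_def intro: times_differentiable_imp_continuous)
  have "compact (p ` ?C)"
    using p by (intro compact_continuous_image continuous_on_subset[OF c]) (auto simp: test_function_def)
  then obtain B where B: "\<And>x. x \<in> ?C \<Longrightarrow> \<bar>p x\<bar> \<le> B"
    using compact_imp_bounded bounded_iff by (metis imageI real_norm_def)
  have "\<bar>p x\<bar> \<le> max B 0" for x
    using B[of x] closure_subset[of "{x. p x \<noteq> 0}"] by (cases "p x = 0") (auto simp: max_def intro: order_trans)
  then show ?thesis
    using borel_measurable_continuous_onI[OF c] by (auto simp: bounded_borel_def)
qed

lemma grad_nth: "grad p x $ j = frechet_derivative p (at x) (axis j 1)"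
  by (simp add: grad_def)

lemma test_function_grad: "test_function U p \<Longrightarrow> test_function U (\<lambda>x. grad p x $ j)"
  unfolding grad_nth by (rule test_function_derivative)

lemma test_function_deriv:
  assumes "test_function U q"
  shows "test_function U (deriv q)" "(q has_real_derivative deriv q s) (at s)"
proof -
  have D: "(q has_real_derivative frechet_derivative q (at s) 1) (at s)" for s
  proof -
    have d: "(q has_derivative frechet_derivative q (at s)) (at s)"
      using test_function_differentiable[OF assms] frechet_derivative_works by blast
    have "frechet_derivative q (at s) v = frechet_derivative q (at s) 1 * v" for v
      using linear_cmul[OF has_derivative_linear[OF d], of v 1] by simp
    then have "frechet_derivative q (at s) = (\<lambda>v. frechet_derivative q (at s) 1 * v)" by (rule ext)
    with d show ?thesis by (simp only: has_field_derivative_def)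
  qed
  have "deriv q = (\<lambda>s. frechet_derivative q (at s) 1)"
    by (rule ext, rule DERIV_imp_deriv, rule D)
  then show "test_function U (deriv q)" "(q has_real_derivative deriv q s) (at s)"
    using test_function_derivative[OF assms, of 1] D by simp_all
qed

lemma integrable_vecI:
  fixes f :: "'a \<Rightarrow> real^'n"
  assumes "\<And>j. integrable M (\<lambda>z. f z $ j)"
  shows "integrable M f"
proof -
  have "integrable M (\<lambda>z. \<Sum>j\<in>UNIV. (f z $ j) *\<^sub>R axis j 1)"
    using assms by (intro Bochner_Integration.integrable_sum integrable_scaleR_left)
  also have "(\<lambda>z. \<Sum>j\<in>UNIV. (f z $ j) *\<^sub>R axis j 1) = f"
    by (simp add: fun_eq_iff vec_eq_iff axis_def if_distrib cong: if_cong)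
  finally show ?thesis .
qed

lemma integral_nth:
  fixes f :: "'a \<Rightarrow> real^'n"
  assumes "integrable M f"
  shows "(\<integral>z. f z \<partial>M) $ j = (\<integral>z. f z $ j \<partial>M)"
  using integral_bounded_linear[OF bounded_linear_vec_nth assms] by simp

lemma borel_measurable_tnorm:
  assumes "tmeasurable_on N S f"
  shows "(\<lambda>z. tnorm N (f z)) \<in> borel_measurable (lebesgue_on S)"
proof -
  have [measurable]: "(\<lambda>z. \<Sum>i<N. (norm (f z i))\<^sup>2) \<in> borel_measurable (lebesgue_on S)"
  proof (rule borel_measurable_sum)
    fix i assume "i \<in> {..<N}"
    then have [measurable]: "(\<lambda>z. f z i) \<in> borel_measurable (lebesgue_on S)"
      using assms by (simp add: tmeasurable_on_def)
    show "(\<lambda>z. (norm (f z i))\<^sup>2) \<in> borel_measurable (lebesgue_on S)" by measurable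
  qed
  show ?thesis unfolding tnorm_def L2_set_def by measurable
qed

lemma integrable_tnorm_indicator:
  fixes f :: "'a::euclidean_space \<Rightarrow> nat \<Rightarrow> 'b::euclidean_space"
  assumes f: "tmeasurable_on N S f" and Q: "open Q" "Q \<subseteq> S" "emeasure lborel Q < \<infinity>" and q: "1 < q"
    and fin: "(\<integral>\<^sup>+z\<in>Q. ennreal (tnorm N (f z) powr q) \<partial>lebesgue) < \<infinity>"
  shows "integrable lebesgue (\<lambda>z. tnorm N (f z) * indicator Q z)"
proof -
  have "(\<lambda>z. tnorm N (f z)) \<in> borel_measurable (lebesgue_on Q)"
    using measurable_restrict_mono[OF borel_measurable_tnorm[OF f] Q(2)] .
  then have "(\<lambda>z. if z \<in> Q then tnorm N (f z) else 0) \<in> borel_measurable lebesgue"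
    by (rule borel_measurable_if_I) (use Q in simp)
  also have "(\<lambda>z. if z \<in> Q then tnorm N (f z) else 0) = (\<lambda>z. tnorm N (f z) * indicator Q z)"
    by (auto simp: fun_eq_iff)
  finally have m[measurable]: "(\<lambda>z. tnorm N (f z) * indicator Q z) \<in> borel_measurable lebesgue" .
  have [measurable]: "Q \<in> sets lebesgue" using Q by simp
  have "(\<integral>\<^sup>+z. ennreal (tnorm N (f z) * indicator Q z) \<partial>lebesgue)
      \<le> (\<integral>\<^sup>+z. indicator Q z + ennreal ((tnorm N (f z) * indicator Q z) powr q) \<partial>lebesgue)"
    using young_powr[OF tnorm_nonneg, of 1 q N] q
    by (intro nn_integral_mono)
       (auto simp: indicator_def ennreal_plus[symmetric] ennreal_1[symmetric] simp del: ennreal_plus ennreal_1)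
  also have "\<dots> = emeasure lborel Q + (\<integral>\<^sup>+z. ennreal ((tnorm N (f z) * indicator Q z) powr q) \<partial>lebesgue)"
    using Q by (subst nn_integral_add) auto
  also have "(\<integral>\<^sup>+z. ennreal ((tnorm N (f z) * indicator Q z) powr q) \<partial>lebesgue) = (\<integral>\<^sup>+z\<in>Q. ennreal (tnorm N (f z) powr q) \<partial>lebesgue)"
    by (intro nn_integral_cong) (auto simp: indicator_def)
  also have "emeasure lborel Q + (\<integral>\<^sup>+z\<in>Q. ennreal (tnorm N (f z) powr q) \<partial>lebesgue) < \<infinity>"
    using Q fin by simp
  finally show ?thesis
    using m by (intro integrableI_nonneg) (auto simp: tnorm_nonneg)
qed

lemma integrable_representative:
  fixes f :: "'a::euclidean_space \<Rightarrow> 'b::euclidean_space"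
  assumes f: "f \<in> borel_measurable (lebesgue_on S)" and Q: "open Q" "Q \<subseteq> S" and S: "S \<in> sets lebesgue"
    and h: "integrable lebesgue h" and le: "AE z in lebesgue. z \<in> Q \<longrightarrow> norm (f z) \<le> h z" and h0: "\<And>z. 0 \<le> h z"
  shows "\<exists>g. integrable lborel g \<and> (AE z in lborel. g z = (if z \<in> Q then f z else 0))"
proof -
  obtain g where g: "g \<in> borel_measurable borel" "AE z in lborel. g z = (if z \<in> Q then f z else 0)"
    using borel_representative[OF f Q S] by auto
  have "integrable lebesgue g"
  proof (rule Bochner_Integration.integrable_bound[OF h])
    show "g \<in> borel_measurable lebesgue" using g(1) by (simp add: measurable_completion)
    have "AE z in lebesgue. g z = (if z \<in> Q then f z else 0)" using g(2) by (simp add: AE_completion_iff)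
    with le show "AE z in lebesgue. norm (g z) \<le> norm (h z)"
      by eventually_elim (use h0 in auto)
  qed
  then have "integrable lborel g" using g(1) by (subst (asm) integrable_completion) auto
  with g show ?thesis by auto
qed

lemma integrable_test_product:
  fixes f :: "'a::euclidean_space \<times> 'b::euclidean_space \<Rightarrow> real"
  assumes "integrable lborel f" "test_function U p" "test_function V r"
  shows "integrable lborel (\<lambda>z. f z * (p (fst z) * r (snd z)))"
  by (intro integrable_bounded_borel assms bounded_borel_fst_snd test_function_bounded_borel[OF assms(2)]
      test_function_bounded_borel[OF assms(3)])

section \<open>The parabolic system in terms of Borel functions\<close>

locale parabolic_system =
  fixes N :: nat and q \<nu> L :: real and \<Omega> :: "(real^'n) set" and T :: real
    and A :: "(real^'n) \<times> real \<Rightarrow> (nat \<Rightarrow> real^'n) \<Rightarrow> nat \<Rightarrow> real^'n"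
    and F :: "(real^'n) \<times> real \<Rightarrow> nat \<Rightarrow> real^'n"
    and u :: "(real^'n) \<times> real \<Rightarrow> nat \<Rightarrow> real" and Du :: "(real^'n) \<times> real \<Rightarrow> nat \<Rightarrow> real^'n"
    and x0 :: "real^'n" and t0 \<rho> :: real
  assumes q: "1 < q" and L: "0 < L" and \<Omega>: "open \<Omega>"
    and A: "caratheodory_field N (\<Omega> \<times> {0<..<T}) A" "structure_conditions N \<nu> L (\<Omega> \<times> {0<..<T}) A"
    and F: "tmeasurable_on N (\<Omega> \<times> {0<..<T}) F" "in_Lq_loc N q (\<Omega> \<times> {0<..<T}) F"
    and u: "Lq_loc_W1q_loc_with_gradient N q \<Omega> T u Du"
    and sol: "weak_solution N (\<Omega> \<times> {0<..<T}) A F u Du"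
    and \<rho>: "\<rho> > 0" and cc: "compactly_contained (cylinder x0 t0 (2 * \<rho>)) (\<Omega> \<times> {0<..<T})"
begin

abbreviation "S \<equiv> \<Omega> \<times> {0<..<T}"
abbreviation "B2 \<equiv> ball x0 (2 * \<rho>)"
abbreviation "J \<equiv> time_interval t0 (2 * \<rho>)"
abbreviation "Q2 \<equiv> cylinder x0 t0 (2 * \<rho>)"

definition g :: "(real^'n) \<times> real \<Rightarrow> real" where
  "g z = (tnorm N (Du z) + tnorm N (F z)) * indicator Q2 z"

lemma Q2_eq: "Q2 = B2 \<times> J" by (simp add: cylinder_def)

lemma domain_open: "open S" "S \<in> sets lebesgue"
proof -
  show "open S" using \<Omega> by (intro open_Times) auto
  then show "S \<in> sets lebesgue" by simp
qed

lemma Q2_geometry: "open Q2" "Q2 \<subseteq> S" "emeasure lborel Q2 < \<infinity>" "compact (closure Q2)" "closure Q2 \<subseteq> S"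
  using cc closure_subset[of Q2] emeasure_bounded_finite[of Q2]
    bounded_subset[OF compact_imp_bounded[of "closure Q2"] closure_subset]
  by (auto simp: compactly_contained_def Q2_eq time_interval_def intro!: open_Times)

lemma B2_J_geometry: "compactly_contained B2 \<Omega>" "0 < t0 - (2 * \<rho>)\<^sup>2" "t0 + (2 * \<rho>)\<^sup>2 < T"
proof -
  have "closure Q2 = cball x0 (2 * \<rho>) \<times> {t0 - (2 * \<rho>)\<^sup>2 .. t0 + (2 * \<rho>)\<^sup>2}"
    using \<rho> by (simp add: Q2_eq closure_Times time_interval_def)
  then have sub: "cball x0 (2 * \<rho>) \<times> {t0 - (2 * \<rho>)\<^sup>2 .. t0 + (2 * \<rho>)\<^sup>2} \<subseteq> S"
    using Q2_geometry(5) by simp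
  have p: "(y, t) \<in> S" if "y \<in> cball x0 (2 * \<rho>)" "t0 - (2 * \<rho>)\<^sup>2 \<le> t" "t \<le> t0 + (2 * \<rho>)\<^sup>2" for y t
    using that by (intro subsetD[OF sub] SigmaI) auto
  show "0 < t0 - (2 * \<rho>)\<^sup>2" using p[of x0 "t0 - (2 * \<rho>)\<^sup>2"] \<rho> by simp
  show "t0 + (2 * \<rho>)\<^sup>2 < T" using p[of x0 "t0 + (2 * \<rho>)\<^sup>2"] \<rho> by simp
  have "cball x0 (2 * \<rho>) \<subseteq> \<Omega>" using p[of _ t0] by auto
  then show "compactly_contained B2 \<Omega>"
    using \<rho> by (simp add: compactly_contained_def)
qed

lemma solution_regularity:
  shows "tmeasurable_on N S u" "tmeasurable_on N S Du" "Du \<in> S \<rightarrow> tuples N"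
    "AE t in lebesgue_on J. W1q_with_gradient N q B2 (\<lambda>x. u (x, t)) (\<lambda>x. Du (x, t))"
    "(\<integral>\<^sup>+z\<in>Q2. ennreal (tnorm N (u z) powr q + tnorm N (Du z) powr q) \<partial>lebesgue) < \<infinity>"
proof -
  have lt: "t0 - (2 * \<rho>)\<^sup>2 < t0 + (2 * \<rho>)\<^sup>2" using \<rho> by simp
  have "\<forall>\<Omega>' t1 t2. open \<Omega>' \<and> compactly_contained \<Omega>' \<Omega> \<and> 0 < t1 \<and> t1 < t2 \<and> t2 < T \<longrightarrow>
        (AE t in lebesgue_on {t1<..<t2}.
           W1q_with_gradient N q \<Omega>' (\<lambda>x. u (x, t)) (\<lambda>x. Du (x, t))) \<and>
        (\<integral>\<^sup>+z\<in>\<Omega>' \<times> {t1<..<t2}.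
           ennreal (tnorm N (u z) powr q + tnorm N (Du z) powr q) \<partial>lebesgue) < \<infinity>"
    using u unfolding Lq_loc_W1q_loc_with_gradient_def by (elim conjE) assumption
  from mp[OF spec[OF spec[OF spec[OF this]]], OF conjI[OF open_ball conjI[OF B2_J_geometry(1) conjI[OF B2_J_geometry(2) conjI[OF lt B2_J_geometry(3)]]]]]
  show "AE t in lebesgue_on J. W1q_with_gradient N q B2 (\<lambda>x. u (x, t)) (\<lambda>x. Du (x, t))"
    "(\<integral>\<^sup>+z\<in>Q2. ennreal (tnorm N (u z) powr q + tnorm N (Du z) powr q) \<partial>lebesgue) < \<infinity>"
    unfolding Q2_eq time_interval_def by (rule conjunct1, rule conjunct2)
qed (use u in \<open>simp_all add: Lq_loc_W1q_loc_with_gradient_def\<close>)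

lemma integrable_norms:
  "integrable lebesgue (\<lambda>z. tnorm N (u z) * indicator Q2 z)"
  "integrable lebesgue (\<lambda>z. tnorm N (Du z) * indicator Q2 z)"
  "integrable lebesgue (\<lambda>z. tnorm N (F z) * indicator Q2 z)"
proof -
  have 1: "(\<integral>\<^sup>+z\<in>Q2. ennreal (tnorm N (u z) powr q) \<partial>lebesgue) < \<infinity>"
    by (rule le_less_trans[OF _ solution_regularity(5)], rule nn_integral_mono) (auto simp: indicator_def)
  have 2: "(\<integral>\<^sup>+z\<in>Q2. ennreal (tnorm N (Du z) powr q) \<partial>lebesgue) < \<infinity>"
    by (rule le_less_trans[OF _ solution_regularity(5)], rule nn_integral_mono) (auto simp: indicator_def)
  have "(\<integral>\<^sup>+z\<in>closure Q2. ennreal (tnorm N (F z) powr q) \<partial>lebesgue) < \<infinity>"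
    using F(2) Q2_geometry(4,5) by (simp add: in_Lq_loc_def in_Lq_def)
  then have 3: "(\<integral>\<^sup>+z\<in>Q2. ennreal (tnorm N (F z) powr q) \<partial>lebesgue) < \<infinity>"
    by (rule le_less_trans[rotated], intro nn_integral_mono)
       (use closure_subset[of Q2] in \<open>auto simp: indicator_def\<close>)
  show "integrable lebesgue (\<lambda>z. tnorm N (u z) * indicator Q2 z)"
    by (rule integrable_tnorm_indicator[OF solution_regularity(1) Q2_geometry(1-3) q 1])
  show "integrable lebesgue (\<lambda>z. tnorm N (Du z) * indicator Q2 z)"
    by (rule integrable_tnorm_indicator[OF solution_regularity(2) Q2_geometry(1-3) q 2])
  show "integrable lebesgue (\<lambda>z. tnorm N (F z) * indicator Q2 z)"
    by (rule integrable_tnorm_indicator[OF F(1) Q2_geometry(1-3) q 3])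
qed

lemma integrable_g: "integrable lebesgue g"
proof -
  have "g = (\<lambda>z. tnorm N (Du z) * indicator Q2 z + tnorm N (F z) * indicator Q2 z)"
    by (simp add: fun_eq_iff g_def distrib_right)
  then show ?thesis using integrable_norms(2,3) by simp
qed

lemma field_bound: "AE z in lebesgue. z \<in> Q2 \<longrightarrow> tnorm N (A z (Du z)) \<le> L * tnorm N (Du z)"
proof -
  have "AE z in lebesgue_on S. \<forall>\<xi>\<in>tuples N. tnorm N (A z \<xi>) \<le> L * tnorm N \<xi>"
    using A(2) unfolding structure_conditions_def by eventually_elim auto
  then have "AE z in lebesgue. z \<in> S \<longrightarrow> (\<forall>\<xi>\<in>tuples N. tnorm N (A z \<xi>) \<le> L * tnorm N \<xi>)"
    using domain_open by (subst (asm) AE_restrict_space_iff) auto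
  then show ?thesis
    by eventually_elim (use Q2_geometry(2) solution_regularity(3) in blast)
qed

text \<open>
  A Borel version of a function on 2Q, extended by 0. Fubini's theorem is available for the
  product of the Borel measures but not of their completions, so everything is expressed through
  these versions.
\<close>

definition representative :: "((real^'n) \<times> real \<Rightarrow> 'b::euclidean_space) \<Rightarrow> (real^'n) \<times> real \<Rightarrow> 'b" where
  "representative f = (SOME h. integrable lborel h \<and> (AE z in lborel. h z = (if z \<in> Q2 then f z else 0)))"

abbreviation "rep_u i \<equiv> representative (\<lambda>z. u z i)"
abbreviation "rep_Du i \<equiv> representative (\<lambda>z. Du z i)"
abbreviation "rep_A i \<equiv> representative (\<lambda>z. A z (Du z) i)"
abbreviation "rep_F i \<equiv> representative (\<lambda>z. F z i)"

lemma representativeI: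
  assumes "f \<in> borel_measurable (lebesgue_on S)" "integrable lebesgue h"
    "AE z in lebesgue. z \<in> Q2 \<longrightarrow> norm (f z) \<le> h z" "\<And>z. 0 \<le> h z"
  shows "integrable lborel (representative f)" "AE z in lborel. representative f z = (if z \<in> Q2 then f z else 0)"
  using someI_ex[OF integrable_representative[OF assms(1) Q2_geometry(1,2) domain_open(2) assms(2-)], folded representative_def]
  by auto

lemma reps:
  assumes i: "i < N"
  shows rep_u: "integrable lborel (rep_u i)" "AE z in lborel. rep_u i z = (if z \<in> Q2 then u z i else 0)"
    and rep_Du: "integrable lborel (rep_Du i)" "AE z in lborel. rep_Du i z = (if z \<in> Q2 then Du z i else 0)"
    and rep_A: "integrable lborel (rep_A i)" "AE z in lborel. rep_A i z = (if z \<in> Q2 then A z (Du z) i else 0)"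
    and rep_F: "integrable lborel (rep_F i)" "AE z in lborel. rep_F i z = (if z \<in> Q2 then F z i else 0)"
proof -
  note le = norm_le_tnorm[OF i]
  have b: "AE z in lebesgue. z \<in> Q2 \<longrightarrow> norm (f z i) \<le> tnorm N (f z) * indicator Q2 z"
    for f :: "(real^'n) \<times> real \<Rightarrow> nat \<Rightarrow> 'b::real_normed_vector"
    by (intro AE_I2 impI) (simp add: le)
  have m: "(\<lambda>z. u z i) \<in> borel_measurable (lebesgue_on S)" "(\<lambda>z. Du z i) \<in> borel_measurable (lebesgue_on S)"
    "(\<lambda>z. F z i) \<in> borel_measurable (lebesgue_on S)" "(\<lambda>z. A z (Du z) i) \<in> borel_measurable (lebesgue_on S)"
    using solution_regularity(1,2) F(1) caratheodory_measurable[OF A(1) domain_open(2) solution_regularity(2,3)] i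
    by (simp_all add: tmeasurable_on_def)
  show "integrable lborel (rep_u i)" "AE z in lborel. rep_u i z = (if z \<in> Q2 then u z i else 0)"
    by (rule representativeI[OF m(1) integrable_norms(1) b]; simp add: tnorm_nonneg)+
  show "integrable lborel (rep_Du i)" "AE z in lborel. rep_Du i z = (if z \<in> Q2 then Du z i else 0)"
    by (rule representativeI[OF m(2) integrable_norms(2) b]; simp add: tnorm_nonneg)+
  show "integrable lborel (rep_F i)" "AE z in lborel. rep_F i z = (if z \<in> Q2 then F z i else 0)"
    by (rule representativeI[OF m(3) integrable_norms(3) b]; simp add: tnorm_nonneg)+
  have "AE z in lebesgue. z \<in> Q2 \<longrightarrow> norm (A z (Du z) i) \<le> L * (tnorm N (Du z) * indicator Q2 z)"
    using field_bound
  proof eventually_elim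
    case (elim z)
    then show ?case using le[of "A z (Du z)"] by auto
  qed
  note r = representativeI[OF m(4) integrable_mult_right[OF integrable_norms(2)] this]
  show "integrable lborel (rep_A i)" "AE z in lborel. rep_A i z = (if z \<in> Q2 then A z (Du z) i else 0)"
    using L by (intro r; simp add: tnorm_nonneg)+
qed

lemma integrable_rep_nth:
  assumes "i < N"
  shows "integrable lborel (\<lambda>z. rep_Du i z $ j)" "integrable lborel (\<lambda>z. rep_A i z $ j)" "integrable lborel (\<lambda>z. rep_F i z $ j)"
  using reps[OF assms] by (auto intro: integrable_nth)

lemma integrable_test_inner:
  fixes X :: "(real^'n) \<times> real \<Rightarrow> real^'n"
  assumes X: "\<And>j. integrable lborel (\<lambda>z. X z $ j)" and p: "test_function B2 p" and r: "test_function J r"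
  shows "integrable lborel (\<lambda>z. r (snd z) * (grad p (fst z) \<bullet> X z))"
proof -
  have "integrable lborel (\<lambda>z. \<Sum>j\<in>UNIV. X z $ j * (grad p (fst z) $ j * r (snd z)))"
    by (intro Bochner_Integration.integrable_sum integrable_test_product[OF X test_function_grad[OF p] r])
  also have "(\<lambda>z. \<Sum>j\<in>UNIV. X z $ j * (grad p (fst z) $ j * r (snd z))) = (\<lambda>z. r (snd z) * (grad p (fst z) \<bullet> X z))"
    by (simp add: fun_eq_iff inner_vec_def sum_distrib_left mult_ac)
  finally show ?thesis .
qed

text \<open>
  The i-th equation is isolated by a test function with the single component p(y) r(s) at i. It
  is integrated over the whole space, which is harmless because the test function vanishes
  outside 2Q.
\<close>

lemma weak_eq_component:
  assumes i: "i < N" and p: "test_function B2 p" and r: "test_function J r"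
  shows "(LBINT z. rep_u i z * (p (fst z) * deriv r (snd z)))
     = (LBINT z. r (snd z) * (grad p (fst z) \<bullet> (rep_A i z - rep_F i z)))"
proof -
  \<comment> \<open>all other components vanish, so every inner product reduces to its i-th term\<close>
  define \<phi> where "\<phi> = (\<lambda>(z :: (real^'n) \<times> real) k. if k = i then p (fst z) * r (snd z) else 0)"
  have pr: "test_function S (\<lambda>z. p (fst z) * r (snd z))"
  proof (rule test_functionI)
    let ?C = "closure {x. p x \<noteq> 0} \<times> closure {s. r s \<noteq> 0}"
    have sub: "?C \<subseteq> Q2" using p r by (auto simp: test_function_def Q2_eq)
    then show "?C \<subseteq> S" using Q2_geometry(2) by blast
    show "compact ?C" using p r by (intro compact_Times) (auto simp: test_function_def)
    fix k
    have "times_differentiable k (\<lambda>z. p (fst z + 0))" "times_differentiable k (\<lambda>z. r (snd z + 0))"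
      using p r by (auto intro!: times_differentiable_comp_affine bounded_linear_fst bounded_linear_snd simp: test_function_def simp del: add_0_right)
    then show "times_differentiable k (\<lambda>z. p (fst z) * r (snd z))"
      by (intro times_differentiable_mult) simp_all
  next
    fix z :: "(real^'n) \<times> real" assume "z \<notin> closure {x. p x \<noteq> 0} \<times> closure {s. r s \<noteq> 0}"
    then show "p (fst z) * r (snd z) = 0"
      using closure_subset[of "{x. p x \<noteq> 0}"] closure_subset[of "{s. r s \<noteq> 0}"] by (cases z) auto
  qed
  have zero: "test_function S (\<lambda>z. 0)"
    by (rule test_functionI[where C = "{}"]) (auto intro: times_differentiable_const)
  have "test_tuple N S \<phi>"
    unfolding test_tuple_def
  proof (intro conjI allI impI)
    show "\<phi> z \<in> tuples N" for z using i by (auto simp: \<phi>_def tuples_def)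
    show "test_function S (\<lambda>z. \<phi> z k)" for k
      using pr zero by (cases "k = i") (auto simp: \<phi>_def)
  qed
  then have W: "(LINT z:S|lebesgue. - tinner N (u z) (time_deriv \<phi> z) + tinner N (A z (Du z)) (space_grad \<phi> z))
        = (LINT z:S|lebesgue. tinner N (F z) (space_grad \<phi> z))"
    using sol by (simp add: weak_solution_def)
  have td: "time_deriv \<phi> z k = (if k = i then p (fst z) * deriv r (snd z) else 0)" for z k
  proof (cases "k = i")
    case True
    have "((\<lambda>s. p (fst z) * r s) has_real_derivative p (fst z) * deriv r (snd z)) (at (snd z))"
      by (rule DERIV_cmult[OF test_function_deriv(2)[OF r]])
    then show ?thesis using True by (simp add: time_deriv_def \<phi>_def DERIV_imp_deriv)
  qed (simp add: time_deriv_def \<phi>_def)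
  have sg: "space_grad \<phi> z k = (if k = i then r (snd z) *\<^sub>R grad p (fst z) else 0)" for z k
  proof (cases "k = i")
    case True
    have "(p has_derivative frechet_derivative p (at (fst z))) (at (fst z))"
      using test_function_differentiable[OF p] frechet_derivative_works by blast
    then have "((\<lambda>y. p y * r (snd z)) has_derivative (\<lambda>v. frechet_derivative p (at (fst z)) v * r (snd z))) (at (fst z))"
      by (rule has_derivative_mult_left)
    from frechet_derivative_at[OF this, symmetric]
    show ?thesis using True by (simp add: space_grad_def grad_def \<phi>_def vec_eq_iff mult.commute)
  qed (simp add: space_grad_def grad_def \<phi>_def vec_eq_iff)
  have ti: "tinner N (u z) (time_deriv \<phi> z) = u z i * (p (fst z) * deriv r (snd z))" for z
    using i by (simp add: tinner_def td if_distrib sum.delta cong: if_cong)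
  have si: "tinner N X (space_grad \<phi> z) = r (snd z) * (grad p (fst z) \<bullet> X i)" for z X
    using i by (simp add: tinner_def sg if_distrib[of "\<lambda>a. _ \<bullet> a"] sum.delta inner_commute cong: if_cong)
  have out: "p (fst z) * deriv r (snd z) = 0" "r (snd z) * (grad p (fst z) \<bullet> v) = 0" if z: "z \<notin> Q2" for z v
  proof -
    consider "fst z \<notin> B2" | "snd z \<notin> J" using z by (cases z) (auto simp: Q2_eq)
    note c = this
    from c show "p (fst z) * deriv r (snd z) = 0"
      by cases (simp_all only: test_function_zero[OF p] test_function_zero[OF test_function_deriv(1)[OF r]] mult_zero_left mult_zero_right simp_thms)
    from c show "r (snd z) * (grad p (fst z) \<bullet> v) = 0"
    proof cases
      case 1
      then have "grad p (fst z) = 0"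
        using test_function_zero[OF test_function_grad[OF p]] by (simp add: vec_eq_iff del: mem_ball)
      then show ?thesis by simp
    qed (simp add: test_function_zero[OF r])
  qed
  have iu: "integrable lborel (\<lambda>z. rep_u i z * (p (fst z) * deriv r (snd z)))"
    by (rule integrable_test_product[OF rep_u(1)[OF i] p test_function_deriv(1)[OF r]])
  have iA: "integrable lborel (\<lambda>z. r (snd z) * (grad p (fst z) \<bullet> rep_A i z))"
    by (rule integrable_test_inner[OF integrable_rep_nth(2)[OF i] p r])
  have iF: "integrable lborel (\<lambda>z. r (snd z) * (grad p (fst z) \<bullet> rep_F i z))"
    by (rule integrable_test_inner[OF integrable_rep_nth(3)[OF i] p r])
  have S0: "z \<in> S" if "z \<in> Q2" for z using Q2_geometry(2) that by blast
  have "(LINT z:S|lebesgue. - tinner N (u z) (time_deriv \<phi> z) + tinner N (A z (Du z)) (space_grad \<phi> z))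
     = (LBINT z. - (rep_u i z * (p (fst z) * deriv r (snd z))) + r (snd z) * (grad p (fst z) \<bullet> rep_A i z))"
    unfolding set_lebesgue_integral_def
  proof (rule integral_lebesgue_if_AE_eq)
    show "(\<lambda>z. - (rep_u i z * (p (fst z) * deriv r (snd z))) + r (snd z) * (grad p (fst z) \<bullet> rep_A i z)) \<in> borel_measurable borel"
      using borel_measurable_integrable[OF iu] borel_measurable_integrable[OF iA] by simp
    show "AE z in lborel. indicator S z *\<^sub>R (- tinner N (u z) (time_deriv \<phi> z) + tinner N (A z (Du z)) (space_grad \<phi> z))
        = - (rep_u i z * (p (fst z) * deriv r (snd z))) + r (snd z) * (grad p (fst z) \<bullet> rep_A i z)"
      using rep_u(2)[OF i] rep_A(2)[OF i]
    proof eventually_elim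
      case (elim z)
      show ?case
      proof (cases "z \<in> Q2")
        case True
        then show ?thesis using elim S0[OF True] by (simp add: ti si)
      next
        case False
        then show ?thesis using elim by (simp add: ti si out[OF False])
      qed
    qed
  qed
  moreover have "(LINT z:S|lebesgue. tinner N (F z) (space_grad \<phi> z)) = (LBINT z. r (snd z) * (grad p (fst z) \<bullet> rep_F i z))"
    unfolding set_lebesgue_integral_def
  proof (rule integral_lebesgue_if_AE_eq)
    show "(\<lambda>z. r (snd z) * (grad p (fst z) \<bullet> rep_F i z)) \<in> borel_measurable borel"
      using borel_measurable_integrable[OF iF] by simp
    show "AE z in lborel. indicator S z *\<^sub>R tinner N (F z) (space_grad \<phi> z) = r (snd z) * (grad p (fst z) \<bullet> rep_F i z)"
      using rep_F(2)[OF i]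
    proof eventually_elim
      case (elim z)
      then show ?case
        using S0[of z] out[of z] by (cases "z \<in> Q2") (simp_all add: si)
    qed
  qed
  ultimately show ?thesis
    using W iu iA iF by (simp add: inner_diff_right right_diff_distrib)
qed

text \<open>
  The spatial gradient is known slicewise only, for almost every time. Each slice is integrated
  by parts, multiplied by r(t) and integrated in t.
\<close>

lemma weak_grad_component:
  assumes i: "i < N" and p: "test_function B2 p" and r: "test_function J r"
  shows "(LBINT z. rep_u i z * (grad p (fst z) $ j * r (snd z)))
     = - (LBINT z. p (fst z) * r (snd z) * rep_Du i z $ j)"
proof -
  have i1: "integrable lborel (\<lambda>z. rep_u i z * (grad p (fst z) $ j * r (snd z)))"
    by (rule integrable_test_product[OF rep_u(1)[OF i] test_function_grad[OF p] r])
  have i2: "integrable lborel (\<lambda>z. rep_Du i z $ j * (p (fst z) * r (snd z)))"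
    by (rule integrable_test_product[OF integrable_rep_nth(1)[OF i] p r])
  have "AE t in lebesgue. t \<in> J \<longrightarrow> W1q_with_gradient N q B2 (\<lambda>x. u (x, t)) (\<lambda>x. Du (x, t))"
    using solution_regularity(4) by (subst (asm) AE_restrict_space_iff) (auto simp: time_interval_def)
  then have ae: "AE t in lborel. t \<in> J \<longrightarrow> W1q_with_gradient N q B2 (\<lambda>x. u (x, t)) (\<lambda>x. Du (x, t))"
    by (simp only: AE_completion_iff)
  have jnt: "AE t in lborel. \<forall>k. integrable lborel (\<lambda>x. rep_Du i (x, t) $ k)"
    unfolding AE_all_countable using AE_integrable_slice_snd[OF integrable_rep_nth(1)[OF i]] by blast
  \<comment> \<open>at times outside the interval both sides vanish with r\<close>
  have slice: "AE t in lborel. (LBINT x. rep_u i (x, t) * (grad p x $ j * r t)) = - (LBINT x. rep_Du i (x, t) $ j * (p x * r t))"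
    using ae jnt AE_integrable_slice_snd[OF rep_u(1)[OF i]] AE_lborel_swap(2)[OF rep_u(2)[OF i]] AE_lborel_swap(2)[OF rep_Du(2)[OF i]]
  proof eventually_elim
    case (elim t)
    note eu = elim(4) and eD = elim(5)
    show ?case
    proof (cases "t \<in> J")
      case False
      then have "r t = 0" by (rule test_function_zero[OF r])
      then show ?thesis by simp
    next
      case True
      have [measurable]: "(\<lambda>x. grad p x) \<in> borel_measurable borel" 
      proof -
        have "(\<lambda>x. \<Sum>k\<in>UNIV. (grad p x $ k) *\<^sub>R (axis k 1 :: real^'n)) \<in> borel_measurable borel"
          using test_function_bounded_borel[OF test_function_grad[OF p]]
          by (intro borel_measurable_sum borel_measurable_scaleR) (auto simp: bounded_borel_def)
        also have "(\<lambda>x. \<Sum>k\<in>UNIV. (grad p x $ k) *\<^sub>R (axis k 1 :: real^'n)) = (\<lambda>x. grad p x)"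
          by (simp add: fun_eq_iff vec_eq_iff axis_def if_distrib cong: if_cong)
        finally show ?thesis .
      qed
      have v1: "integrable lborel (\<lambda>x. rep_u i (x, t) *\<^sub>R grad p x)"
        by (rule integrable_vecI)
           (use integrable_bounded_borel[OF elim(3) test_function_bounded_borel[OF test_function_grad[OF p]]] in simp)
      have v2: "integrable lborel (\<lambda>x. p x *\<^sub>R rep_Du i (x, t))"
        by (rule integrable_vecI)
           (use integrable_bounded_borel[OF elim(2)[rule_format] test_function_bounded_borel[OF p]] in \<open>simp add: mult.commute\<close>)
      have wg: "(LINT x:B2|lebesgue. u (x, t) i *\<^sub>R grad p x) = - (LINT x:B2|lebesgue. p x *\<^sub>R Du (x, t) i)"
        using elim(1) True i p by (simp add: W1q_with_gradient_def weak_gradient_def)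
      have "(LINT x:B2|lebesgue. u (x, t) i *\<^sub>R grad p x) = (LBINT x. rep_u i (x, t) *\<^sub>R grad p x)"
        unfolding set_lebesgue_integral_def
      proof (rule integral_lebesgue_if_AE_eq)
        show "AE x in lborel. indicator B2 x *\<^sub>R u (x, t) i *\<^sub>R grad p x = rep_u i (x, t) *\<^sub>R grad p x"
          using eu by eventually_elim (use True in \<open>auto simp: Q2_eq indicator_def\<close>)
      qed (use borel_measurable_integrable[OF v1] in simp)
      moreover have "(LINT x:B2|lebesgue. p x *\<^sub>R Du (x, t) i) = (LBINT x. p x *\<^sub>R rep_Du i (x, t))"
        unfolding set_lebesgue_integral_def
      proof (rule integral_lebesgue_if_AE_eq)
        show "AE x in lborel. indicator B2 x *\<^sub>R p x *\<^sub>R Du (x, t) i = p x *\<^sub>R rep_Du i (x, t)"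
          using eD by eventually_elim (use True in \<open>auto simp: Q2_eq indicator_def\<close>)
      qed (use borel_measurable_integrable[OF v2] in simp)
      ultimately have "(LBINT x. rep_u i (x, t) *\<^sub>R grad p x) = - (LBINT x. p x *\<^sub>R rep_Du i (x, t))"
        using wg by simp
      then have "(LBINT x. rep_u i (x, t) *\<^sub>R grad p x) $ j = - ((LBINT x. p x *\<^sub>R rep_Du i (x, t)) $ j)"
        by simp
      then have "(LBINT x. rep_u i (x, t) * grad p x $ j) = - (LBINT x. p x * rep_Du i (x, t) $ j)"
        by (simp add: integral_nth[OF v1] integral_nth[OF v2])
      then have "r t * (LBINT x. rep_u i (x, t) * grad p x $ j) = - (r t * (LBINT x. p x * rep_Du i (x, t) $ j))"
        by simp
      then show ?thesis
        by (simp only: integral_mult_right_zero[symmetric] mult_ac)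
    qed
  qed
  have "(LBINT z. rep_u i z * (grad p (fst z) $ j * r (snd z)))
      = (LBINT t. (LBINT x. rep_u i (x, t) * (grad p x $ j * r t)))"
    using integral_lborel_Fubini[OF i1] by simp
  also have "\<dots> = (LBINT t. - (LBINT x. rep_Du i (x, t) $ j * (p x * r t)))"
  proof (rule integral_cong_AE[OF _ _ slice])
    show "(\<lambda>t. LBINT x. rep_u i (x, t) * (grad p x $ j * r t)) \<in> borel_measurable lborel"
      using lborel_pair.integrable_snd[of "\<lambda>x t. rep_u i (x, t) * (grad p x $ j * r t)"] i1
      by (simp add: lborel_prod case_prod_unfold borel_measurable_integrable)
    show "(\<lambda>t. - (LBINT x. rep_Du i (x, t) $ j * (p x * r t))) \<in> borel_measurable lborel"
      using lborel_pair.integrable_snd[of "\<lambda>x t. rep_Du i (x, t) $ j * (p x * r t)"] i2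
      by (simp add: lborel_prod case_prod_unfold borel_measurable_integrable)
  qed
  also have "\<dots> = - (LBINT z. rep_Du i z $ j * (p (fst z) * r (snd z)))"
    using integral_lborel_Fubini[OF i2] by simp
  finally show ?thesis by (simp add: mult_ac)
qed

end

section \<open>Almost everywhere convergence of the mollification\<close>

definition cylinder_bump :: "(real^'n) \<times> real \<Rightarrow> real" where
  "cylinder_bump z = bump (fst z) * bump (snd z)"

text \<open>
  The kernel is not normalised; its integral, which depends on n only, enters the final
  constant.
\<close>

definition bump_mass :: "'n::finite itself \<Rightarrow> real" where
  "bump_mass _ = integral\<^sup>L lborel (cylinder_bump :: (real^'n) \<times> real \<Rightarrow> real)"

lemma cylinder_bump_bounds: "0 \<le> cylinder_bump z" "cylinder_bump z \<le> 1"
  using bump_nonneg[of "fst z"] bump_nonneg[of "snd z"] bump_le_1[of "fst z"] bump_le_1[of "snd z"]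
    mult_mono[of "bump (fst z)" 1 "bump (snd z)" 1]
  by (auto simp: cylinder_bump_def)

lemma cylinder_bump_measurable[measurable]: "cylinder_bump \<in> borel_measurable borel"
  unfolding cylinder_bump_def[abs_def] by measurable

lemma cylinder_bump_integrable: "integrable lborel cylinder_bump"
proof (rule Bochner_Integration.integrable_bound[of lborel "indicator (cball 0 2)"])
  have "emeasure lborel (cball 0 2 :: ((real^'n) \<times> real) set) < \<infinity>"
    by (rule emeasure_bounded_finite) simp
  then show "integrable lborel (indicator (cball 0 2) :: (real^'n) \<times> real \<Rightarrow> real)"
    by (intro integrable_real_indicator) auto
  show "AE z in lborel. norm (cylinder_bump z) \<le> norm (indicator (cball 0 2) z :: real)"
  proof (rule AE_I2)
    fix z :: "(real^'n) \<times> real"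
    show "norm (cylinder_bump z) \<le> norm (indicator (cball 0 2) z :: real)"
    proof (cases "norm z \<le> 2")
      case True
      then show ?thesis using cylinder_bump_bounds[of z] by simp
    next
      case False
      then have "norm (fst z) \<ge> 1 \<or> norm (snd z) \<ge> 1"
        using norm_fst_le norm_triangle_le[of "(fst z, 0)" "(0, snd z)" "norm (fst z) + norm (snd z)"] by (cases z) (auto simp: norm_Pair)
      then have "cylinder_bump z = 0" by (auto simp: cylinder_bump_def bump_zero)
      then show ?thesis by simp
    qed
  qed
qed measurable

lemma bump_mass_pos: "bump_mass TYPE('n::finite) > 0"
proof -
  let ?K = "cylinder_bump :: (real^'n) \<times> real \<Rightarrow> real"
  have "integral\<^sup>L lborel ?K \<noteq> 0"
  proof
    assume "integral\<^sup>L lborel ?K = 0"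
    then have "AE z in lborel. ?K z = 0"
      by (subst (asm) integral_nonneg_eq_0_iff_AE[OF cylinder_bump_integrable]) (simp_all add: cylinder_bump_bounds)
    then have "AE z in lborel. z \<notin> (ball 0 1 :: ((real^'n) \<times> real) set)"
    proof eventually_elim
      case (elim z)
      show ?case
      proof
        assume "z \<in> ball 0 1"
        then have "norm (fst z) < 1" "norm (snd z) < 1"
          using norm_fst_le[of "fst z" "snd z"] norm_snd_le[of "snd z" "fst z"] by (auto simp del: real_norm_def)
        then have "?K z > 0" unfolding cylinder_bump_def by (intro mult_pos_pos bump_pos)
        with elim show False by simp
      qed
    qed
    then have "(ball 0 1 :: ((real^'n) \<times> real) set) \<in> null_sets lborel"
      by (subst AE_iff_null_sets) (simp_all del: mem_ball mem_ball_0)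
    then have "emeasure lborel (ball 0 1 :: ((real^'n) \<times> real) set) = 0" by (rule null_setsD1)
    then show False
      using content_ball_pos[of 1 "0 :: (real^'n) \<times> real"] by (simp add: measure_def)
  qed
  moreover have "integral\<^sup>L lborel ?K \<ge> 0"
    by (intro integral_nonneg_AE AE_I2 cylinder_bump_bounds)
  ultimately show ?thesis by (simp add: bump_mass_def)
qed

lemma mollify_weighted_sum:
  fixes f :: "nat \<Rightarrow> (real^'n) \<times> real \<Rightarrow> real"
  assumes f: "\<And>i. i < N \<Longrightarrow> integrable lborel (f i)" and e: "e > 0"
  shows "mollify cylinder_bump e (\<lambda>z. \<Sum>i<N. w i * f i z) z = (\<Sum>i<N. w i * mollify cylinder_bump e (f i) z)"
proof -
  have "bounded_borel (\<lambda>\<zeta>. cylinder_bump ((\<zeta> - z) /\<^sub>R e) / e ^ DIM((real^'n) \<times> real))"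
    unfolding bounded_borel_def
  proof (intro conjI exI allI)
    show "\<bar>cylinder_bump ((\<zeta> - z) /\<^sub>R e) / e ^ DIM((real^'n) \<times> real)\<bar> \<le> 1 / e ^ DIM((real^'n) \<times> real)" for \<zeta>
      using cylinder_bump_bounds[of "(\<zeta> - z) /\<^sub>R e"] e by (simp add: abs_mult abs_divide divide_right_mono del: DIM_prod)
  qed measurable
  then have i: "integrable lborel (\<lambda>\<zeta>. f i \<zeta> * (cylinder_bump ((\<zeta> - z) /\<^sub>R e) / e ^ DIM((real^'n) \<times> real)))" if "i < N" for i
    by (rule integrable_bounded_borel[OF f[OF that]])
  have "mollify cylinder_bump e (\<lambda>z. \<Sum>i<N. w i * f i z) z
     = (LBINT \<zeta>. (\<Sum>i<N. w i * (f i \<zeta> * (cylinder_bump ((\<zeta> - z) /\<^sub>R e) / e ^ DIM((real^'n) \<times> real)))))"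
    unfolding mollify_def
    by (intro Bochner_Integration.integral_cong[OF refl]) (simp add: sum_distrib_right sum_divide_distrib mult.assoc del: DIM_prod)
  also have "\<dots> = (\<Sum>i<N. w i * (LBINT \<zeta>. f i \<zeta> * (cylinder_bump ((\<zeta> - z) /\<^sub>R e) / e ^ DIM((real^'n) \<times> real))))"
    by (subst Bochner_Integration.integral_sum) (intro integrable_mult_right i, simp, simp only: integral_mult_right_zero)
  finally show ?thesis by (simp only: mollify_def times_divide_eq_right)
qed

text \<open>
  One subsequence serves all components: the sum of the finitely many errors tends to 0 in L1,
  hence almost everywhere along a subsequence.
\<close>

lemma mollify_AE_subsequence:
  fixes f :: "nat \<Rightarrow> (real^'n) \<times> real \<Rightarrow> real"
  assumes f: "\<And>i. i < N \<Longrightarrow> integrable lborel (f i)"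
  shows "\<exists>e. (\<forall>k. e k > 0) \<and> e \<longlonglongrightarrow> 0 \<and>
    (AE z in lborel. \<forall>i<N. (\<lambda>k. mollify cylinder_bump (e k) (f i) z) \<longlonglongrightarrow> bump_mass TYPE('n) * f i z)"
proof -
  define e where "e = (\<lambda>k. 1 / real (Suc k))"
  have e: "e k > 0" "e \<longlonglongrightarrow> 0" for k
    using LIMSEQ_inverse_real_of_nat by (simp_all add: e_def inverse_eq_divide)
  define D where "D = (\<lambda>i k z. mollify cylinder_bump (e k) (f i) z - bump_mass TYPE('n) * f i z)"
  have D: "integrable lborel (D i k)" "(\<lambda>k. LBINT z. \<bar>D i k z\<bar>) \<longlonglongrightarrow> 0" if "i < N" for i k
    using mollify_tendsto_L1[OF f[OF that] cylinder_bump_integrable cylinder_bump_bounds e]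
    by (simp_all add: D_def bump_mass_def)
  have "(\<lambda>k. \<Sum>i<N. LBINT z. \<bar>D i k z\<bar>) \<longlonglongrightarrow> (\<Sum>i<N. 0)"
    by (intro tendsto_sum D) simp
  moreover have "(LBINT z. norm (\<Sum>i<N. \<bar>D i k z\<bar>)) = (\<Sum>i<N. LBINT z. \<bar>D i k z\<bar>)" for k
    using D(1) by (subst Bochner_Integration.integral_sum[symmetric]) (auto simp: sum_nonneg)
  ultimately have "(\<lambda>k. LBINT z. norm (\<Sum>i<N. \<bar>D i k z\<bar>)) \<longlonglongrightarrow> 0" by simp
  moreover have "integrable lborel (\<lambda>z. \<Sum>i<N. \<bar>D i k z\<bar>)" for k
    using D(1) by auto
  ultimately obtain r :: "nat \<Rightarrow> nat" where r: "strict_mono r" "AE z in lborel. (\<lambda>k. \<Sum>i<N. \<bar>D i (r k) z\<bar>) \<longlonglongrightarrow> 0"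
    using tendsto_L1_AE_subseq[of lborel "\<lambda>k z. \<Sum>i<N. \<bar>D i k z\<bar>"] by auto
  have "AE z in lborel. \<forall>i<N. (\<lambda>k. mollify cylinder_bump ((e \<circ> r) k) (f i) z) \<longlonglongrightarrow> bump_mass TYPE('n) * f i z"
    using r(2)
  proof eventually_elim
    case (elim z)
    show ?case
    proof (intro allI impI)
      fix i assume "i < N"
      then have "norm (D i (r k) z) \<le> (\<Sum>i<N. \<bar>D i (r k) z\<bar>)" for k
        using member_le_sum[of i "{..<N}" "\<lambda>i. \<bar>D i (r k) z\<bar>"] by simp
      then have "(\<lambda>k. D i (r k) z) \<longlonglongrightarrow> 0"
        by (intro Lim_null_comparison[OF _ elim] always_eventually) simp
      then have "(\<lambda>k. D i (r k) z + bump_mass TYPE('n) * f i z) \<longlonglongrightarrow> 0 + bump_mass TYPE('n) * f i z"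
        by (intro tendsto_add tendsto_const)
      then show "(\<lambda>k. mollify cylinder_bump ((e \<circ> r) k) (f i) z) \<longlonglongrightarrow> bump_mass TYPE('n) * f i z"
        by (simp add: D_def)
    qed
  qed
  moreover have "(e \<circ> r) \<longlonglongrightarrow> 0" using LIMSEQ_subseq_LIMSEQ[OF e(2) r(1)] .
  ultimately show ?thesis using e(1) by (intro exI[of _ "e \<circ> r"]) auto
qed

lemma tnorm_cong: "(\<And>i. i < N \<Longrightarrow> v i = w i) \<Longrightarrow> tnorm N v = tnorm N w"
  unfolding tnorm_def by (rule L2_set_cong) auto

lemma tnorm_diff_le: 
  fixes v w :: "nat \<Rightarrow> 'b::real_normed_vector"
  shows "tnorm N (\<lambda>i. v i - w i) \<le> tnorm N v + tnorm N w"
proof -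
  have "tnorm N (\<lambda>i. v i - w i) \<le> L2_set (\<lambda>i. norm (v i) + norm (w i)) {..<N}"
    unfolding tnorm_def by (rule L2_set_mono) (auto intro: norm_triangle_ineq4)
  also have "\<dots> \<le> tnorm N v + tnorm N w" unfolding tnorm_def by (rule L2_set_triangle_ineq)
  finally show ?thesis .
qed

section \<open>The oscillation estimate\<close>

text \<open>
  The factor of \<rho> in avg_estimate with \<Lambda> = L + 1, divided by the mass of the
  kernel.
\<close>

definition osc_const :: "'n::finite itself \<Rightarrow> real \<Rightarrow> real" where
  "osc_const _ L = (2 + 32 * (L + 1)) * unit_ball_vol (real CARD('n)) / bump_mass TYPE('n)"

lemma osc_const_pos: "L > 0 \<Longrightarrow> osc_const TYPE('n::finite) L > 0"
  using bump_mass_pos[where ?'n = 'n] unfolding osc_const_def by (intro divide_pos_pos mult_pos_pos) auto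

context parabolic_system
begin

text \<open>
  By Cauchy-Schwarz the weighted sums of the rows of Du and of A(z,Du) - F are bounded by the
  Euclidean norms |Du| and L |Du| + |F|, both of which are controlled by g. No factor depending
  on N is lost here.
\<close>

lemma weighted_sum_scalar_equation:
  assumes w: "tnorm N w \<le> 1"
  shows "scalar_equation x0 t0 \<rho> (L + 1) (\<lambda>z. \<Sum>i<N. w i * rep_u i z) g
    (\<lambda>z. \<Sum>i<N. w i *\<^sub>R rep_Du i z) (\<lambda>z. \<Sum>i<N. w i *\<^sub>R (rep_A i z - rep_F i z))"
proof
  show "\<rho> > 0" "0 \<le> L + 1" using \<rho> L by auto
  show "integrable lborel (\<lambda>z. \<Sum>i<N. w i * rep_u i z)" "integrable lborel (\<lambda>z. \<Sum>i<N. w i *\<^sub>R rep_Du i z)"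
    "integrable lborel (\<lambda>z. \<Sum>i<N. w i *\<^sub>R (rep_A i z - rep_F i z))"
    using reps by (auto intro!: Bochner_Integration.integrable_sum)
  show "g \<in> borel_measurable lebesgue" using integrable_g by auto
next
  fix j p r assume p: "test_function B2 p" and r: "test_function J r"
  have i1: "integrable lborel (\<lambda>z. rep_u i z * (grad p (fst z) $ j * r (snd z)))" if "i < N" for i
    by (rule integrable_test_product[OF rep_u(1)[OF that] test_function_grad[OF p] r])
  have i2: "integrable lborel (\<lambda>z. p (fst z) * r (snd z) * rep_Du i z $ j)" if "i < N" for i
    using integrable_test_product[OF integrable_rep_nth(1)[OF that] p r, of j]
    by (simp add: mult_ac)
  have "(LBINT z. (\<Sum>i<N. w i * rep_u i z) * (grad p (fst z) $ j * r (snd z)))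
     = (LBINT z. (\<Sum>i<N. w i * (rep_u i z * (grad p (fst z) $ j * r (snd z)))))"
    by (simp add: sum_distrib_right mult.assoc)
  also have "\<dots> = (\<Sum>i<N. w i * (LBINT z. rep_u i z * (grad p (fst z) $ j * r (snd z))))"
    using i1 by (subst Bochner_Integration.integral_sum) auto
  also have "\<dots> = - (\<Sum>i<N. w i * (LBINT z. p (fst z) * r (snd z) * rep_Du i z $ j))"
    by (simp add: weak_grad_component[OF _ p r] sum_negf)
  also have "(\<Sum>i<N. w i * (LBINT z. p (fst z) * r (snd z) * rep_Du i z $ j))
     = (LBINT z. (\<Sum>i<N. w i * (p (fst z) * r (snd z) * rep_Du i z $ j)))"
    using i2 by (subst Bochner_Integration.integral_sum) auto
  also have "\<dots> = (LBINT z. p (fst z) * r (snd z) * (\<Sum>i<N. w i *\<^sub>R rep_Du i z) $ j)"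
    by (simp add: sum_distrib_left mult_ac)
  finally show "(LBINT z. (\<Sum>i<N. w i * rep_u i z) * (grad p (fst z) $ j * r (snd z)))
     = - (LBINT z. p (fst z) * r (snd z) * (\<Sum>i<N. w i *\<^sub>R rep_Du i z) $ j)" .
next
  fix p r assume p: "test_function B2 p" and r: "test_function J r"
  have i1: "integrable lborel (\<lambda>z. rep_u i z * (p (fst z) * deriv r (snd z)))" if "i < N" for i
    by (rule integrable_test_product[OF rep_u(1)[OF that] p test_function_deriv(1)[OF r]])
  have i2: "integrable lborel (\<lambda>z. r (snd z) * (grad p (fst z) \<bullet> (rep_A i z - rep_F i z)))" if "i < N" for i
    by (rule integrable_test_inner[OF _ p r]) (use integrable_rep_nth(2,3)[OF that] in auto)
  have "(LBINT z. (\<Sum>i<N. w i * rep_u i z) * (p (fst z) * deriv r (snd z)))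
     = (LBINT z. (\<Sum>i<N. w i * (rep_u i z * (p (fst z) * deriv r (snd z)))))"
    by (simp add: sum_distrib_right mult.assoc)
  also have "\<dots> = (\<Sum>i<N. w i * (LBINT z. rep_u i z * (p (fst z) * deriv r (snd z))))"
    using i1 by (subst Bochner_Integration.integral_sum) auto
  also have "\<dots> = (\<Sum>i<N. w i * (LBINT z. r (snd z) * (grad p (fst z) \<bullet> (rep_A i z - rep_F i z))))"
    by (simp add: weak_eq_component[OF _ p r])
  also have "\<dots> = (LBINT z. (\<Sum>i<N. w i * (r (snd z) * (grad p (fst z) \<bullet> (rep_A i z - rep_F i z)))))"
    using i2 by (subst Bochner_Integration.integral_sum) auto
  also have "\<dots> = (LBINT z. r (snd z) * (grad p (fst z) \<bullet> (\<Sum>i<N. w i *\<^sub>R (rep_A i z - rep_F i z))))"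
    by (simp add: inner_sum_right sum_distrib_left mult_ac)
  finally show "(LBINT z. (\<Sum>i<N. w i * rep_u i z) * (p (fst z) * deriv r (snd z)))
     = (LBINT z. r (snd z) * (grad p (fst z) \<bullet> (\<Sum>i<N. w i *\<^sub>R (rep_A i z - rep_F i z))))" .
next
  have "AE z in lborel. \<forall>i\<in>{..<N}. rep_Du i z = (if z \<in> Q2 then Du z i else 0)"
    by (rule AE_finite_allI[OF finite_lessThan rep_Du(2)], simp)
  then show "AE z in lborel. norm (\<Sum>i<N. w i *\<^sub>R rep_Du i z) \<le> g z"
  proof eventually_elim
    case (elim z)
    show ?case
    proof (cases "z \<in> Q2")
      case True
      then have "(\<Sum>i<N. w i *\<^sub>R rep_Du i z) = (\<Sum>i<N. w i *\<^sub>R Du z i)"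
        using elim by (intro sum.cong) auto
      then show ?thesis
        using norm_weighted_sum_le[OF w, of "Du z"] tnorm_nonneg[of N "F z"] True by (simp add: g_def)
    next
      case False
      then show ?thesis using elim by (simp add: g_def)
    qed
  qed
  have "AE z in lborel. \<forall>i\<in>{..<N}. rep_A i z = (if z \<in> Q2 then A z (Du z) i else 0)"
    "AE z in lborel. \<forall>i\<in>{..<N}. rep_F i z = (if z \<in> Q2 then F z i else 0)"
    by (rule AE_finite_allI[OF finite_lessThan rep_A(2)], simp, rule AE_finite_allI[OF finite_lessThan rep_F(2)], simp)
  moreover have "AE z in lborel. z \<in> Q2 \<longrightarrow> tnorm N (A z (Du z)) \<le> L * tnorm N (Du z)"
    using field_bound by (simp only: AE_completion_iff)
  ultimately show "AE z in lborel. norm (\<Sum>i<N. w i *\<^sub>R (rep_A i z - rep_F i z)) \<le> (L + 1) * g z"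
  proof eventually_elim
    case (elim z)
    show ?case
    proof (cases "z \<in> Q2")
      case True
      then have "norm (\<Sum>i<N. w i *\<^sub>R (rep_A i z - rep_F i z)) = norm (\<Sum>i<N. w i *\<^sub>R (A z (Du z) i - F z i))"
        using elim by (intro arg_cong[of _ _ norm] sum.cong) auto
      also have "\<dots> \<le> tnorm N (\<lambda>i. A z (Du z) i - F z i)"
        by (rule norm_weighted_sum_le[OF w])
      also have "\<dots> \<le> tnorm N (A z (Du z)) + tnorm N (F z)" by (rule tnorm_diff_le)
      also have "\<dots> \<le> L * tnorm N (Du z) + tnorm N (F z)" using elim True by simp
      also have "\<dots> \<le> (L + 1) * (tnorm N (Du z) + tnorm N (F z))"
        using L tnorm_nonneg[of N "Du z"] tnorm_nonneg[of N "F z"] by (simp add: algebra_simps)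
      finally show ?thesis using True by (simp add: g_def)
    next
      case False
      then show ?thesis using elim by (simp add: g_def)
    qed
  qed
qed

text \<open>
  For each weight vector the scalar estimate holds for all small scales with a constant
  independent of the scale, and it passes to the limit at points of convergence; the supremum
  over the weights gives the norm.
\<close>

lemma pointwise_time_difference:
  assumes e: "\<And>k. e k > 0" "e \<longlonglongrightarrow> 0"
    and conv: "\<And>i. i < N \<Longrightarrow> (\<lambda>k. mollify cylinder_bump (e k) (rep_u i) (x, s)) \<longlonglongrightarrow> bump_mass TYPE('n) * rep_u i (x, s)"
      "\<And>i. i < N \<Longrightarrow> (\<lambda>k. mollify cylinder_bump (e k) (rep_u i) (x, t)) \<longlonglongrightarrow> bump_mass TYPE('n) * rep_u i (x, t)"
    and x: "x \<in> ball x0 \<rho>" and st: "s \<in> time_interval t0 \<rho>" "t \<in> time_interval t0 \<rho>"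
    and M: "strong_maximal g (x, s) \<le> ennreal m1" "0 \<le> m1" "strong_maximal g (x, t) \<le> ennreal m2" "0 \<le> m2"
  shows "tnorm N (\<lambda>i. rep_u i (x, s) - rep_u i (x, t)) \<le> osc_const TYPE('n) L * \<rho> * (m1 + m2)"
proof (rule tnorm_le_by_duality)
  fix w :: "nat \<Rightarrow> real" assume w: "tnorm N w \<le> 1"
  let ?m = "bump_mass TYPE('n)"
  interpret W: scalar_equation x0 t0 \<rho> "L + 1" "\<lambda>z. \<Sum>i<N. w i * rep_u i z" g
    "\<lambda>z. \<Sum>i<N. w i *\<^sub>R rep_Du i z" "\<lambda>z. \<Sum>i<N. w i *\<^sub>R (rep_A i z - rep_F i z)"
    by (rule weighted_sum_scalar_equation[OF w])
  define C where "C = (2 + 32 * (L + 1)) * unit_ball_vol (real CARD('n)) * \<rho> * (m1 + m2)"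
  let ?d = "\<lambda>k. \<Sum>i<N. w i * (mollify cylinder_bump (e k) (rep_u i) (x, s) - mollify cylinder_bump (e k) (rep_u i) (x, t))"
  have "?d \<longlonglongrightarrow> (\<Sum>i<N. w i * (?m * rep_u i (x, s) - ?m * rep_u i (x, t)))"
    by (intro tendsto_sum tendsto_mult tendsto_const tendsto_diff conv) auto
  moreover have "eventually (\<lambda>k. ?d k \<le> C) sequentially"
  proof -
    have "min \<rho> (\<rho>\<^sup>2) > 0" using \<rho> by simp
    with e(2) have "eventually (\<lambda>k. e k < min \<rho> (\<rho>\<^sup>2)) sequentially" by (rule order_tendstoD)
    then show ?thesis
    proof eventually_elim
      case (elim k)
      have "?d k = W.avg (e k) (e k) x s - W.avg (e k) (e k) x t"
        unfolding W.avg_eq_mollify[OF e(1)] cylinder_bump_def[abs_def, symmetric]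
        by (subst (1 2) mollify_weighted_sum) (use rep_u(1) e(1) in \<open>auto simp: right_diff_distrib sum_subtractf\<close>)
      also have "\<dots> \<le> C"
        using W.avg_estimate[OF x st e(1) _ _ M, of k] elim by (simp add: C_def)
      finally show ?case .
    qed
  qed
  ultimately have "(\<Sum>i<N. w i * (?m * rep_u i (x, s) - ?m * rep_u i (x, t))) \<le> C"
    by (intro tendsto_upperbound[of ?d]) auto
  also have "(\<Sum>i<N. w i * (?m * rep_u i (x, s) - ?m * rep_u i (x, t))) = ?m * (\<Sum>i<N. w i * (rep_u i (x, s) - rep_u i (x, t)))"
    by (simp add: sum_distrib_left algebra_simps)
  finally have "(\<Sum>i<N. w i * (rep_u i (x, s) - rep_u i (x, t))) \<le> C / ?m"
    using bump_mass_pos[where ?'n = 'n] by (simp add: field_simps)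
  also have "C / ?m = osc_const TYPE('n) L * \<rho> * (m1 + m2)"
    by (simp add: C_def osc_const_def)
  finally show "(\<Sum>i<N. w i * (rep_u i (x, s) - rep_u i (x, t))) \<le> osc_const TYPE('n) L * \<rho> * (m1 + m2)" .
qed

text \<open>
  Fubini's theorem turns the almost everywhere statements on 2Q into statements for almost every
  t on almost every line x = const. On such a line the difference inequality holds for almost
  all pairs of times.
\<close>

lemma mean_oscillation_AE:
  "AE x in lebesgue_on (ball x0 \<rho>).
     nn_mean (time_interval t0 \<rho>) (\<lambda>t. ennreal (tnorm N (\<lambda>i. u (x, t) i - time_mean (time_interval t0 \<rho>) u x i) powr q))
     \<le> ennreal ((osc_const TYPE('n) L * \<rho>) powr q * 2 powr q * (1 + 2 powr q))
        * nn_mean (time_interval t0 \<rho>) (\<lambda>t. ennpowr (strong_maximal g (x, t)) q)"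
proof -
  let ?C = "ennreal ((osc_const TYPE('n) L * \<rho>) powr q * 2 powr q * (1 + 2 powr q))"
  define I where "I = time_interval t0 \<rho>"
  have I_eq: "I = {t0 - \<rho>\<^sup>2<..<t0 + \<rho>\<^sup>2}" by (simp add: I_def time_interval_def)
  let ?osc = "\<lambda>x. nn_mean I (\<lambda>t. ennreal (tnorm N (\<lambda>i. u (x, t) i - time_mean I u x i) powr q))"
  let ?max = "\<lambda>x. nn_mean I (\<lambda>t. ennpowr (strong_maximal g (x, t)) q)"
  let ?u = "\<lambda>x t. tnorm N (\<lambda>i. u (x, t) i - time_mean I u x i)"
  let ?v = "\<lambda>x t. tnorm N (\<lambda>i. rep_u i (x, t) - mean I (\<lambda>t. rep_u i (x, t)))"
  have [measurable]: "I \<in> sets borel" by (simp add: I_eq)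
  obtain e where e: "\<And>k. e k > (0::real)" "e \<longlonglongrightarrow> 0"
    and conv: "AE z in lborel. \<forall>i<N. (\<lambda>k. mollify cylinder_bump (e k) (rep_u i) z) \<longlonglongrightarrow> bump_mass TYPE('n) * rep_u i z"
    using mollify_AE_subsequence[of N rep_u] rep_u(1) by auto
  have "AE z in lborel. \<forall>i\<in>{..<N}. rep_u i z = (if z \<in> Q2 then u z i else 0)"
    by (rule AE_finite_allI[OF finite_lessThan rep_u(2)], simp)
  note agree = AE_lborel_swap(1)[OF this]
  have slices: "AE x in lborel. \<forall>i\<in>{..<N}. integrable lborel (\<lambda>t. rep_u i (x, t))"
    using AE_integrable_slice rep_u(1) by (intro AE_finite_allI) auto
  have "AE x in lborel. x \<in> ball x0 \<rho> \<longrightarrow>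
     ?osc x
     \<le> ?C
        * ?max x"
    using agree slices AE_lborel_swap(1)[OF conv]
  proof eventually_elim
    case (elim x)
    show ?case
    proof
      assume x: "x \<in> ball x0 \<rho>"
      define Z where "Z = {t \<in> I. \<forall>i<N. (\<lambda>k. mollify cylinder_bump (e k) (rep_u i) (x, t)) \<longlonglongrightarrow> bump_mass TYPE('n) * rep_u i (x, t)}"
      have bound: "nn_mean I (\<lambda>t. ennreal (?v x t powr q))
         \<le> ?C
          * ?max x"
        unfolding I_eq
      proof (rule mean_oscillation_bound[where Z = Z])
        show "1 < q" by (rule q)
        show "t0 - \<rho>\<^sup>2 < t0 + \<rho>\<^sup>2" "0 < osc_const TYPE('n) L * \<rho>"
          using \<rho> osc_const_pos[OF L, where ?'n = 'n] by auto
        show "(\<lambda>t. strong_maximal g (x, t)) \<in> borel_measurable borel"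
          by (rule measurable_compose[OF _ borel_measurable_strong_maximal])
             (auto intro!: borel_measurable_continuous_onI continuous_intros)
        show "AE t in lborel. t \<in> {t0 - \<rho>\<^sup>2<..<t0 + \<rho>\<^sup>2} \<longrightarrow> t \<in> Z"
          using elim(3) by eventually_elim (auto simp: Z_def I_eq)
        show "tnorm N (\<lambda>i. rep_u i (x, s) - rep_u i (x, t)) \<le> osc_const TYPE('n) L * \<rho> * (m1 + m2)"
          if "s \<in> Z" "t \<in> Z" "strong_maximal g (x, s) \<le> ennreal m1" "strong_maximal g (x, t) \<le> ennreal m2" "0 \<le> m1" "0 \<le> m2"
          for s t m1 m2
          using that e x by (intro pointwise_time_difference[of e]) (auto simp: Z_def I_def)
      qed (use elim(2) in auto)
      have inQ: "(x, t) \<in> Q2" if "t \<in> I" for t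
        using x that \<rho> by (auto simp: Q2_eq I_eq time_interval_def power_mult_distrib)
      have eq: "AE t in lborel. t \<in> I \<longrightarrow> (\<forall>i<N. u (x, t) i = rep_u i (x, t))"
        using elim(1) by eventually_elim (use inQ in auto)
      have mean_eq: "time_mean I u x i = mean I (\<lambda>t. rep_u i (x, t))" if i: "i < N" for i
      proof -
        have m: "(\<lambda>t. indicator I t *\<^sub>R rep_u i (x, t)) \<in> borel_measurable borel"
        proof (intro borel_measurable_scaleR borel_measurable_indicator)
          have "integrable lborel (\<lambda>t. rep_u i (x, t))" using elim(2) i by blast
          then show "(\<lambda>t. rep_u i (x, t)) \<in> borel_measurable borel" using borel_measurable_integrable by force
        qed simp
        have "(LINT t:I|lebesgue. u (x, t) i) = (LBINT t. indicator I t *\<^sub>R rep_u i (x, t))"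
          unfolding set_lebesgue_integral_def
          by (rule integral_lebesgue_if_AE_eq[OF m]) (use eq in eventually_elim, use i in \<open>auto simp: indicator_def\<close>)
        also have "\<dots> = (LINT t:I|lebesgue. rep_u i (x, t))"
          unfolding set_lebesgue_integral_def by (rule integral_completion[symmetric]) (use m in simp)
        finally show ?thesis by (simp add: time_mean_def mean_def)
      qed
      have "?osc x
        = nn_mean I (\<lambda>t. ennreal (?v x t powr q))"
        unfolding nn_mean_def
      proof (intro arg_cong2[of _ _ _ _ "(/)"] refl nn_integral_cong_AE)
        have "AE t in lebesgue. t \<in> I \<longrightarrow> (\<forall>i<N. u (x, t) i = rep_u i (x, t))"
          using eq by (simp only: AE_completion_iff)
        then show "AE t in lebesgue. ennreal (?u x t powr q) * indicator I t
          = ennreal (?v x t powr q) * indicator I t"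
        proof eventually_elim
          case (elim t)
          show ?case
          proof (cases "t \<in> I")
            case True
            then have "?u x t = ?v x t"
              using elim by (intro tnorm_cong) (auto simp: mean_eq)
            then show ?thesis by simp
          qed simp
        qed
      qed
      with bound show "?osc x
        \<le> ?C
          * ?max x"
        by simp
    qed
  qed
  then show ?thesis
    unfolding I_def[symmetric] by (subst AE_restrict_space_iff) (auto simp: AE_completion_iff simp del: mem_ball)
qed

end

theorem theorem5p2:
  fixes q L :: real
  assumes "1 < q" and "0 < L"
  shows "\<exists>c::real. c > 0 \<and>
    (\<forall>(N::nat) (\<nu>::real) (\<Omega>::(real^'n) set) (T::real) A F u Du.
       N \<ge> 1 \<and> 0 < \<nu> \<and> \<nu> < L \<and>
       open \<Omega> \<and> connected \<Omega> \<and> \<Omega> \<noteq> {} \<and> bounded \<Omega> \<and> 0 < T \<and>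
       caratheodory_field N (\<Omega> \<times> {0<..<T}) A \<and>
       structure_conditions N \<nu> L (\<Omega> \<times> {0<..<T}) A \<and>
       F \<in> \<Omega> \<times> {0<..<T} \<rightarrow> tuples N \<and>
       tmeasurable_on N (\<Omega> \<times> {0<..<T}) F \<and>
       in_Lq_loc N q (\<Omega> \<times> {0<..<T}) F \<and>
       Lq_loc_W1q_loc_with_gradient N q \<Omega> T u Du \<and>
       weak_solution N (\<Omega> \<times> {0<..<T}) A F u Du \<longrightarrow>
       (\<forall>x0 t0 \<rho>. \<rho> > 0 \<and>
          compactly_contained (cylinder x0 t0 (2 * \<rho>)) (\<Omega> \<times> {0<..<T}) \<longrightarrow>
          (let I = time_interval t0 \<rho>;
               g = (\<lambda>z. (tnorm N (Du z) + tnorm N (F z))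
                        * indicator (cylinder x0 t0 (2 * \<rho>)) z)
           in AE x in lebesgue_on (ball x0 \<rho>).
                nn_mean I (\<lambda>t. ennreal (tnorm N (\<lambda>i. u (x, t) i - time_mean I u x i) powr q))
                \<le> ennreal (c * measure lebesgue I powr (q / 2))
                   * nn_mean I (\<lambda>t. ennpowr (strong_maximal g (x, t)) q))))"
proof -
  define C where "C = osc_const TYPE('n) L"
  have C: "C > 0" using osc_const_pos[OF assms(2)] by (simp add: C_def)
  define c where "c = C powr q * 2 powr q * (1 + 2 powr q)"
  have c: "c > 0" using C by (simp add: c_def add_pos_pos)
  have scale: "(C * \<rho>) powr q * 2 powr q * (1 + 2 powr q) \<le> c * measure lebesgue (time_interval t0 \<rho>) powr (q / 2)"
    if \<rho>: "\<rho> > 0" for t0 \<rho>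
  proof -
    \<comment> \<open>|I| = 2 \<rho>^2, so the factor \<rho>^q is at most |I|^(q/2)\<close>
    have "measure lebesgue (time_interval t0 \<rho>) = 2 * \<rho>\<^sup>2"
      by (simp add: time_interval_def measure_def)
    moreover have "\<rho> powr q = (\<rho>\<^sup>2) powr (q / 2)"
    proof -
      have "\<rho>\<^sup>2 = \<rho> powr 2" using \<rho> by simp
      then show ?thesis by (simp only: powr_powr) simp
    qed
    moreover have "(\<rho>\<^sup>2) powr (q / 2) \<le> (2 * \<rho>\<^sup>2) powr (q / 2)"
      using \<rho> assms(1) by (intro powr_mono2) auto
    ultimately have "\<rho> powr q \<le> measure lebesgue (time_interval t0 \<rho>) powr (q / 2)" by simp
    then have "c * \<rho> powr q \<le> c * measure lebesgue (time_interval t0 \<rho>) powr (q / 2)"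
      using c by (intro mult_left_mono) auto
    moreover have "(C * \<rho>) powr q * 2 powr q * (1 + 2 powr q) = c * \<rho> powr q"
      using C \<rho> by (simp add: c_def powr_mult)
    ultimately show ?thesis by simp
  qed
  show ?thesis
  proof (intro exI[of _ c] conjI allI impI c, goal_cases)
    case (1 N \<nu> \<Omega> T A F u Du x0 t0 \<rho>)
    interpret parabolic_system N q \<nu> L \<Omega> T A F u Du x0 t0 \<rho>
      by unfold_locales (use 1 assms in blast)+
    show ?case
      unfolding Let_def g_def[abs_def, symmetric]
      using mean_oscillation_AE
    proof eventually_elim
      case (elim x)
      show ?case
        by (rule order_trans[OF elim mult_right_mono[OF ennreal_leI[OF scale[OF \<rho>, unfolded C_def]]]]) simp
    qed
  qed
qed

end
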